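(* Let $a,b,d>0$, $\eta\in\mathbb{R}\setminus\{0\}$ and $c<0$, and suppose $a>-\dfrac{\eta^2}{c}$. Consider the one-dimensional quasi-static problem on $[0,1]$: $$c\,u_{xxxx}=\eta\,\theta_{xx},\qquad a\,\theta_t=b\,\theta_{xx}-d\,\theta_{xxxx}-\eta\,u_{xxt},$$ with boundary conditions $u=u_{xx}=\theta=\theta_{xx}=0$ at $x=0$ and $x=1$, and initial condition $\theta(x,0)=\theta^0(x)$. Then: 1. For every initial datum $\theta^0\in L^2(0,1)$ there is a solution $(u,\theta)$, and it is analytic with respect to time (for $t>0$). 2. The solutions decay exponentially: there exist constants $M,\omega>0$, independent of $\theta^0$, such that $\|\theta(t)\|_{L^2(0,1)}+\|u(t)\|_{H^2(0,1)}\le Me^{-\omega t}\|\theta^0\|_{L^2(0,1)}$ for all $t>0$.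
   Context: Let $H_*^4(0,1)=\{w\in H^4(0,1): w=w_{xx}=0\text{ at }x=0,1\}$. A solution is a pair $(u,\theta)$ with $\theta\in C([0,\infty);L^2(0,1))\cap C^1((0,\infty);L^2(0,1))$, $u\in C^1((0,\infty);H^2(0,1))$, $\theta(t),u(t)\in H_*^4(0,1)$ for every $t>0$, satisfying both equations in $L^2(0,1)$ for every $t>0$ and $\theta(0)=\theta^0$. Analytic with respect to time means that $t\mapsto\theta(t)\in L^2(0,1)$ and $t\mapsto u(t)\in H^2(0,1)$ are real-analytic on $(0,\infty)$. *)

theory Defs
  imports "HOL-Analysis.Analysis"
begin

text \<open>
  Elements of the Lebesgue and Sobolev spaces over the interval from 0 to 1 are represented by real
  functions; what happens outside the interval is irrelevant, and functions that agree almost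
  everywhere on it are identified: every notion below is invariant under such changes, and
  equality in \<open>L2\<close> is written as almost-everywhere equality.
\<close>

abbreviation unit_measure :: "real measure" where
  "unit_measure \<equiv> lebesgue_on {0<..<1}"

definition L2 :: "(real \<Rightarrow> real) set" where
  "L2 = {f \<in> borel_measurable unit_measure. integrable unit_measure (\<lambda>x. (f x)\<^sup>2)}"

definition L2_norm :: "(real \<Rightarrow> real) \<Rightarrow> real" where
  "L2_norm f = sqrt (LINT x|unit_measure. (f x)\<^sup>2)"

definition test_functions :: "(real \<Rightarrow> real) set" where
  "test_functions =
     {\<phi>. (\<forall>n x. (deriv ^^ n) \<phi> differentiable (at x)) \<and>
         compact (closure {x. \<phi> x \<noteq> 0}) \<and> closure {x. \<phi> x \<noteq> 0} \<subseteq> {0<..<1}}"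

definition has_weak_deriv :: "nat \<Rightarrow> (real \<Rightarrow> real) \<Rightarrow> (real \<Rightarrow> real) \<Rightarrow> bool" where
  "has_weak_deriv k f g \<longleftrightarrow>
     (\<forall>\<phi>\<in>test_functions.
        (LINT x|unit_measure. f x * (deriv ^^ k) \<phi> x) =
        (-1) ^ k * (LINT x|unit_measure. g x * \<phi> x))"

text \<open>The choice below is determined up to a null set whenever a square-integrable weak derivative exists.\<close>

definition weak_deriv :: "nat \<Rightarrow> (real \<Rightarrow> real) \<Rightarrow> real \<Rightarrow> real" where
  "weak_deriv k f = (SOME g. g \<in> L2 \<and> has_weak_deriv k f g)"

definition Sobolev :: "nat \<Rightarrow> (real \<Rightarrow> real) set" where
  "Sobolev k = {f \<in> L2. \<forall>j\<le>k. \<exists>g\<in>L2. has_weak_deriv j f g}"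

definition Sobolev_norm :: "nat \<Rightarrow> (real \<Rightarrow> real) \<Rightarrow> real" where
  "Sobolev_norm k f = sqrt (\<Sum>j\<le>k. (L2_norm (weak_deriv j f))\<^sup>2)"

text \<open>Boundary values are those of the (unique) representative that is continuous on the closed interval.\<close>

definition vanishes_at :: "(real \<Rightarrow> real) \<Rightarrow> real \<Rightarrow> bool" where
  "vanishes_at f y \<longleftrightarrow>
     (\<exists>g. continuous_on {0..1} g \<and> (AE x in unit_measure. f x = g x) \<and> g y = 0)"

definition H4_star :: "(real \<Rightarrow> real) set" where
  "H4_star = {w \<in> Sobolev 4. \<forall>y\<in>{0, 1}. vanishes_at w y \<and> vanishes_at (weak_deriv 2 w) y}"

text \<open>
  Regularity in time of curves \<open>f\<close> with values in a function space \<open>X\<close> with seminorm \<open>N\<close>.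
  The library's notions for normed spaces need the quotient by null functions as a type.
\<close>

definition continuous_curve ::
  "(real \<Rightarrow> real) set \<Rightarrow> ((real \<Rightarrow> real) \<Rightarrow> real) \<Rightarrow> real set \<Rightarrow> (real \<Rightarrow> real \<Rightarrow> real) \<Rightarrow> bool" where
  "continuous_curve X N S f \<longleftrightarrow>
     (\<forall>t\<in>S. f t \<in> X) \<and>
     (\<forall>t\<in>S. ((\<lambda>s. N (\<lambda>x. f s x - f t x)) \<longlongrightarrow> 0) (at t within S))"

definition has_curve_deriv ::
  "((real \<Rightarrow> real) \<Rightarrow> real) \<Rightarrow> (real \<Rightarrow> real \<Rightarrow> real) \<Rightarrow> (real \<Rightarrow> real) \<Rightarrow> real \<Rightarrow> bool" where
  "has_curve_deriv N f g t \<longleftrightarrow>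
     ((\<lambda>s. N (\<lambda>x. (f s x - f t x) / (s - t) - g x)) \<longlongrightarrow> 0) (at t)"

definition C1_curve_with_deriv ::
  "(real \<Rightarrow> real) set \<Rightarrow> ((real \<Rightarrow> real) \<Rightarrow> real) \<Rightarrow> real set \<Rightarrow>
     (real \<Rightarrow> real \<Rightarrow> real) \<Rightarrow> (real \<Rightarrow> real \<Rightarrow> real) \<Rightarrow> bool" where
  "C1_curve_with_deriv X N S f f' \<longleftrightarrow>
     (\<forall>t\<in>S. f t \<in> X \<and> has_curve_deriv N f (f' t) t) \<and> continuous_curve X N S f'"

definition analytic_curve ::
  "(real \<Rightarrow> real) set \<Rightarrow> ((real \<Rightarrow> real) \<Rightarrow> real) \<Rightarrow> real set \<Rightarrow> (real \<Rightarrow> real \<Rightarrow> real) \<Rightarrow> bool" where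
  "analytic_curve X N S f \<longleftrightarrow>
     (\<forall>t\<in>S. f t \<in> X) \<and>
     (\<forall>t\<in>S. \<exists>r>0. \<exists>q :: nat \<Rightarrow> real \<Rightarrow> real. (\<forall>n. q n \<in> X) \<and>
        (\<forall>s\<in>S. \<bar>s - t\<bar> < r \<longrightarrow>
           (\<lambda>m. N (\<lambda>x. f s x - (\<Sum>n<m. (s - t) ^ n * q n x))) \<longlonglongrightarrow> 0))"

text \<open>
  In the second equation \<open>\<theta>' t\<close> is the derivative of \<open>\<theta>\<close> in \<open>L2\<close>, and \<open>u' t\<close> that of \<open>u\<close> in
  \<open>Sobolev 2\<close>, so that the mixed derivative of \<open>u\<close> is the second weak derivative of \<open>u' t\<close>.
\<close>

definition is_solution ::
  "real \<Rightarrow> real \<Rightarrow> real \<Rightarrow> real \<Rightarrow> real \<Rightarrow> (real \<Rightarrow> real) \<Rightarrow>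
     (real \<Rightarrow> real \<Rightarrow> real) \<Rightarrow> (real \<Rightarrow> real \<Rightarrow> real) \<Rightarrow> bool" where
  "is_solution a b c d \<eta> \<theta>0 u \<theta> \<longleftrightarrow>
     continuous_curve L2 L2_norm {0..} \<theta> \<and>
     (\<forall>t>0. \<theta> t \<in> H4_star \<and> u t \<in> H4_star) \<and>
     (AE x in unit_measure. \<theta> 0 x = \<theta>0 x) \<and>
     (\<exists>\<theta>' u'.
        C1_curve_with_deriv L2 L2_norm {0<..} \<theta> \<theta>' \<and>
        C1_curve_with_deriv (Sobolev 2) (Sobolev_norm 2) {0<..} u u' \<and>
        (\<forall>t>0.
           (AE x in unit_measure. c * weak_deriv 4 (u t) x = \<eta> * weak_deriv 2 (\<theta> t) x) \<and>
           (AE x in unit_measure.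
              a * \<theta>' t x =
                b * weak_deriv 2 (\<theta> t) x - d * weak_deriv 4 (\<theta> t) x
                - \<eta> * weak_deriv 2 (u' t) x)))"

end

theory Submission
  imports Defs "HOL-Computational_Algebra.Polynomial"
begin

text \<open>
  Integrating the first equation twice gives \<open>u\<^sub>x\<^sub>x = (\<eta> / c) \<theta>\<close>, so the second one becomes
  \<open>(a + \<eta>\<^sup>2 / c) \<theta>\<^sub>t = b \<theta>\<^sub>x\<^sub>x - d \<theta>\<^sub>x\<^sub>x\<^sub>x\<^sub>x\<close>, whose leading coefficient is positive by assumption.
  The boundary conditions make it diagonal in the sine basis: the \<open>n\<close>-th coefficient of \<open>\<theta>\<close> is
  multiplied by \<open>exp (- r\<^sub>n t)\<close>, where \<open>(a + \<eta>\<^sup>2 / c) r\<^sub>n = b k\<^sup>2 + d k\<^sup>4\<close> for the frequency \<open>k = (n + 1) \<pi>\<close>.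
  Existence and analyticity follow from Parseval's identity and dominated convergence of series.
  For the decay of an arbitrary solution one shows that its coefficients satisfy these ordinary
  differential equations; this rests on the integration by parts of weak derivatives against sines,
  where the boundary conditions enter.
\<close>

section \<open>Square-integrable functions on the unit interval\<close>

text \<open>Weak derivatives are tested only with functions supported inside the open interval, and
  sines are not among them. Smooth cutoffs bridge this gap; their derivatives concentrate at the end
  points, and this is where the boundary conditions act. Sobolev functions are known only up to null
  sets, so the equations are compared through sine coefficients. Completeness of the sines therefore
  comes early: it gives Parseval's identity, and through it even the uniqueness of weak derivatives.
  For an arbitrary solution no boundary values of the time derivative of \<open>u\<close> are given.
  The coefficients of its second derivative are found by differentiating in time the relation
  between the coefficients of \<open>u\<close> and \<open>\<theta>\<close>. The decay exponent
  \<open>b / (a + \<eta>\<^sup>2 / c)\<close> bounds all rates from below because every frequency is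
  at least 1. In the constant \<open>1 + 2 * \<bar>\<eta> / c\<bar>\<close> the first term accounts
  for the temperature, the second for the displacement.\<close>

definition L2_inner :: "(real \<Rightarrow> real) \<Rightarrow> (real \<Rightarrow> real) \<Rightarrow> real" where
  "L2_inner f g = (LINT x|unit_measure. f x * g x)"

lemma finite_unit_measure: "finite_measure unit_measure"
  by (rule finite_measure_lebesgue_on) simp

lemma measure_unit_measure: "measure unit_measure {0<..<1} = 1"
  by (simp add: measure_restrict_space)

lemma AE_unit_measureI: "(\<And>x. 0 < x \<Longrightarrow> x < 1 \<Longrightarrow> P x) \<Longrightarrow> AE x in unit_measure. P x"
  by (rule AE_I2) simp

lemma borel_measurable_continuous_unit:
  fixes f :: "real \<Rightarrow> real"
  assumes "continuous_on {0<..<1} f"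
  shows "f \<in> borel_measurable unit_measure"
  using assms by (intro continuous_imp_measurable_on_sets_lebesgue) auto

lemma integrable_unit_bounded:
  fixes f :: "real \<Rightarrow> real"
  assumes "f \<in> borel_measurable unit_measure" "\<And>x. 0 < x \<Longrightarrow> x < 1 \<Longrightarrow> \<bar>f x\<bar> \<le> B"
  shows "integrable unit_measure f"
  by (rule finite_measure.integrable_const_bound[OF finite_unit_measure, of _ B])
     (use assms in \<open>auto intro: AE_unit_measureI\<close>)

lemma LINT_unit_measure_const: "(LINT x|unit_measure. (c::real)) = c"
  using measure_unit_measure by simp

lemma LINT_unit_measure_le_const:
  fixes f :: "real \<Rightarrow> real"
  assumes "integrable unit_measure f" "\<And>x. 0 < x \<Longrightarrow> x < 1 \<Longrightarrow> f x \<le> B"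
  shows "(LINT x|unit_measure. f x) \<le> B"
proof -
  interpret finite_measure unit_measure by (rule finite_unit_measure)
  have "(LINT x|unit_measure. f x) \<le> (LINT x|unit_measure. B)"
    by (intro integral_mono_AE assms AE_unit_measureI) auto
  then show ?thesis unfolding LINT_unit_measure_const .
qed

lemma L2_measurable: "f \<in> L2 \<Longrightarrow> f \<in> borel_measurable unit_measure"
  by (simp add: L2_def)

lemma L2_mult_integrable:
  assumes "f \<in> L2" "g \<in> L2"
  shows "integrable unit_measure (\<lambda>x. f x * g x)"
proof (rule Bochner_Integration.integrable_bound)
  show "integrable unit_measure (\<lambda>x. (f x)\<^sup>2 + (g x)\<^sup>2)"
    using assms by (simp add: L2_def)
  show "(\<lambda>x. f x * g x) \<in> borel_measurable unit_measure"
    using assms by (simp add: L2_def borel_measurable_times)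
  have "\<bar>a * b\<bar> \<le> a\<^sup>2 + b\<^sup>2" for a b :: real
  proof -
    have "2 * \<bar>a * b\<bar> \<le> a\<^sup>2 + b\<^sup>2"
      using sum_squares_bound[of "\<bar>a\<bar>" "\<bar>b\<bar>"] by (simp add: abs_mult)
    then show ?thesis using abs_ge_zero[of "a * b"] by linarith
  qed
  then show "AE x in unit_measure. norm (f x * g x) \<le> norm ((f x)\<^sup>2 + (g x)\<^sup>2)"
    by (auto intro!: AE_I2)
qed

lemma L2_bounded:
  assumes "f \<in> borel_measurable unit_measure" "\<And>x. 0 < x \<Longrightarrow> x < 1 \<Longrightarrow> \<bar>f x\<bar> \<le> B"
  shows "f \<in> L2"
proof -
  have "(f x)\<^sup>2 \<le> B\<^sup>2" if "0 < x" "x < 1" for x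
    using power_mono[OF assms(2)[OF that], of 2] by simp
  then have "integrable unit_measure (\<lambda>x. (f x)\<^sup>2)"
    by (intro integrable_unit_bounded[where B="B\<^sup>2"]) (use assms in auto)
  then show ?thesis using assms by (simp add: L2_def)
qed

lemma continuous_on_unit_bounded:
  fixes f :: "real \<Rightarrow> real"
  assumes "continuous_on {0..1} f"
  obtains B where "B > 0" "\<And>x. 0 \<le> x \<Longrightarrow> x \<le> 1 \<Longrightarrow> \<bar>f x\<bar> \<le> B"
proof -
  have "bounded (f ` {0..1})"
    using assms compact_continuous_image compact_imp_bounded by blast
  then obtain B where "B > 0" "\<And>y. y \<in> f ` {0..1} \<Longrightarrow> norm y \<le> B"
    by (meson bounded_pos)
  then show thesis by (intro that[of B]) auto
qed

lemma L2_continuous: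
  assumes "continuous_on {0..1} f"
  shows "f \<in> L2"
proof -
  obtain B where "\<And>x. 0 \<le> x \<Longrightarrow> x \<le> 1 \<Longrightarrow> \<bar>f x\<bar> \<le> B"
    using continuous_on_unit_bounded[OF assms] by blast
  moreover have "f \<in> borel_measurable unit_measure"
    by (intro borel_measurable_continuous_unit continuous_on_subset[OF assms]) auto
  ultimately show ?thesis by (intro L2_bounded[where B=B]) auto
qed

lemma L2_const: "(\<lambda>x. c) \<in> L2"
  by (intro L2_continuous continuous_intros)

lemma L2_integrable: "f \<in> L2 \<Longrightarrow> integrable unit_measure f"
  using L2_mult_integrable[OF _ L2_const[of 1]] by simp

lemma L2_cmult: "f \<in> L2 \<Longrightarrow> (\<lambda>x. c * f x) \<in> L2"
  by (simp add: L2_def power_mult_distrib borel_measurable_times)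

lemma L2_add:
  assumes "f \<in> L2" "g \<in> L2"
  shows "(\<lambda>x. f x + g x) \<in> L2"
proof -
  have "integrable unit_measure (\<lambda>x. (f x)\<^sup>2 + (g x)\<^sup>2 + 2 * (f x * g x))"
    using assms L2_mult_integrable[OF assms] by (auto simp: L2_def)
  then show ?thesis
    using assms by (simp add: L2_def power2_sum mult.assoc borel_measurable_add)
qed

lemma L2_diff: "f \<in> L2 \<Longrightarrow> g \<in> L2 \<Longrightarrow> (\<lambda>x. f x - g x) \<in> L2"
  using L2_add[OF _ L2_cmult[of g "-1"]] by simp

lemma L2_sum: "(\<And>i. i \<in> I \<Longrightarrow> f i \<in> L2) \<Longrightarrow> (\<lambda>x. \<Sum>i\<in>I. f i x) \<in> L2"
  by (induction I rule: infinite_finite_induct) (auto intro: L2_add simp: L2_const)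

lemma L2_mult_bounded:
  assumes "f \<in> L2" "h \<in> borel_measurable unit_measure" "\<And>x. 0 < x \<Longrightarrow> x < 1 \<Longrightarrow> \<bar>h x\<bar> \<le> B"
  shows "(\<lambda>x. f x * h x) \<in> L2"
proof -
  have "integrable unit_measure (\<lambda>x. (f x * h x)\<^sup>2)"
  proof (rule Bochner_Integration.integrable_bound)
    show "integrable unit_measure (\<lambda>x. B\<^sup>2 * (f x)\<^sup>2)" "(\<lambda>x. (f x * h x)\<^sup>2) \<in> borel_measurable unit_measure"
      using assms by (auto simp: L2_def)
    have "(f x * h x)\<^sup>2 \<le> B\<^sup>2 * (f x)\<^sup>2" if "0 < x" "x < 1" for x
    proof -
      have "(h x)\<^sup>2 \<le> B\<^sup>2" using power_mono[OF assms(3)[OF that], of 2] by simp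
      then show ?thesis by (simp add: power_mult_distrib mult.commute[of _ "(f x)\<^sup>2"] mult_left_mono)
    qed
    then show "AE x in unit_measure. norm ((f x * h x)\<^sup>2) \<le> norm (B\<^sup>2 * (f x)\<^sup>2)"
      by (auto intro!: AE_unit_measureI)
  qed
  then show ?thesis using assms by (simp add: L2_def borel_measurable_times)
qed

lemma L2_mult_continuous:
  assumes "f \<in> L2" "continuous_on {0..1} h"
  shows "(\<lambda>x. f x * h x) \<in> L2"
proof -
  obtain B where "\<And>x. 0 \<le> x \<Longrightarrow> x \<le> 1 \<Longrightarrow> \<bar>h x\<bar> \<le> B"
    using continuous_on_unit_bounded[OF assms(2)] by blast
  then show ?thesis
    by (intro L2_mult_bounded[where B=B] assms borel_measurable_continuous_unit
        continuous_on_subset[OF assms(2)]) auto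
qed

section \<open>Inner product, norm and the Cauchy-Schwarz inequality\<close>

lemma L2_inner_commute: "L2_inner f g = L2_inner g f"
  by (simp add: L2_inner_def mult.commute)

lemma L2_inner_add_left:
  "f \<in> L2 \<Longrightarrow> g \<in> L2 \<Longrightarrow> h \<in> L2 \<Longrightarrow> L2_inner (\<lambda>x. f x + g x) h = L2_inner f h + L2_inner g h"
  by (simp add: L2_inner_def distrib_right L2_mult_integrable)

lemma L2_inner_diff_left:
  "f \<in> L2 \<Longrightarrow> g \<in> L2 \<Longrightarrow> h \<in> L2 \<Longrightarrow> L2_inner (\<lambda>x. f x - g x) h = L2_inner f h - L2_inner g h"
  by (simp add: L2_inner_def left_diff_distrib L2_mult_integrable)

lemma L2_inner_cmult_left: "L2_inner (\<lambda>x. c * f x) h = c * L2_inner f h"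
  by (simp add: L2_inner_def mult.assoc)

lemma L2_inner_sum_left:
  "(\<And>i. i \<in> I \<Longrightarrow> f i \<in> L2) \<Longrightarrow> h \<in> L2 \<Longrightarrow>
     L2_inner (\<lambda>x. \<Sum>i\<in>I. f i x) h = (\<Sum>i\<in>I. L2_inner (f i) h)"
  by (simp add: L2_inner_def sum_distrib_right L2_mult_integrable)

lemma L2_inner_add_right:
  "f \<in> L2 \<Longrightarrow> g \<in> L2 \<Longrightarrow> h \<in> L2 \<Longrightarrow> L2_inner h (\<lambda>x. f x + g x) = L2_inner h f + L2_inner h g"
  by (simp add: L2_inner_add_left L2_inner_commute[of h])

lemma L2_inner_diff_right:
  "f \<in> L2 \<Longrightarrow> g \<in> L2 \<Longrightarrow> h \<in> L2 \<Longrightarrow> L2_inner h (\<lambda>x. f x - g x) = L2_inner h f - L2_inner h g"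
  by (simp add: L2_inner_diff_left L2_inner_commute[of h])

lemma L2_inner_cmult_right: "L2_inner h (\<lambda>x. c * f x) = c * L2_inner h f"
  by (simp add: L2_inner_cmult_left L2_inner_commute[of h])

lemma L2_inner_sum_right:
  "(\<And>i. i \<in> I \<Longrightarrow> f i \<in> L2) \<Longrightarrow> h \<in> L2 \<Longrightarrow>
     L2_inner h (\<lambda>x. \<Sum>i\<in>I. f i x) = (\<Sum>i\<in>I. L2_inner h (f i))"
  by (simp add: L2_inner_sum_left L2_inner_commute[of h])

lemma L2_inner_cong_AE:
  assumes "f \<in> L2" "f' \<in> L2" "g \<in> L2" "AE x in unit_measure. f x = f' x"
  shows "L2_inner f g = L2_inner f' g"
  unfolding L2_inner_def
  by (rule Bochner_Integration.integral_cong_AE) (use assms in \<open>auto intro: borel_measurable_times dest: L2_measurable\<close>)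

lemma L2_norm_eq_sqrt_inner: "L2_norm f = sqrt (L2_inner f f)"
  by (simp add: L2_norm_def L2_inner_def power2_eq_square)

lemma L2_norm_nonneg: "L2_norm f \<ge> 0"
  by (simp add: L2_norm_def)

lemma L2_norm_square: "(L2_norm f)\<^sup>2 = L2_inner f f"
  by (simp add: L2_norm_eq_sqrt_inner L2_inner_def)

lemma L2_norm_cong_AE:
  assumes "f \<in> L2" "g \<in> L2" "AE x in unit_measure. f x = g x"
  shows "L2_norm f = L2_norm g"
  using L2_inner_cong_AE[OF assms(1,2,1,3)] L2_inner_cong_AE[OF assms(1,2,2,3)]
  by (simp add: L2_norm_eq_sqrt_inner L2_inner_commute)

lemma L2_norm_cmult: "L2_norm (\<lambda>x. c * f x) = \<bar>c\<bar> * L2_norm f"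
  by (simp add: L2_norm_eq_sqrt_inner L2_inner_cmult_left L2_inner_cmult_right real_sqrt_mult
      flip: mult.assoc power2_eq_square)

lemma L2_norm_eq_0:
  assumes "f \<in> L2" "L2_norm f = 0"
  shows "AE x in unit_measure. f x = 0"
proof -
  have "(LINT x|unit_measure. (f x)\<^sup>2) = 0" using assms(2) by (simp add: L2_norm_def)
  then have "AE x in unit_measure. (f x)\<^sup>2 = 0"
    using assms(1) by (subst (asm) integral_nonneg_eq_0_iff_AE) (auto simp: L2_def)
  then show ?thesis by simp
qed

text \<open>The polynomial \<open>?A - 2 * r * ?B + r\<^sup>2 * ?C\<close> in \<open>r\<close> is
  nonnegative. If \<open>?C = 0\<close> and \<open>?B \<noteq> 0\<close>, it would take the value -1
  at \<open>r = (?A + 1) / (2 * ?B)\<close>; if \<open>?C > 0\<close>, its minimiser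
  \<open>r = ?B / ?C\<close> gives the bound.\<close>

lemma L2_inner_le:
  assumes "f \<in> L2" "g \<in> L2"
  shows "\<bar>L2_inner f g\<bar> \<le> L2_norm f * L2_norm g"
proof -
  let ?A = "L2_inner f f" and ?B = "L2_inner f g" and ?C = "L2_inner g g"
  have nn: "L2_inner h h \<ge> 0" for h by (simp flip: L2_norm_square)
  have sq: "0 \<le> ?A - 2 * r * ?B + r\<^sup>2 * ?C" for r
  proof -
    have rg: "(\<lambda>x. r * g x) \<in> L2" by (intro L2_cmult assms)
    have "0 \<le> L2_inner (\<lambda>x. f x - r * g x) (\<lambda>x. f x - r * g x)" by (rule nn)
    also have "\<dots> = ?A - 2 * r * ?B + r\<^sup>2 * ?C"
      by (simp add: L2_inner_diff_left L2_inner_diff_right L2_inner_cmult_left L2_inner_cmult_right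
          L2_diff rg assms L2_inner_commute[of g f] power2_eq_square algebra_simps)
    finally show ?thesis .
  qed
  have "?B\<^sup>2 \<le> ?A * ?C"
  proof (cases "?C = 0")
    case True
    have "?B = 0"
    proof (rule ccontr)
      assume "?B \<noteq> 0"
      then show False using sq[of "(?A + 1) / (2 * ?B)"] True by simp
    qed
    then show ?thesis using nn by simp
  next
    case False
    then have "?C > 0" using nn[of g] by simp
    then show ?thesis using sq[of "?B / ?C"]
      by (simp add: power2_eq_square field_simps)
  qed
  then have "\<bar>?B\<bar> \<le> sqrt (?A * ?C)"
    by (metis real_sqrt_abs real_sqrt_le_iff)
  then show ?thesis by (simp add: L2_norm_eq_sqrt_inner real_sqrt_mult)
qed

lemma L2_norm_triangle:
  assumes "f \<in> L2" "g \<in> L2"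
  shows "L2_norm (\<lambda>x. f x + g x) \<le> L2_norm f + L2_norm g"
proof (rule power2_le_imp_le)
  have "(L2_norm (\<lambda>x. f x + g x))\<^sup>2 = L2_inner f f + 2 * L2_inner f g + L2_inner g g"
    using assms by (simp add: L2_norm_square L2_inner_add_left L2_inner_add_right L2_add L2_inner_commute[of g f])
  also have "\<dots> \<le> (L2_norm f + L2_norm g)\<^sup>2"
    using L2_inner_le[OF assms] by (simp add: power2_sum L2_norm_square)
  finally show "(L2_norm (\<lambda>x. f x + g x))\<^sup>2 \<le> (L2_norm f + L2_norm g)\<^sup>2" .
qed (simp add: L2_norm_nonneg)

lemma L2_norm_triangle_diff:
  assumes "f \<in> L2" "g \<in> L2" "h \<in> L2"
  shows "L2_norm (\<lambda>x. f x - h x) \<le> L2_norm (\<lambda>x. f x - g x) + L2_norm (\<lambda>x. g x - h x)"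
  using L2_norm_triangle[of "\<lambda>x. f x - g x" "\<lambda>x. g x - h x"] assms by (simp add: L2_diff)

lemma L2_norm_le_bound:
  assumes "f \<in> L2" "\<And>x. 0 < x \<Longrightarrow> x < 1 \<Longrightarrow> \<bar>f x\<bar> \<le> B" "B \<ge> 0"
  shows "L2_norm f \<le> B"
proof (rule power2_le_imp_le)
  show "(L2_norm f)\<^sup>2 \<le> B\<^sup>2"
    unfolding L2_norm_square L2_inner_def
    by (rule LINT_unit_measure_le_const)
       (use assms L2_mult_integrable[of f f] in \<open>auto simp flip: power2_eq_square intro: power2_le_iff_abs_le[THEN iffD2]\<close>)
qed (use assms in auto)

lemma LINT_unit_measure_FTC:
  fixes F f :: "real \<Rightarrow> real"
  assumes "\<And>x. 0 \<le> x \<Longrightarrow> x \<le> 1 \<Longrightarrow> (F has_real_derivative f x) (at x)" "continuous_on {0..1} f"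
  shows "(LINT x|unit_measure. f x) = F 1 - F 0"
proof -
  have "(f has_integral F 1 - F 0) {0..1}"
    by (rule fundamental_theorem_of_calculus)
       (use assms in \<open>auto simp: has_real_derivative_iff_has_vector_derivative[symmetric]
         intro: DERIV_subset\<close>)
  then have "(f has_integral F 1 - F 0) {0<..<1}"
    by (simp add: has_integral_Icc_iff_Ioo)
  then have "integral {0<..<1} f = F 1 - F 0" by (rule integral_unique)
  moreover have "integrable unit_measure f"
    using L2_integrable L2_continuous assms(2) by blast
  ultimately show ?thesis by (simp add: lebesgue_integral_eq_integral)
qed

section \<open>The sine basis\<close>

text \<open>A common majorant \<open>w\<close> of the sequence and its limit bounds the squared
  difference by \<open>4 * (w x)\<^sup>2\<close>, which is integrable because \<open>w\<close> is in
  \<open>L2\<close>.\<close>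

lemma L2_dominated_convergence:
  assumes f: "f \<in> borel_measurable unit_measure" and g: "\<And>n. g n \<in> borel_measurable unit_measure"
    and w: "w \<in> L2"
    and lim: "AE x in unit_measure. (\<lambda>n. g n x) \<longlonglongrightarrow> f x"
    and dom: "\<And>n x. 0 < x \<Longrightarrow> x < 1 \<Longrightarrow> \<bar>g n x\<bar> \<le> w x" "\<And>x. 0 < x \<Longrightarrow> x < 1 \<Longrightarrow> \<bar>f x\<bar> \<le> w x"
  shows "(\<lambda>n. L2_norm (\<lambda>x. f x - g n x)) \<longlonglongrightarrow> 0"
proof -
  have "(\<lambda>n. LINT x|unit_measure. (f x - g n x)\<^sup>2) \<longlonglongrightarrow> (LINT x|unit_measure. 0)"
  proof (rule integral_dominated_convergence)
    show "(\<lambda>x. 0::real) \<in> borel_measurable unit_measure"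
      "(\<lambda>x. (f x - g n x)\<^sup>2) \<in> borel_measurable unit_measure" for n
      by (auto intro!: borel_measurable_power borel_measurable_diff f g)
    show "integrable unit_measure (\<lambda>x. 4 * (w x)\<^sup>2)"
      using w by (simp add: L2_def)
    show "AE x in unit_measure. (\<lambda>n. (f x - g n x)\<^sup>2) \<longlonglongrightarrow> 0"
      using lim by eventually_elim (auto intro!: tendsto_eq_intros)
    show "AE x in unit_measure. norm ((f x - g n x)\<^sup>2) \<le> 4 * (w x)\<^sup>2" for n
    proof (rule AE_unit_measureI)
      fix x :: real assume x: "0 < x" "x < 1"
      have "\<bar>f x - g n x\<bar> \<le> 2 * w x" using dom(1)[OF x, of n] dom(2)[OF x] by linarith
      then have "\<bar>f x - g n x\<bar>\<^sup>2 \<le> (2 * w x)\<^sup>2" by (intro power_mono) auto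
      then show "norm ((f x - g n x)\<^sup>2) \<le> 4 * (w x)\<^sup>2" by (simp add: power_mult_distrib)
    qed
  qed
  then have "(\<lambda>n. sqrt (LINT x|unit_measure. (f x - g n x)\<^sup>2)) \<longlonglongrightarrow> sqrt 0"
    by (intro tendsto_real_sqrt) simp
  then show ?thesis by (simp add: L2_norm_def)
qed

text \<open>The shift by one makes every index a genuine mode: \<open>n = 0\<close> has frequency
  \<open>pi\<close>, and the zero function does not enter the basis.\<close>

definition freq :: "nat \<Rightarrow> real" where
  "freq n = real (Suc n) * pi"

text \<open>\<open>trig j n\<close> is the \<open>j\<close>-th derivative of the normalised sine \<open>trig 0 n\<close>.\<close>

definition trig :: "nat \<Rightarrow> nat \<Rightarrow> real \<Rightarrow> real" where
  "trig j n x = sqrt 2 * freq n ^ j * sin (freq n * x + real j * (pi / 2))"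

lemma freq_pos: "freq n > 0"
  by (simp add: freq_def)

lemma freq_ge_1: "freq n \<ge> 1"
proof -
  have "1 * 1 \<le> real (Suc n) * pi" using pi_ge_two by (intro mult_mono) auto
  then show ?thesis by (simp add: freq_def)
qed

lemma freq_ge: "freq n \<ge> real (Suc n)"
  using mult_left_mono[of 1 pi "real (Suc n)"] pi_ge_two by (simp add: freq_def)

lemma trig_0: "trig 0 n x = sqrt 2 * sin (freq n * x)"
  by (simp add: trig_def)

lemma trig_Suc_Suc: "trig (Suc (Suc j)) n x = - ((freq n)\<^sup>2 * trig j n x)"
proof -
  have "freq n * x + real (Suc (Suc j)) * (pi / 2) = (freq n * x + real j * (pi / 2)) + pi"
    by (simp add: field_simps)
  then show ?thesis unfolding trig_def by (simp only: sin_periodic_pi) (simp add: power2_eq_square)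
qed

lemma trig_2: "trig 2 n x = - ((freq n)\<^sup>2 * trig 0 n x)"
  using trig_Suc_Suc[of 0] by (simp add: numeral_2_eq_2)

lemma has_real_derivative_trig: "(trig j n has_real_derivative trig (Suc j) n x) (at x)"
proof -
  have *: "freq n * x + real (Suc j) * (pi / 2) = (freq n * x + real j * (pi / 2)) + pi / 2"
    by (simp add: field_simps)
  have "((\<lambda>x. sqrt 2 * freq n ^ j * sin (freq n * x + real j * (pi / 2))) has_real_derivative
         sqrt 2 * freq n ^ j * (cos (freq n * x + real j * (pi / 2)) * freq n)) (at x)"
    by (auto intro!: derivative_eq_intros)
  then show ?thesis
    unfolding trig_def[abs_def] * by (simp add: sin_add[of _ "pi / 2"] mult_ac)
qed

lemma continuous_on_trig: "continuous_on S (trig j n)"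
  by (meson DERIV_continuous_on has_field_derivative_at_within has_real_derivative_trig)

lemma trig_L2: "trig j n \<in> L2"
  by (intro L2_continuous continuous_on_trig)

lemma trig_0_ends: "trig 0 n 0 = 0" "trig 0 n 1 = 0"
proof -
  have "sin (freq n) = 0" unfolding freq_def by (rule sin_npi)
  then show "trig 0 n 0 = 0" "trig 0 n 1 = 0" by (auto simp: trig_0)
qed

lemma trig_bound: "\<bar>trig j n x\<bar> \<le> 2 * freq n ^ j"
proof -
  have "sqrt 2 \<le> (2::real)" using real_sqrt_le_mono[of 2 4] by simp
  then have "sqrt 2 * (freq n ^ j) * \<bar>sin (freq n * x + real j * (pi / 2))\<bar> \<le> 2 * freq n ^ j * 1"
    using freq_pos[of n] by (intro mult_mono) auto
  then show ?thesis using freq_pos[of n] by (simp add: trig_def abs_mult)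
qed

lemma sin_freq_diff: "sin (freq n - freq m) = 0" "sin (freq n + freq m) = 0"
proof -
  have "freq n - freq m = of_int (int (Suc n) - int (Suc m)) * pi"
       "freq n + freq m = of_int (int (Suc n) + int (Suc m)) * pi"
    by (auto simp: freq_def algebra_simps)
  then show "sin (freq n - freq m) = 0" "sin (freq n + freq m) = 0"
    using sin_npi_int by (simp_all only: mult.commute[of _ pi])
qed

lemma trig_0_orthonormal: "L2_inner (trig 0 n) (trig 0 m) = (if n = m then 1 else 0)"
proof -
  have prod: "trig 0 n x * trig 0 m x = cos ((freq n - freq m) * x) - cos ((freq n + freq m) * x)" for x
    by (simp add: trig_0 left_diff_distrib distrib_right cos_diff cos_add)
  have s: "freq n + freq m \<noteq> 0" using freq_pos[of n] freq_pos[of m] by simp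
  \<comment> \<open>An antiderivative of the product after the product-to-sum formula. For
    \<open>n = m\<close> the first cosine is constantly 1, so its antiderivative is
    \<open>x\<close>; this alone contributes at the end points.\<close>
  define F where "F x = (if n = m then x else sin ((freq n - freq m) * x) / (freq n - freq m))
     - sin ((freq n + freq m) * x) / (freq n + freq m)" for x
  have F: "(F has_real_derivative trig 0 n x * trig 0 m x) (at x)" for x
  proof (cases "n = m")
    case True
    then show ?thesis using s unfolding prod F_def[abs_def]
      by (auto intro!: derivative_eq_intros simp: field_simps)
  next
    case False
    then have "freq n - freq m \<noteq> 0" by (simp add: freq_def)
    then show ?thesis using s False unfolding prod F_def[abs_def]
      by (auto intro!: derivative_eq_intros)
  qed
  have "L2_inner (trig 0 n) (trig 0 m) = F 1 - F 0"
    unfolding L2_inner_def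
    by (rule LINT_unit_measure_FTC) (auto intro!: F continuous_intros continuous_on_trig)
  then show ?thesis using sin_freq_diff[of n m] by (simp add: F_def)
qed

text \<open>Integration by parts reduces cosines to sines, since
  \<open>trig 0 n x * trig 1 m x\<close> vanishes at both ends.\<close>

lemma trig_1_orthogonal:
  "L2_inner (trig 1 n) (trig 1 m) = (if n = m then (freq n)\<^sup>2 else 0)"
proof -
  have "((\<lambda>x. trig 0 n x * trig 1 m x) has_real_derivative
      (trig 1 n x * trig 1 m x - (freq m)\<^sup>2 * (trig 0 n x * trig 0 m x))) (at x)" for x
    using DERIV_mult[OF has_real_derivative_trig[of 0 n x] has_real_derivative_trig[of 1 m x]]
    by (simp add: trig_Suc_Suc algebra_simps)
  then have "(LINT x|unit_measure. trig 1 n x * trig 1 m x - (freq m)\<^sup>2 * (trig 0 n x * trig 0 m x))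
     = trig 0 n 1 * trig 1 m 1 - trig 0 n 0 * trig 1 m 0"
    by (rule LINT_unit_measure_FTC) (auto intro!: continuous_intros continuous_on_trig)
  then have "L2_inner (trig 1 n) (trig 1 m) = (freq m)\<^sup>2 * L2_inner (trig 0 n) (trig 0 m)"
    by (simp add: trig_0_ends L2_inner_def L2_mult_integrable trig_L2)
  then show ?thesis by (simp add: trig_0_orthonormal)
qed

section \<open>Density of the span of the sines\<close>

inductive_set sine_span :: "(real \<Rightarrow> real) set" where
  zero: "(\<lambda>x. 0) \<in> sine_span"
| step: "g \<in> sine_span \<Longrightarrow> (\<lambda>x. g x + a * trig 0 n x) \<in> sine_span"

text \<open>One choice of coefficients serves all large lengths, because it is padded by zeros.
  Parseval's identity needs this to compare a single approximant with every late partial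
  sum.\<close>

lemma sine_span_eq_sum:
  assumes "g \<in> sine_span"
  obtains N a where "\<And>M. M \<ge> N \<Longrightarrow> g = (\<lambda>x. \<Sum>n<M. a n * trig 0 n x)"
proof -
  have "\<exists>N a. \<forall>M\<ge>N. g = (\<lambda>x. \<Sum>n<M. a n * trig 0 n x)"
    using assms
  proof induction
    case zero
    show ?case by (intro exI[of _ 0] exI[of _ "\<lambda>_. 0"]) auto
  next
    case (step g c k)
    then obtain N a where Na: "\<And>M. M \<ge> N \<Longrightarrow> g = (\<lambda>x. \<Sum>n<M. a n * trig 0 n x)" by blast
    have "(\<lambda>x. g x + c * trig 0 k x) = (\<lambda>x. \<Sum>n<M. (a(k := a k + c)) n * trig 0 n x)"
      if M: "M \<ge> max N (Suc k)" for M
    proof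
      fix x
      have "(\<Sum>n<M. (a(k := a k + c)) n * trig 0 n x)
        = (\<Sum>n<M. a n * trig 0 n x + (if n = k then c * trig 0 k x else 0))"
        by (intro sum.cong) (auto simp: distrib_right)
      also have "\<dots> = g x + c * trig 0 k x"
        using M Na[of M] by (auto simp: sum.distrib)
      finally show "g x + c * trig 0 k x = (\<Sum>n<M. (a(k := a k + c)) n * trig 0 n x)" by simp
    qed
    then show ?case by blast
  qed
  then show thesis using that by blast
qed

lemma sine_span_L2: "g \<in> sine_span \<Longrightarrow> g \<in> L2"
  by (induction rule: sine_span.induct) (auto intro!: L2_add L2_cmult trig_L2 simp: L2_const)

lemma sine_span_add:
  assumes "g \<in> sine_span" "h \<in> sine_span"
  shows "(\<lambda>x. g x + h x) \<in> sine_span"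
  using assms(2,1)
  by induction (use sine_span.step in \<open>force simp: add.assoc[symmetric]\<close>)+

lemma sine_span_cmult:
  assumes "g \<in> sine_span"
  shows "(\<lambda>x. c * g x) \<in> sine_span"
  using assms
proof induction
  case zero
  then show ?case using sine_span.zero by simp
next
  case (step g a n)
  then show ?case using sine_span.step[OF step.IH, of "c * a" n] by (simp add: algebra_simps)
qed

text \<open>By the product-to-sum formula, multiplication by \<open>cos (pi * x)\<close> averages
  the two neighbouring modes. The lowest mode has only an upper neighbour, the lower one being
  \<open>sin 0 = 0\<close>; hence the case split.\<close>

lemma sine_span_mult_cos:
  assumes "g \<in> sine_span"
  shows "(\<lambda>x. g x * cos (pi * x)) \<in> sine_span"
  using assms
proof induction
  case zero
  then show ?case using sine_span.zero by simp
next
  case (step g a n)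
  have eq: "2 * (sin (freq n * x) * cos (pi * x)) = sin (freq n * x + pi * x) + sin (freq n * x - pi * x)" for x
    by (simp add: sin_add sin_diff)
  have up: "freq n * x + pi * x = freq (Suc n) * x" for x
    by (simp add: freq_def algebra_simps)
  show ?case
  proof (cases n)
    case 0
    have "freq n = pi" using 0 by (simp add: freq_def)
    then have "2 * (trig 0 n x * cos (pi * x)) = trig 0 (Suc n) x" for x
      using eq[of x] unfolding up by (simp add: trig_0)
    note double = this
    have "trig 0 n x * cos (pi * x) = 1/2 * trig 0 (Suc n) x" for x
      using double[of x] by linarith
    then show ?thesis using sine_span.step[OF step.IH, of "a * (1/2)" "Suc n"]
      by (simp only: distrib_right mult.assoc)
  next
    case (Suc k)
    have "freq n * x - pi * x = freq k * x" for x
      using Suc by (simp add: freq_def algebra_simps)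
    then have "2 * (trig 0 n x * cos (pi * x)) = trig 0 (Suc n) x + trig 0 k x" for x
      using arg_cong[OF eq[of x], of "\<lambda>y. sqrt 2 * y"] unfolding up by (simp add: trig_0 distrib_left)
    note double = this
    have "trig 0 n x * cos (pi * x) = 1/2 * trig 0 (Suc n) x + 1/2 * trig 0 k x" for x
      using double[of x] by linarith
    then show ?thesis
      using sine_span.step[OF sine_span.step[OF step.IH, of "a * (1/2)" "Suc n"], of "a * (1/2)" k]
      by (simp only: distrib_right distrib_left mult.assoc add.assoc)
  qed
qed

text \<open>
  Density is reduced to the Weierstrass theorem by splitting off the factor \<open>sin (pi * x)\<close>: what
  remains need only be approximated by a polynomial in \<open>cos (pi * x)\<close>.
\<close>

lemma sine_span_mult_cos_poly:
  "(\<lambda>x. sin (pi * x) * (\<Sum>i\<le>m. a i * cos (pi * x) ^ i)) \<in> sine_span"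
proof -
  have sin: "(\<lambda>x. sin (pi * x)) \<in> sine_span"
    using sine_span.step[OF sine_span.zero, of "1 / sqrt 2" 0] by (simp add: trig_0 freq_def)
  have pow: "(\<lambda>x. sin (pi * x) * cos (pi * x) ^ i) \<in> sine_span" for i
  proof (induction i)
    case (Suc i)
    then show ?case using sine_span_mult_cos[OF Suc] by (simp add: mult_ac)
  qed (use sin in simp)
  show ?thesis
  proof (induction m)
    case 0
    then show ?case using sine_span_cmult[OF sin, of "a 0"] by (simp add: mult.commute)
  next
    case (Suc m)
    then show ?case
      using sine_span_add[OF Suc sine_span_cmult[OF pow[of "Suc m"], of "a (Suc m)"]]
      by (simp add: algebra_simps)
  qed
qed

lemma sine_span_approx_sin_continuous:
  assumes g: "continuous_on {0..1} g" and "e > 0"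
  obtains h where "h \<in> sine_span" "L2_norm (\<lambda>x. sin (pi * x) * g x - h x) \<le> e"
proof -
  \<comment> \<open>The substitution \<open>y = cos (pi * x)\<close> maps the unit interval
    bijectively onto \<open>{-1..1}\<close>, so a uniform polynomial approximation in
    \<open>y\<close> is one by polynomials in the cosine.\<close>
  have "continuous_on {-1..1} (\<lambda>y. g (arccos y / pi))"
    by (rule continuous_on_compose2[OF g])
       (auto intro!: continuous_intros divide_nonneg_pos arccos_lbound arccos_ubound)
  then obtain p where p: "real_polynomial_function p"
    and pe: "\<And>y. y \<in> {-1..1} \<Longrightarrow> \<bar>g (arccos y / pi) - p y\<bar> < e"
    using Stone_Weierstrass_real_polynomial_function[of "{-1..1::real}"] \<open>e > 0\<close> compact_Icc by metis
  obtain a m where am: "p = (\<lambda>x. \<Sum>i\<le>m. a i * x ^ i)"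
    using p real_polynomial_function_iff_sum by blast
  let ?h = "\<lambda>x. sin (pi * x) * p (cos (pi * x))"
  have h: "?h \<in> sine_span" using sine_span_mult_cos_poly am by simp
  have "\<bar>sin (pi * x) * g x - ?h x\<bar> \<le> e" if "0 < x" "x < 1" for x
  proof -
    have "\<bar>g x - p (cos (pi * x))\<bar> \<le> e"
      using pe[of "cos (pi * x)"] that by (simp add: arccos_cos)
    then have "\<bar>sin (pi * x)\<bar> * \<bar>g x - p (cos (pi * x))\<bar> \<le> 1 * e"
      by (intro mult_mono) auto
    then show ?thesis by (simp add: abs_mult right_diff_distrib flip: abs_mult)
  qed
  then have "L2_norm (\<lambda>x. sin (pi * x) * g x - ?h x) \<le> e"
    using h \<open>e > 0\<close> by (intro L2_norm_le_bound L2_diff sine_span_L2 L2_continuous continuous_intros g) auto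
  then show thesis using that h by blast
qed

text \<open>The quotient \<open>f x / sin (pi * x)\<close> may fail to be square-integrable near the
  ends, so it is clamped to a bounded range; multiplied back by the sine, it stays below
  \<open>\<bar>f x\<bar>\<close>. As a measurable function the quotient is an almost everywhere
  limit of continuous functions, and clamping these at the same level supplies a constant
  majorant.\<close>

lemma L2_approx_sin_continuous:
  assumes f: "f \<in> L2" and "e > 0"
  obtains g where "continuous_on {0..1} g" "L2_norm (\<lambda>x. f x - sin (pi * x) * g x) \<le> e"
proof -
  define clamp where "clamp K y = max (- K) (min K y)" for K y :: real
  have clamp_cont: "continuous_on S (\<lambda>x. clamp K (h x))" if "continuous_on S h" for S K and h :: "real \<Rightarrow> real"
    unfolding clamp_def using that by (intro continuous_intros)
  have clamp_meas: "(\<lambda>x. clamp K (h x)) \<in> borel_measurable unit_measure"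
    if "h \<in> borel_measurable unit_measure" for K and h :: "real \<Rightarrow> real"
    unfolding clamp_def by (intro borel_measurable_max borel_measurable_min borel_measurable_const that)
  have clamp_le: "\<bar>clamp K y\<bar> \<le> \<bar>y\<bar>" "\<bar>clamp K y\<bar> \<le> K" if "K \<ge> 0" for K y
    using that by (auto simp: clamp_def)
  have sin_meas: "(\<lambda>x. sin (pi * x)) \<in> borel_measurable unit_measure"
    by (intro borel_measurable_continuous_unit continuous_intros)
  have sin_pos: "sin (pi * x) > 0" if "0 < x" "x < 1" for x
    using that by (intro sin_gt_zero) auto
  define q where "q x = f x / sin (pi * x)" for x
  have q_meas: "q \<in> borel_measurable unit_measure"
    unfolding q_def[abs_def] by (intro borel_measurable_divide sin_meas L2_measurable f)
  have "(\<lambda>n. L2_norm (\<lambda>x. f x - sin (pi * x) * clamp (real n) (q x))) \<longlonglongrightarrow> 0"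
  proof (rule L2_dominated_convergence[where w = "\<lambda>x. \<bar>f x\<bar>"])
    show "(\<lambda>x. \<bar>f x\<bar>) \<in> L2" using f by (simp add: L2_def borel_measurable_abs)
    show "(\<lambda>x. sin (pi * x) * clamp (real n) (q x)) \<in> borel_measurable unit_measure" for n
      by (intro borel_measurable_times clamp_meas sin_meas q_meas)
    show "AE x in unit_measure. (\<lambda>n. sin (pi * x) * clamp (real n) (q x)) \<longlonglongrightarrow> f x"
    proof (rule AE_unit_measureI)
      fix x :: real assume x: "0 < x" "x < 1"
      have "\<forall>\<^sub>F n in sequentially. sin (pi * x) * clamp (real n) (q x) = f x"
        using eventually_ge_at_top[of "nat \<lceil>\<bar>q x\<bar>\<rceil>"]
      proof eventually_elim
        case (elim n)
        then have "\<bar>q x\<bar> \<le> real n" by linarith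
        then have "clamp (real n) (q x) = q x" by (auto simp: clamp_def)
        then show ?case using sin_pos[OF x] by (simp add: q_def)
      qed
      then show "(\<lambda>n. sin (pi * x) * clamp (real n) (q x)) \<longlonglongrightarrow> f x"
        by (rule tendsto_eventually)
    qed
    show "\<bar>sin (pi * x) * clamp (real n) (q x)\<bar> \<le> \<bar>f x\<bar>" if x: "0 < x" "x < 1" for n x
    proof -
      have "\<bar>sin (pi * x)\<bar> * \<bar>clamp (real n) (q x)\<bar> \<le> \<bar>sin (pi * x)\<bar> * \<bar>q x\<bar>"
        by (intro mult_left_mono clamp_le) auto
      then show ?thesis using sin_pos[OF x] by (simp add: q_def abs_mult)
    qed
  qed (use f L2_measurable in auto)
  then have "\<forall>\<^sub>F n in sequentially. L2_norm (\<lambda>x. f x - sin (pi * x) * clamp (real n) (q x)) < e / 2"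
    using \<open>e > 0\<close> by (intro order_tendstoD) auto
  then obtain K where K: "L2_norm (\<lambda>x. f x - sin (pi * x) * clamp (real K) (q x)) < e / 2"
    by (auto simp: eventually_sequentially)
  have "q measurable_on {0<..<1}"
    using q_meas by (simp add: measurable_on_iff_borel_measurable)
  then obtain N G where N: "negligible N" and G: "\<And>n. continuous_on UNIV (G n)"
    and lim: "\<And>x. x \<notin> N \<Longrightarrow> (\<lambda>n. G n x) \<longlonglongrightarrow> (if x \<in> {0<..<1} then q x else 0)"
    unfolding measurable_on_def by blast
  have "(\<lambda>n. L2_norm (\<lambda>x. sin (pi * x) * clamp (real K) (q x) - sin (pi * x) * clamp (real K) (G n x))) \<longlonglongrightarrow> 0"
  proof (rule L2_dominated_convergence[where w = "\<lambda>x. real K"])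
    show "(\<lambda>x. sin (pi * x) * clamp (real K) (q x)) \<in> borel_measurable unit_measure"
      by (intro borel_measurable_times clamp_meas sin_meas q_meas)
    show "(\<lambda>x. sin (pi * x) * clamp (real K) (G n x)) \<in> borel_measurable unit_measure" for n
      by (intro borel_measurable_times clamp_meas sin_meas borel_measurable_continuous_unit
          continuous_on_subset[OF G]) auto
    have "AE x in lebesgue. x \<notin> N"
      using N by (intro AE_not_in) (simp add: negligible_iff_null_sets)
    then have "AE x in unit_measure. x \<notin> N"
      by (auto simp: AE_restrict_space_iff elim: AE_mp)
    then show "AE x in unit_measure. (\<lambda>n. sin (pi * x) * clamp (real K) (G n x)) \<longlonglongrightarrow> sin (pi * x) * clamp (real K) (q x)"
    proof (rule AE_mp, intro AE_unit_measureI impI)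
      fix x :: real assume "0 < x" "x < 1" "x \<notin> N"
      then have "(\<lambda>n. G n x) \<longlonglongrightarrow> q x" using lim[of x] by simp
      then show "(\<lambda>n. sin (pi * x) * clamp (real K) (G n x)) \<longlonglongrightarrow> sin (pi * x) * clamp (real K) (q x)"
        unfolding clamp_def by (intro tendsto_intros)
    qed
    have "\<bar>sin (pi * x) * clamp (real K) y\<bar> \<le> 1 * real K" for x y
      unfolding abs_mult by (intro mult_mono clamp_le) auto
    then show "\<bar>sin (pi * x) * clamp (real K) (G n x)\<bar> \<le> real K"
      "\<bar>sin (pi * x) * clamp (real K) (q x)\<bar> \<le> real K" for n x
      by auto
  qed (rule L2_const)
  then have "\<forall>\<^sub>F n in sequentially. L2_norm (\<lambda>x. sin (pi * x) * clamp (real K) (q x) - sin (pi * x) * clamp (real K) (G n x)) < e / 2"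
    using \<open>e > 0\<close> by (intro order_tendstoD) auto
  then obtain n where n: "L2_norm (\<lambda>x. sin (pi * x) * clamp (real K) (q x) - sin (pi * x) * clamp (real K) (G n x)) < e / 2"
    by (auto simp: eventually_sequentially)
  have cont: "continuous_on {0..1} (\<lambda>x. clamp (real K) (G n x))"
    by (intro clamp_cont continuous_on_subset[OF G]) auto
  have "(\<lambda>x. clamp (real K) (q x)) \<in> L2"
    by (rule L2_bounded[where B="real K"]) (auto intro!: clamp_meas q_meas clamp_le)
  from L2_mult_continuous[OF this, of "\<lambda>x. sin (pi * x)"]
  have "(\<lambda>x. sin (pi * x) * clamp (real K) (q x)) \<in> L2"
    by (simp add: mult.commute continuous_intros)
  moreover have "(\<lambda>x. sin (pi * x) * clamp (real K) (G n x)) \<in> L2"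
    by (intro L2_continuous continuous_intros cont)
  ultimately have "L2_norm (\<lambda>x. f x - sin (pi * x) * clamp (real K) (G n x)) \<le> e / 2 + e / 2"
    using L2_norm_triangle_diff[OF f] K n by fastforce
  then show thesis using that[OF cont] by simp
qed

lemma sine_span_dense:
  assumes f: "f \<in> L2" and "e > 0"
  obtains h where "h \<in> sine_span" "L2_norm (\<lambda>x. f x - h x) \<le> e"
proof -
  obtain g where g: "continuous_on {0..1} g" "L2_norm (\<lambda>x. f x - sin (pi * x) * g x) \<le> e / 2"
    using L2_approx_sin_continuous[OF f, of "e / 2"] \<open>e > 0\<close> by auto
  obtain h where h: "h \<in> sine_span" "L2_norm (\<lambda>x. sin (pi * x) * g x - h x) \<le> e / 2"
    using sine_span_approx_sin_continuous[OF g(1), of "e / 2"] \<open>e > 0\<close> by auto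
  have "(\<lambda>x. sin (pi * x) * g x) \<in> L2"
    by (intro L2_continuous continuous_intros g)
  then have "L2_norm (\<lambda>x. f x - h x) \<le> e / 2 + e / 2"
    using L2_norm_triangle_diff[OF f _ sine_span_L2[OF h(1)]] g(2) h(2) by fastforce
  then show thesis using that h by simp
qed

section \<open>Sine coefficients and Parseval's identity\<close>

definition sine_coeff :: "(real \<Rightarrow> real) \<Rightarrow> nat \<Rightarrow> real" where
  "sine_coeff f n = L2_inner f (trig 0 n)"

definition sine_sum :: "(nat \<Rightarrow> real) \<Rightarrow> nat \<Rightarrow> real \<Rightarrow> real" where
  "sine_sum a N x = (\<Sum>n<N. a n * trig 0 n x)"

lemma sine_sum_L2: "sine_sum a N \<in> L2"
  unfolding sine_sum_def[abs_def] by (intro L2_sum L2_cmult trig_L2)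

lemma L2_inner_sine_sum: "f \<in> L2 \<Longrightarrow> L2_inner f (sine_sum a N) = (\<Sum>n<N. a n * sine_coeff f n)"
  unfolding sine_sum_def[abs_def] sine_coeff_def
  by (subst L2_inner_sum_right) (auto intro!: L2_cmult trig_L2 simp: L2_inner_cmult_right)

lemma sine_coeff_sine_sum: "sine_coeff (sine_sum a N) n = (if n < N then a n else 0)"
  unfolding sine_coeff_def sine_sum_def[abs_def]
  by (subst L2_inner_sum_left)
     (auto intro!: L2_cmult trig_L2 simp: L2_inner_cmult_left trig_0_orthonormal if_distrib cong: if_cong)

text \<open>Completing the square in each coefficient. Arbitrary \<open>a\<close> shows that the
  Fourier coefficients are the best choice, and \<open>a = sine_coeff f\<close> gives Bessel's
  inequality; Parseval's identity uses both.\<close>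

lemma L2_norm_diff_sine_sum:
  assumes f: "f \<in> L2"
  shows "(L2_norm (\<lambda>x. f x - sine_sum a N x))\<^sup>2 =
     (L2_norm f)\<^sup>2 - (\<Sum>n<N. (sine_coeff f n)\<^sup>2) + (\<Sum>n<N. (a n - sine_coeff f n)\<^sup>2)"
proof -
  have "(L2_norm (\<lambda>x. f x - sine_sum a N x))\<^sup>2
      = L2_inner f f - 2 * L2_inner f (sine_sum a N) + L2_inner (sine_sum a N) (sine_sum a N)"
    using f by (simp add: L2_norm_square L2_inner_diff_left L2_inner_diff_right L2_diff sine_sum_L2
        L2_inner_commute[of "sine_sum a N" f])
  also have "\<dots> = L2_inner f f + (\<Sum>n<N. a n * a n - 2 * (a n * sine_coeff f n))"
    using f by (simp add: L2_inner_sine_sum sine_sum_L2 sine_coeff_sine_sum sum_subtractf sum_distrib_left)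
  also have "(\<Sum>n<N. a n * a n - 2 * (a n * sine_coeff f n)) =
      (\<Sum>n<N. (a n - sine_coeff f n)\<^sup>2 - (sine_coeff f n)\<^sup>2)"
    by (intro sum.cong) (auto simp: power2_eq_square algebra_simps)
  finally show ?thesis by (simp add: L2_norm_square sum_subtractf)
qed

text \<open>Density gives one sine sum with squared distance at most \<open>r / 2\<close>, and every
  partial Fourier sum of at least its length is at least as close.\<close>

theorem parseval:
  assumes f: "f \<in> L2"
  shows "(\<lambda>n. (sine_coeff f n)\<^sup>2) sums (L2_norm f)\<^sup>2"
  unfolding sums_def
proof (rule LIMSEQ_I)
  fix r :: real assume "r > 0"
  obtain h where h: "h \<in> sine_span" "L2_norm (\<lambda>x. f x - h x) \<le> sqrt (r / 2)"
    using sine_span_dense[OF f, of "sqrt (r / 2)"] \<open>r > 0\<close> by auto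
  obtain N a where Na: "\<And>M. M \<ge> N \<Longrightarrow> h = sine_sum a M"
    using sine_span_eq_sum[OF h(1)] unfolding sine_sum_def[abs_def] by metis
  have "\<bar>(\<Sum>n<M. (sine_coeff f n)\<^sup>2) - (L2_norm f)\<^sup>2\<bar> < r" if "M \<ge> N" for M
  proof -
    have "(L2_norm (\<lambda>x. f x - sine_sum a M x))\<^sup>2 \<le> (sqrt (r / 2))\<^sup>2"
      using h(2) Na[OF that] by (intro power_mono) (auto simp: L2_norm_nonneg)
    then have "(L2_norm f)\<^sup>2 - (\<Sum>n<M. (sine_coeff f n)\<^sup>2) + (\<Sum>n<M. (a n - sine_coeff f n)\<^sup>2) \<le> r / 2"
      using \<open>r > 0\<close> unfolding L2_norm_diff_sine_sum[OF f] by simp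
    moreover have "(\<Sum>n<M. (a n - sine_coeff f n)\<^sup>2) \<ge> 0" by (intro sum_nonneg) auto
    moreover have "(L2_norm f)\<^sup>2 - (\<Sum>n<M. (sine_coeff f n)\<^sup>2) \<ge> 0"
      using L2_norm_diff_sine_sum[OF f, of "sine_coeff f" M] zero_le_power2[of "L2_norm (\<lambda>x. f x - sine_sum (sine_coeff f) M x)"]
      by simp
    ultimately show ?thesis using \<open>r > 0\<close> by linarith
  qed
  then show "\<exists>no. \<forall>n\<ge>no. norm ((\<Sum>n<n. (sine_coeff f n)\<^sup>2) - (L2_norm f)\<^sup>2) < r" by auto
qed

lemma sine_sum_tendsto:
  assumes f: "f \<in> L2"
  shows "(\<lambda>N. L2_norm (\<lambda>x. f x - sine_sum (sine_coeff f) N x)) \<longlonglongrightarrow> 0"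
proof -
  have "(\<lambda>N. (L2_norm f)\<^sup>2 - (\<Sum>n<N. (sine_coeff f n)\<^sup>2)) \<longlonglongrightarrow> (L2_norm f)\<^sup>2 - (L2_norm f)\<^sup>2"
    using parseval[OF f] unfolding sums_def by (intro tendsto_intros)
  then have "(\<lambda>N. (L2_norm (\<lambda>x. f x - sine_sum (sine_coeff f) N x))\<^sup>2) \<longlonglongrightarrow> 0"
    by (simp add: L2_norm_diff_sine_sum[OF f])
  then show ?thesis
    using tendsto_real_sqrt[of _ 0] by (fastforce simp: L2_norm_nonneg)
qed

lemma L2_inner_tendsto:
  assumes "f \<in> L2" "g \<in> L2" "\<And>n. h n \<in> L2"
    and lim: "(\<lambda>n. L2_norm (\<lambda>x. f x - h n x)) \<longlonglongrightarrow> 0"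
  shows "(\<lambda>n. L2_inner (h n) g) \<longlonglongrightarrow> L2_inner f g"
proof -
  have "(\<lambda>n. L2_norm (\<lambda>x. f x - h n x) * L2_norm g) \<longlonglongrightarrow> 0"
    using lim by (auto intro: tendsto_eq_intros)
  then have "(\<lambda>n. L2_inner (h n) g - L2_inner f g) \<longlonglongrightarrow> 0"
  proof (rule Lim_null_comparison[rotated], intro always_eventually allI)
    show "norm (L2_inner (h n) g - L2_inner f g) \<le> L2_norm (\<lambda>x. f x - h n x) * L2_norm g" for n
      using L2_inner_le[of "\<lambda>x. f x - h n x" g] assms
      by (simp add: L2_diff L2_inner_diff_left abs_minus_commute)
  qed
  then show ?thesis by (simp add: LIM_zero_iff)
qed

lemma L2_inner_sine_sum_tendsto:
  assumes "f \<in> L2" "g \<in> L2"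
  shows "(\<lambda>N. L2_inner (sine_sum (sine_coeff f) N) g) \<longlonglongrightarrow> L2_inner f g"
  using assms by (intro L2_inner_tendsto sine_sum_tendsto sine_sum_L2)

section \<open>Smooth functions and test functions\<close>

definition smooth_fun :: "(real \<Rightarrow> real) \<Rightarrow> bool" where
  "smooth_fun f \<longleftrightarrow> (\<forall>n x. (deriv ^^ n) f differentiable (at x))"

text \<open>Smoothness is the greatest property stable under differentiation. Exhibiting a family
  closed under derivatives replaces any formula for the \<open>n\<close>-th derivative.\<close>

lemma smooth_fun_coinduct:
  assumes "f \<in> A" and closed: "\<And>g. g \<in> A \<Longrightarrow> \<exists>g'\<in>A. \<forall>x. (g has_real_derivative g' x) (at x)"
  shows "smooth_fun f"
proof -
  have "(deriv ^^ n) f \<in> A" for n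
  proof (induction n)
    case (Suc n)
    then obtain g' where "g' \<in> A" "\<forall>x. ((deriv ^^ n) f has_real_derivative g' x) (at x)"
      using closed by blast
    moreover from this have "deriv ((deriv ^^ n) f) = g'" by (auto intro: DERIV_imp_deriv)
    ultimately show ?case by simp
  qed (simp add: assms)
  then show ?thesis
    unfolding smooth_fun_def using closed real_differentiable_def by blast
qed

lemma smooth_fun_deriv: "smooth_fun f \<Longrightarrow> smooth_fun (deriv f)"
  unfolding smooth_fun_def by (metis comp_apply funpow_Suc_right)

lemma smooth_fun_has_derivative: "smooth_fun f \<Longrightarrow> (f has_real_derivative deriv f x) (at x)"
  unfolding smooth_fun_def by (metis DERIV_deriv_iff_real_differentiable funpow_0)

lemma smooth_fun_continuous_on: "smooth_fun f \<Longrightarrow> continuous_on S f"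
  by (meson DERIV_continuous_on has_field_derivative_at_within smooth_fun_has_derivative)

lemma smooth_fun_L2: "smooth_fun f \<Longrightarrow> f \<in> L2"
  by (intro L2_continuous smooth_fun_continuous_on)

text \<open>Closure under both sums and products makes the set stable under the product rule, so
  that the coinduction principle applies to it.\<close>

inductive_set smooth_algebra :: "(real \<Rightarrow> real) set" where
  base: "smooth_fun f \<Longrightarrow> f \<in> smooth_algebra"
| add: "f \<in> smooth_algebra \<Longrightarrow> g \<in> smooth_algebra \<Longrightarrow> (\<lambda>x. f x + g x) \<in> smooth_algebra"
| mult: "f \<in> smooth_algebra \<Longrightarrow> g \<in> smooth_algebra \<Longrightarrow> (\<lambda>x. f x * g x) \<in> smooth_algebra"

lemma smooth_algebra_smooth:
  assumes "f \<in> smooth_algebra"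
  shows "smooth_fun f"
  using assms
proof (rule smooth_fun_coinduct)
  fix g assume "g \<in> smooth_algebra"
  then show "\<exists>g'\<in>smooth_algebra. \<forall>x. (g has_real_derivative g' x) (at x)"
  proof induction
    case (base f)
    then show ?case using smooth_fun_deriv smooth_fun_has_derivative smooth_algebra.base by blast
  next
    case (add f g)
    then obtain f' g' where "f' \<in> smooth_algebra" "\<forall>x. (f has_real_derivative f' x) (at x)"
      "g' \<in> smooth_algebra" "\<forall>x. (g has_real_derivative g' x) (at x)" by blast
    then show ?case
      by (intro bexI[of _ "\<lambda>x. f' x + g' x"]) (auto intro: DERIV_add smooth_algebra.intros)
  next
    case (mult f g)
    then obtain f' g' where "f' \<in> smooth_algebra" "\<forall>x. (f has_real_derivative f' x) (at x)"
      "g' \<in> smooth_algebra" "\<forall>x. (g has_real_derivative g' x) (at x)" by blast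
    then show ?case
      using mult.hyps
      by (intro bexI[of _ "\<lambda>x. f' x * g x + g' x * f x"])
         (auto intro: DERIV_mult smooth_algebra.intros)
  qed
qed

lemma smooth_fun_add: "smooth_fun f \<Longrightarrow> smooth_fun g \<Longrightarrow> smooth_fun (\<lambda>x. f x + g x)"
  by (rule smooth_algebra_smooth, rule smooth_algebra.add; rule smooth_algebra.base)

lemma smooth_fun_mult: "smooth_fun f \<Longrightarrow> smooth_fun g \<Longrightarrow> smooth_fun (\<lambda>x. f x * g x)"
  by (rule smooth_algebra_smooth, rule smooth_algebra.mult; rule smooth_algebra.base)

lemma smooth_fun_const: "smooth_fun (\<lambda>x. c)"
proof (rule smooth_fun_coinduct[where A="{\<lambda>x. c, \<lambda>x. 0}"])
  fix g :: "real \<Rightarrow> real" assume "g \<in> {\<lambda>x. c, \<lambda>x. 0}"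
  then have "\<forall>x. (g has_real_derivative 0) (at x)" by auto
  then show "\<exists>g'\<in>{\<lambda>x. c, \<lambda>x. 0}. \<forall>x. (g has_real_derivative g' x) (at x)" by simp
qed simp

lemma smooth_fun_trig: "smooth_fun (trig j n)"
proof (rule smooth_fun_coinduct[where A="range (\<lambda>j. trig j n)"])
  fix g assume "g \<in> range (\<lambda>j. trig j n)"
  then obtain i where "g = trig i n" by blast
  then have "\<forall>x. (g has_real_derivative trig (Suc i) n x) (at x)"
    by (simp add: has_real_derivative_trig)
  then show "\<exists>g'\<in>range (\<lambda>j. trig j n). \<forall>x. (g has_real_derivative g' x) (at x)"
    by (intro bexI[of _ "trig (Suc i) n"]) simp_all
qed simp

lemma smooth_fun_sine_sum: "smooth_fun (sine_sum a N)"
proof (induction N)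
  case 0
  then show ?case by (simp add: sine_sum_def[abs_def] smooth_fun_const)
next
  case (Suc N)
  have "smooth_fun (\<lambda>x. a N * trig 0 N x)"
    by (intro smooth_fun_mult smooth_fun_const smooth_fun_trig)
  from smooth_fun_add[OF Suc this] show ?case by (simp add: sine_sum_def[abs_def])
qed

section \<open>Smooth functions built from \<open>exp (- inverse x)\<close>\<close>

definition flat :: "real poly \<Rightarrow> real \<Rightarrow> real" where
  "flat p x = (if x > 0 then poly p (inverse x) * exp (- inverse x) else 0)"

lemma flat_tendsto_0: "(flat p \<longlongrightarrow> 0) (at 0)"
proof -
  have "((\<lambda>z. \<Sum>i\<le>degree p. coeff p i * (z ^ i / exp z)) \<longlongrightarrow> (\<Sum>i\<le>degree p. coeff p i * 0)) at_top"
    by (intro tendsto_intros tendsto_power_div_exp_0)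
  then have "((\<lambda>z. poly p z * exp (- z)) \<longlongrightarrow> 0) at_top"
    by (simp add: poly_altdef sum_distrib_right exp_minus divide_inverse mult.assoc)
  then have "((\<lambda>x. poly p (inverse x) * exp (- inverse x)) \<longlongrightarrow> 0) (at_right 0)"
    by (rule filterlim_compose[OF _ filterlim_inverse_at_top_right])
  then have "(flat p \<longlongrightarrow> 0) (at_right 0)"
    by (rule Lim_transform_eventually)
       (auto simp: flat_def eventually_at_filter)
  moreover have "(flat p \<longlongrightarrow> 0) (at_left 0)"
    by (rule tendsto_eventually) (auto simp: flat_def eventually_at_filter)
  ultimately show ?thesis by (intro filterlim_split_at)
qed

lemma flat_tendsto_at_top: "(flat p \<longlongrightarrow> poly p 0) at_top"
proof -
  have "((\<lambda>x. poly p (inverse x) * exp (- inverse x)) \<longlongrightarrow> poly p 0 * exp (- 0)) at_top"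
    by (intro tendsto_intros tendsto_poly tendsto_inverse_0_at_top filterlim_ident)
  then have "((\<lambda>x. poly p (inverse x) * exp (- inverse x)) \<longlongrightarrow> poly p 0) at_top" by simp
  then show ?thesis
    by (rule Lim_transform_eventually)
       (use eventually_gt_at_top[of 0] in \<open>eventually_elim, simp add: flat_def\<close>)
qed

text \<open>With \<open>z = inverse x\<close>, differentiating \<open>poly p z * exp (- z)\<close>
  yields the polynomial factor \<open>z\<^sup>2 * (p - p')\<close>, so the family reproduces itself.
  At the origin the difference quotient is again flat: division by \<open>h\<close> multiplies the
  polynomial by its variable, which is \<open>pCons 0 p\<close>.\<close>

lemma flat_has_derivative:
  "(flat p has_real_derivative flat ([:0, 0, 1:] * (p - pderiv p)) x) (at x)"
proof (cases x "0 :: real" rule: linorder_cases)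
  case greater
  have "((\<lambda>x. poly p (inverse x) * exp (- inverse x)) has_real_derivative
      flat ([:0, 0, 1:] * (p - pderiv p)) x) (at x)"
    using greater
    by (auto intro!: derivative_eq_intros poly_DERIV simp: flat_def power2_eq_square field_simps)
  moreover have "\<forall>\<^sub>F y in nhds x. flat p y = poly p (inverse y) * exp (- inverse y)"
    using eventually_nhds_in_open[of "{0<..}" x] greater
    by (auto elim!: eventually_mono simp: flat_def)
  ultimately show ?thesis by (subst DERIV_cong_ev[OF refl _ refl])
next
  case less
  have "\<forall>\<^sub>F y in nhds x. flat p y = 0"
    using eventually_nhds_in_open[of "{..<0}" x] less
    by (auto elim!: eventually_mono simp: flat_def)
  then have "(flat p has_real_derivative 0) (at x)"
    by (subst DERIV_cong_ev[OF refl _ refl]) auto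
  then show ?thesis using less by (simp add: flat_def)
next
  case equal
  have "((\<lambda>h. (flat p (0 + h) - flat p 0) / h) \<longlongrightarrow> 0) (at 0)"
  proof (rule Lim_transform_eventually[OF flat_tendsto_0[of "pCons 0 p"]])
    show "\<forall>\<^sub>F h in at 0. flat (pCons 0 p) h = (flat p (0 + h) - flat p 0) / h"
      by (auto simp: eventually_at_filter flat_def field_simps)
  qed
  then show ?thesis using equal by (simp add: DERIV_def flat_def)
qed

lemma smooth_fun_flat_affine: "smooth_fun (\<lambda>x. flat p (\<alpha> * x + \<beta>))"
proof (rule smooth_fun_coinduct[where A="range (\<lambda>p x. flat p (\<alpha> * x + \<beta>))"])
  fix g assume "g \<in> range (\<lambda>p x. flat p (\<alpha> * x + \<beta>))"
  then obtain p where g: "g = (\<lambda>x. flat p (\<alpha> * x + \<beta>))" by blast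
  let ?q = "smult \<alpha> ([:0, 0, 1:] * (p - pderiv p))"
  have "(g has_real_derivative flat ([:0, 0, 1:] * (p - pderiv p)) (\<alpha> * x + \<beta>) * \<alpha>) (at x)" for x
    unfolding g by (rule DERIV_chain2[OF flat_has_derivative]) (auto intro!: derivative_eq_intros)
  moreover have "flat ([:0, 0, 1:] * (p - pderiv p)) y * \<alpha> = flat ?q y" for y
    by (simp add: flat_def)
  ultimately have "\<forall>x. (g has_real_derivative flat ?q (\<alpha> * x + \<beta>)) (at x)" by simp
  then show "\<exists>g'\<in>range (\<lambda>p x. flat p (\<alpha> * x + \<beta>)). \<forall>x. (g has_real_derivative g' x) (at x)"
    by (intro bexI[of _ "\<lambda>x. flat ?q (\<alpha> * x + \<beta>)"]) simp_all
qed simp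

lemma flat_1_bounds: "0 \<le> flat 1 x" "flat 1 x \<le> 1"
  by (auto simp: flat_def)

lemma flat_X2_nonneg: "0 \<le> flat [:0, 0, 1:] x"
  by (simp add: flat_def)

text \<open>With \<open>z = inverse x\<close>, the bound is twice the inequality
  \<open>1 + z + z\<^sup>2 / 2 \<le> exp z\<close>. The constant 2 is the one in the kernel
  estimates below.\<close>

lemma flat_X_X2_le: "flat [:0, 1, 1:] x \<le> 2"
proof (cases "x > 0")
  case True
  let ?z = "inverse x"
  have "1 + ?z + ?z\<^sup>2 / 2 \<le> exp ?z"
    using True by (intro exp_lower_Taylor_quadratic) simp
  moreover have "?z \<ge> 0" using True by simp
  ultimately have "?z + ?z\<^sup>2 \<le> 2 * exp ?z" by linarith
  then have "(?z + ?z\<^sup>2) * exp (- ?z) \<le> 2 * exp ?z * exp (- ?z)"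
    by (intro mult_right_mono) auto
  then show ?thesis using True by (simp add: flat_def power2_eq_square algebra_simps flip: exp_add)
qed (simp add: flat_def)

section \<open>Cutoffs and the kernels formed by their derivatives\<close>

definition cutoff :: "nat \<Rightarrow> real \<Rightarrow> real" where
  "cutoff k x = flat 1 (real k * x - 1) * flat 1 (real k * (1 - x) - 1)"

text \<open>The derivative of the left factor of \<open>cutoff k\<close>: a nonnegative kernel of
  mass at most 1 on the unit interval, concentrating at 0 as \<open>k\<close> grows. Its reflection
  concentrates at 1.\<close>

definition rise :: "nat \<Rightarrow> real \<Rightarrow> real" where
  "rise k x = real k * flat [:0, 0, 1:] (real k * x - 1)"

lemma flat_1_has_derivative: "(flat 1 has_real_derivative flat [:0, 0, 1:] x) (at x)"
  using flat_has_derivative[of 1 x] by simp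

lemma flat_1_rise: "((\<lambda>x. flat 1 (real k * x - 1)) has_real_derivative rise k x) (at x)"
  unfolding rise_def mult.commute[of "real k" "flat _ _"]
  by (rule DERIV_chain2[OF flat_1_has_derivative]) (auto intro!: derivative_eq_intros)

lemma flat_1_rise_reflect:
  "((\<lambda>x. flat 1 (real k * (1 - x) - 1)) has_real_derivative - rise k (1 - x)) (at x)"
proof -
  have "((\<lambda>x. 1 - x) has_real_derivative - 1) (at x)"
    by (auto intro!: derivative_eq_intros)
  from DERIV_chain2[where f="\<lambda>x. flat 1 (real k * x - 1)" and g="\<lambda>x. 1 - x", OF flat_1_rise this]
  show ?thesis by simp
qed

lemma cutoff_has_derivative:
  "(cutoff k has_real_derivative
     rise k x * flat 1 (real k * (1 - x) - 1) - rise k (1 - x) * flat 1 (real k * x - 1)) (at x)"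
  using DERIV_mult[OF flat_1_rise[of k x] flat_1_rise_reflect[of k x]]
  by (simp add: cutoff_def[abs_def])

lemma rise_nonneg: "rise k x \<ge> 0"
  by (simp add: rise_def flat_X2_nonneg)

lemma continuous_on_rise: "continuous_on S (rise k)"
  using smooth_fun_continuous_on[OF smooth_fun_flat_affine[of "[:0, 0, 1:]" "real k" "-1"]]
  unfolding rise_def[abs_def] by (intro continuous_intros) auto

lemma continuous_on_rise_reflect: "continuous_on S (\<lambda>x. rise k (1 - x))"
  by (rule continuous_on_compose2[OF continuous_on_rise[of UNIV]]) (auto intro: continuous_intros)

text \<open>Put \<open>y = real k * x - 1\<close>. The prefactor \<open>real k\<close> is absorbed
  by \<open>x\<close>, and \<open>(y + 1) / y\<^sup>2 = 1 / y + 1 / y\<^sup>2\<close>. Hence every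
  bound on the right-hand side is uniform in \<open>k\<close>.\<close>

lemma mult_rise_eq: "x * rise k x = flat [:0, 1, 1:] (real k * x - 1)"
proof (cases "real k * x - 1 > 0")
  case True
  define y where "y = real k * x - 1"
  have y: "y > 0" "real k * x = y + 1" using True by (auto simp: y_def)
  have "x * rise k x = (y + 1) * flat [:0, 0, 1:] y"
    unfolding rise_def y_def[symmetric] using y(2) by (simp add: mult_ac)
  also have "\<dots> = flat [:0, 1, 1:] y"
    using y(1) by (simp add: flat_def field_simps)
  finally show ?thesis by (simp add: y_def)
qed (simp add: rise_def flat_def)

lemma mult_rise_le: "x * rise k x \<le> 2"
  unfolding mult_rise_eq by (rule flat_X_X2_le)

lemma filterlim_affine_at_top:
  assumes "x > 0"
  shows "filterlim (\<lambda>k. real k * x - 1) at_top sequentially"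
proof -
  have "filterlim (\<lambda>k. - 1 + real k * x) at_top sequentially"
    using assms
    by (intro filterlim_tendsto_add_at_top[OF tendsto_const]
        filterlim_at_top_mult_tendsto_pos[OF tendsto_const assms filterlim_real_sequentially])
  then show ?thesis by simp
qed

lemma rise_tendsto_0:
  assumes "x > 0"
  shows "(\<lambda>k. rise k x) \<longlonglongrightarrow> 0"
proof -
  have "(\<lambda>k. x * rise k x) \<longlonglongrightarrow> poly [:0, 1, 1:] 0"
    unfolding mult_rise_eq
    by (rule filterlim_compose[OF flat_tendsto_at_top filterlim_affine_at_top[OF assms]])
  then have "(\<lambda>k. inverse x * (x * rise k x)) \<longlonglongrightarrow> inverse x * 0"
    by (intro tendsto_intros) simp
  then show ?thesis using assms by (simp add: field_simps)
qed

lemma LINT_rise_le: "(LINT x|unit_measure. rise k x) \<le> 1"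
proof -
  have "(LINT x|unit_measure. rise k x) = flat 1 (real k * 1 - 1) - flat 1 (real k * 0 - 1)"
    by (rule LINT_unit_measure_FTC) (auto intro: flat_1_rise continuous_on_rise)
  then show ?thesis using flat_1_bounds[of "real k * 1 - 1"] flat_1_bounds[of "real k * 0 - 1"] by linarith
qed

lemma LINT_rise_reflect_le: "(LINT x|unit_measure. rise k (1 - x)) \<le> 1"
proof -
  have "(LINT x|unit_measure. rise k (1 - x)) = - flat 1 (real k * (1 - 1) - 1) - - flat 1 (real k * (1 - 0) - 1)"
    by (rule LINT_unit_measure_FTC)
       (use DERIV_minus[OF flat_1_rise_reflect] in \<open>auto intro: continuous_on_rise_reflect\<close>)
  then show ?thesis
    using flat_1_bounds[of "real k * (1 - 1) - 1"] flat_1_bounds[of "real k * (1 - 0) - 1"] by linarith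
qed

lemma smooth_fun_cutoff: "smooth_fun (cutoff k)"
proof -
  have "smooth_fun (\<lambda>x. flat 1 (real k * x + - 1) * flat 1 ((- real k) * x + (real k - 1)))"
    by (intro smooth_fun_mult smooth_fun_flat_affine)
  then show ?thesis by (simp add: cutoff_def[abs_def] algebra_simps)
qed

lemma cutoff_bounds: "0 \<le> cutoff k x" "cutoff k x \<le> 1"
  unfolding cutoff_def by (auto intro: mult_le_one simp: flat_1_bounds)

text \<open>The factors stay strictly below 1, so no cutoff equals 1 anywhere. Pointwise convergence
  with values in the unit interval is what dominated convergence uses.\<close>

lemma cutoff_tendsto_1:
  assumes "0 < x" "x < 1"
  shows "(\<lambda>k. cutoff k x) \<longlonglongrightarrow> 1"
proof -
  have "(\<lambda>k. cutoff k x) \<longlonglongrightarrow> poly 1 0 * poly 1 0"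
    unfolding cutoff_def
    using assms by (intro tendsto_mult filterlim_compose[OF flat_tendsto_at_top filterlim_affine_at_top]) auto
  then show ?thesis by simp
qed

section \<open>Test functions and duality\<close>

lemma test_functionsD:
  assumes "\<phi> \<in> test_functions"
  shows "smooth_fun \<phi>" "x \<notin> {0<..<1} \<Longrightarrow> \<phi> x = 0"
  using assms closure_subset[of "{x. \<phi> x \<noteq> 0}"] by (auto simp: test_functions_def smooth_fun_def)

lemma test_functions_deriv:
  assumes "\<phi> \<in> test_functions"
  shows "deriv \<phi> \<in> test_functions"
proof -
  let ?C = "closure {x. \<phi> x \<noteq> 0}"
  have "{x. deriv \<phi> x \<noteq> 0} \<subseteq> ?C"
  proof (rule subsetI, rule ccontr)
    fix x assume x: "x \<in> {x. deriv \<phi> x \<noteq> 0}" "x \<notin> ?C"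
    have "\<forall>\<^sub>F y in nhds x. y \<in> - ?C"
      using x by (intro eventually_nhds_in_open) auto
    then have "\<forall>\<^sub>F y in nhds x. \<phi> y = 0"
      using closure_subset[of "{x. \<phi> x \<noteq> 0}"] by (auto elim!: eventually_mono)
    then have "deriv \<phi> x = deriv (\<lambda>x. 0) x" by (intro deriv_cong_ev) auto
    then show False using x by simp
  qed
  then have sub: "closure {x. deriv \<phi> x \<noteq> 0} \<subseteq> ?C" by (simp add: closure_minimal)
  moreover have "compact (closure {x. deriv \<phi> x \<noteq> 0})"
    using assms compact_Int_closed[of ?C "closure {x. deriv \<phi> x \<noteq> 0}"] sub
    by (simp add: test_functions_def Int_absorb1)
  ultimately show ?thesis
    using assms smooth_fun_deriv[of \<phi>] by (auto simp: test_functions_def smooth_fun_def)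
qed

lemma test_functions_funpow_deriv: "\<phi> \<in> test_functions \<Longrightarrow> (deriv ^^ n) \<phi> \<in> test_functions"
  by (induction n) (auto intro: test_functions_deriv)

lemma test_functions_L2: "\<phi> \<in> test_functions \<Longrightarrow> \<phi> \<in> L2"
  by (intro smooth_fun_L2 test_functionsD)

text \<open>The factors of \<open>cutoff k\<close> vanish for \<open>x \<le> 1 / k\<close> and
  \<open>x \<ge> 1 - 1 / k\<close>, so \<open>h\<close> becomes admissible in the definition of weak
  derivatives whatever its boundary values are.\<close>

lemma cutoff_mult_test_function:
  assumes "smooth_fun h"
  shows "(\<lambda>x. cutoff k x * h x) \<in> test_functions"
proof -
  let ?S = "{x. cutoff k x * h x \<noteq> 0}" and ?K = "{1 / real k .. 1 - 1 / real k}"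
  \<comment> \<open>A nonempty support excludes \<open>k = 0\<close>, where the cutoff is
    identically zero and \<open>1 / real k\<close> would be the default value 0.\<close>
  have K: "?S \<subseteq> ?K" "k > 0" if "?S \<noteq> {}"
  proof -
    show k: "k > 0"
    proof (rule ccontr)
      assume "\<not> k > 0"
      then have "?S = {}" by (simp add: cutoff_def flat_def)
      then show False using that by simp
    qed
    show "?S \<subseteq> ?K"
    proof
      fix x assume "x \<in> ?S"
      then have "flat 1 (real k * x - 1) \<noteq> 0" "flat 1 (real k * (1 - x) - 1) \<noteq> 0"
        by (auto simp: cutoff_def)
      then have "real k * x - 1 > 0" "real k * (1 - x) - 1 > 0"
        by (auto simp: flat_def split: if_splits)
      then show "x \<in> ?K" using k by (simp add: field_simps)
    qed
  qed
  have "compact (closure ?S) \<and> closure ?S \<subseteq> {0<..<1}"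
  proof (cases "?S = {}")
    case True
    then show ?thesis by (simp only: closure_empty) simp
  next
    case False
    then have sub: "closure ?S \<subseteq> ?K" using K by (intro closure_minimal) auto
    have "?K \<subseteq> {0<..<1}"
    proof
      fix x assume "x \<in> ?K"
      moreover have "1 / real k > 0" using K(2)[OF False] by simp
      ultimately show "x \<in> {0<..<1}"
        unfolding greaterThanLessThan_iff atLeastAtMost_iff by linarith
    qed
    moreover have "compact (closure ?S)"
      using sub by (meson bounded_closed_interval bounded_subset closed_closure compact_eq_bounded_closed)
    ultimately show ?thesis using sub by blast
  qed
  then show ?thesis
    using smooth_fun_mult[OF smooth_fun_cutoff assms] unfolding test_functions_def smooth_fun_def by blast
qed

lemma cutoff_mult_tendsto:
  assumes "h \<in> L2"
  shows "(\<lambda>k. L2_norm (\<lambda>x. h x - cutoff k x * h x)) \<longlonglongrightarrow> 0"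
proof (rule L2_dominated_convergence[where w="\<lambda>x. \<bar>h x\<bar>"])
  show "(\<lambda>x. \<bar>h x\<bar>) \<in> L2" using assms by (simp add: L2_def borel_measurable_abs)
  show "(\<lambda>x. cutoff k x * h x) \<in> borel_measurable unit_measure" for k
    by (intro borel_measurable_times L2_measurable assms smooth_fun_L2 smooth_fun_cutoff)
  show "AE x in unit_measure. (\<lambda>k. cutoff k x * h x) \<longlonglongrightarrow> h x"
    by (intro AE_unit_measureI) (auto intro!: tendsto_eq_intros cutoff_tendsto_1)
  show "\<bar>cutoff k x * h x\<bar> \<le> \<bar>h x\<bar>" for k x
    using cutoff_bounds[of k x] by (simp add: abs_mult mult_left_le_one_le)
qed (use assms L2_measurable in auto)

lemma cutoff_mult_L2: "h \<in> L2 \<Longrightarrow> (\<lambda>x. cutoff k x * h x) \<in> L2"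
  using L2_mult_continuous[of h "cutoff k"] smooth_fun_continuous_on[OF smooth_fun_cutoff]
  by (simp add: mult.commute)

text \<open>Duality. A partial Fourier sum \<open>s\<close> of \<open>g\<close> satisfies
  \<open>L2_inner s g = (L2_norm s)\<^sup>2\<close>, so testing with \<open>s\<close> would give
  \<open>L2_norm s \<le> K\<close>. Being no test function, \<open>s\<close> is reached as the limit
  of its products with the cutoffs; Parseval's identity then passes from the partial sums to
  \<open>g\<close>.\<close>

lemma L2_norm_le_test_functions:
  assumes g: "g \<in> L2" and le: "\<And>\<phi>. \<phi> \<in> test_functions \<Longrightarrow> \<bar>L2_inner g \<phi>\<bar> \<le> K * L2_norm \<phi>" and "K \<ge> 0"
  shows "L2_norm g \<le> K"
proof -
  have "(\<Sum>n<N. (sine_coeff g n)\<^sup>2) \<le> K\<^sup>2" for N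
  proof -
    define s where "s = sine_sum (sine_coeff g) N"
    have s: "s \<in> L2" "smooth_fun s" by (simp_all add: s_def sine_sum_L2 smooth_fun_sine_sum)
    have lim: "(\<lambda>k. L2_inner (\<lambda>x. cutoff k x * s x) g) \<longlonglongrightarrow> L2_inner s g"
      by (intro L2_inner_tendsto s g cutoff_mult_tendsto cutoff_mult_L2)
    have "\<bar>L2_inner s g\<bar> \<le> K * (L2_norm s + 0)"
    proof (rule tendsto_le[OF sequentially_bot])
      show "(\<lambda>k. \<bar>L2_inner (\<lambda>x. cutoff k x * s x) g\<bar>) \<longlonglongrightarrow> \<bar>L2_inner s g\<bar>"
        by (intro tendsto_intros lim)
      show "(\<lambda>k. K * (L2_norm s + L2_norm (\<lambda>x. s x - cutoff k x * s x))) \<longlonglongrightarrow> K * (L2_norm s + 0)"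
        by (intro tendsto_intros cutoff_mult_tendsto s)
      have "\<bar>L2_inner (\<lambda>x. cutoff k x * s x) g\<bar> \<le> K * (L2_norm s + L2_norm (\<lambda>x. s x - cutoff k x * s x))" for k
      proof -
        have "L2_norm (\<lambda>x. cutoff k x * s x) \<le> L2_norm s + L2_norm (\<lambda>x. s x - cutoff k x * s x)"
          using L2_norm_triangle[OF s(1) L2_cmult[OF L2_diff[OF s(1) cutoff_mult_L2[OF s(1)]], of "-1"], of k]
            L2_norm_cmult[of "-1" "\<lambda>x. s x - cutoff k x * s x"] by simp
        then have "K * L2_norm (\<lambda>x. cutoff k x * s x) \<le> K * (L2_norm s + L2_norm (\<lambda>x. s x - cutoff k x * s x))"
          using \<open>K \<ge> 0\<close> by (rule mult_left_mono)
        then show ?thesis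
          using le[OF cutoff_mult_test_function[OF s(2), of k]] by (simp add: L2_inner_commute[of _ g])
      qed
      then show "\<forall>\<^sub>F k in sequentially. \<bar>L2_inner (\<lambda>x. cutoff k x * s x) g\<bar> \<le> K * (L2_norm s + L2_norm (\<lambda>x. s x - cutoff k x * s x))"
        by simp
    qed
    moreover have sg: "L2_inner s g = (\<Sum>n<N. (sine_coeff g n)\<^sup>2)"
      unfolding s_def using L2_inner_sine_sum[OF g, of "sine_coeff g" N]
      by (simp add: L2_inner_commute[of _ g] power2_eq_square)
    moreover have ss: "(L2_norm s)\<^sup>2 = (\<Sum>n<N. (sine_coeff g n)\<^sup>2)"
      using L2_inner_sine_sum[OF s(1), of "sine_coeff g" N]
      by (simp add: L2_norm_square s_def sine_coeff_sine_sum power2_eq_square[of "sine_coeff g _"])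
    ultimately have "L2_norm s * L2_norm s \<le> K * L2_norm s"
      by (simp add: power2_eq_square)
    then have "L2_norm s \<le> K"
      using L2_norm_nonneg[of s] \<open>K \<ge> 0\<close> by (cases "L2_norm s = 0") auto
    then show ?thesis using ss L2_norm_nonneg[of s] by (metis power_mono)
  qed
  then have "(L2_norm g)\<^sup>2 \<le> K\<^sup>2"
    using parseval[OF g] unfolding sums_def by (intro LIMSEQ_le_const2) auto
  then show ?thesis using \<open>K \<ge> 0\<close> by (rule power2_le_imp_le)
qed

section \<open>Weak derivatives and boundary values\<close>

lemma integrable_mult_continuous:
  fixes f h :: "real \<Rightarrow> real"
  assumes f: "integrable unit_measure f" and h: "continuous_on {0..1} h"
  shows "integrable unit_measure (\<lambda>x. f x * h x)"
proof -
  obtain B where B: "\<And>x. 0 \<le> x \<Longrightarrow> x \<le> 1 \<Longrightarrow> \<bar>h x\<bar> \<le> B"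
    using continuous_on_unit_bounded[OF h] by blast
  show ?thesis
  proof (rule Bochner_Integration.integrable_bound)
    show "integrable unit_measure (\<lambda>x. B * \<bar>f x\<bar>)" using f by simp
    show "(\<lambda>x. f x * h x) \<in> borel_measurable unit_measure"
      using f by (intro borel_measurable_times L2_measurable[OF L2_continuous[OF h]]) auto
    have "\<bar>f x\<bar> * \<bar>h x\<bar> \<le> \<bar>f x\<bar> * \<bar>B\<bar>" if "0 < x" "x < 1" for x
      using B[of x] that by (intro mult_left_mono) auto
    then show "AE x in unit_measure. norm (f x * h x) \<le> norm (B * \<bar>f x\<bar>)"
      by (intro AE_unit_measureI) (simp add: abs_mult mult.commute)
  qed
qed

text \<open>
  Unlike \<open>vanishes_at\<close>, this also covers the product of a merely square-integrable function with a
  smooth function that is \<open>0\<close> at \<open>y\<close>.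
\<close>

definition vanishing_at :: "real \<Rightarrow> (real \<Rightarrow> real) \<Rightarrow> bool" where
  "vanishing_at y F \<longleftrightarrow>
     (\<forall>\<epsilon>>0. \<exists>G. integrable unit_measure G \<and> (AE x in unit_measure. \<bar>F x\<bar> \<le> \<epsilon> + \<bar>x - y\<bar> * G x))"

text \<open>The mean value inequality bounds \<open>h\<close> by a multiple of
  \<open>\<bar>x - y\<bar>\<close>, and the remaining factor \<open>L * \<bar>f x\<bar>\<close> is
  integrable.\<close>

lemma vanishing_at_mult_smooth:
  assumes f: "f \<in> L2" and h: "smooth_fun h" "h y = 0" and y: "y \<in> {0..1}"
  shows "vanishing_at y (\<lambda>x. f x * h x)"
proof -
  obtain L where L: "L > 0" "\<And>x. 0 \<le> x \<Longrightarrow> x \<le> 1 \<Longrightarrow> \<bar>deriv h x\<bar> \<le> L"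
    using continuous_on_unit_bounded[OF smooth_fun_continuous_on[OF smooth_fun_deriv[OF h(1)]]] by blast
  have "\<bar>h x\<bar> \<le> L * \<bar>x - y\<bar>" if "0 < x" "x < 1" for x
    using field_differentiable_bound[of "{0..1}" h "deriv h" L x y] that y L h(2)
    by (auto intro: has_field_derivative_at_within smooth_fun_has_derivative h(1))
  then have "\<bar>f x * h x\<bar> \<le> \<bar>x - y\<bar> * (L * \<bar>f x\<bar>)" if "0 < x" "x < 1" for x
    using mult_left_mono[of "\<bar>h x\<bar>" "L * \<bar>x - y\<bar>" "\<bar>f x\<bar>"] that by (simp add: abs_mult mult_ac)
  then have "\<bar>f x * h x\<bar> \<le> \<epsilon> + \<bar>x - y\<bar> * (L * \<bar>f x\<bar>)" if "0 < x" "x < 1" "\<epsilon> > 0" for x \<epsilon>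
    using that by (smt (verit))
  then show ?thesis
    unfolding vanishing_at_def
    by (intro allI impI exI[of _ "\<lambda>x. L * \<bar>f x\<bar>"] conjI AE_unit_measureI)
       (use L2_integrable[OF f] in auto)
qed

lemma vanishing_at_mult_continuous:
  assumes f: "vanishes_at f y" and h: "continuous_on {0..1} h" and y: "y \<in> {0..1}"
  shows "vanishing_at y (\<lambda>x. f x * h x)"
  unfolding vanishing_at_def
proof (intro allI impI)
  fix \<epsilon> :: real assume "\<epsilon> > 0"
  obtain g where g: "continuous_on {0..1} g" "AE x in unit_measure. f x = g x" "g y = 0"
    using f unfolding vanishes_at_def by blast
  have gh: "continuous_on {0..1} (\<lambda>x. g x * h x)" using g h by (intro continuous_intros)
  then obtain C where C: "C > 0" "\<And>x. 0 \<le> x \<Longrightarrow> x \<le> 1 \<Longrightarrow> \<bar>g x * h x\<bar> \<le> C"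
    using continuous_on_unit_bounded by blast
  obtain \<delta> where \<delta>: "\<delta> > 0" "\<And>x. x \<in> {0..1} \<Longrightarrow> dist x y < \<delta> \<Longrightarrow> dist (g x * h x) (g y * h y) < \<epsilon>"
    using gh y \<open>\<epsilon> > 0\<close> unfolding continuous_on_iff by meson
  \<comment> \<open>Continuity handles the points within \<open>\<delta>\<close> of
    \<open>y\<close>. At all others \<open>\<bar>x - y\<bar> / \<delta> \<ge> 1\<close>, so the
    constant \<open>C / \<delta>\<close> absorbs the global bound \<open>C\<close>.\<close>
  have bound: "\<bar>g x * h x\<bar> \<le> \<epsilon> + \<bar>x - y\<bar> * (C / \<delta>)" if "0 < x" "x < 1" for x
  proof (cases "\<bar>x - y\<bar> < \<delta>")
    case True
    then have "\<bar>g x * h x\<bar> < \<epsilon>" using \<delta>(2)[of x] that g(3) by (simp add: dist_real_def)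
    moreover have "\<bar>x - y\<bar> * (C / \<delta>) \<ge> 0" using C \<delta> by simp
    ultimately show ?thesis by linarith
  next
    case False
    then have "\<delta> * (C / \<delta>) \<le> \<bar>x - y\<bar> * (C / \<delta>)" using C \<delta> by (intro mult_right_mono) auto
    then have "C \<le> \<bar>x - y\<bar> * (C / \<delta>)" using \<delta>(1) by simp
    then show ?thesis using C(2)[of x] that \<open>\<epsilon> > 0\<close> by linarith
  qed
  have "AE x in unit_measure. \<bar>g x * h x\<bar> \<le> \<epsilon> + \<bar>x - y\<bar> * (C / \<delta>)"
    by (rule AE_unit_measureI) (rule bound)
  with g(2) have "AE x in unit_measure. \<bar>f x * h x\<bar> \<le> \<epsilon> + \<bar>x - y\<bar> * (C / \<delta>)"
    by eventually_elim simp
  moreover have "integrable unit_measure (\<lambda>x. C / \<delta>)"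
    by (rule L2_integrable[OF L2_const])
  ultimately show "\<exists>G. integrable unit_measure G \<and>
      (AE x in unit_measure. \<bar>f x * h x\<bar> \<le> \<epsilon> + \<bar>x - y\<bar> * G x)" by blast
qed

text \<open>The small constant part of the bound on \<open>F\<close> is paid by the mass of the
  kernel. In the other part the weight \<open>\<bar>x - y\<bar>\<close> tames the kernel, leaving
  the majorant \<open>2 * \<bar>G x\<bar>\<close>.\<close>

lemma vanishing_at_kernel_tendsto_0:
  assumes F: "integrable unit_measure F" and small: "vanishing_at y F"
    and cont: "\<And>k. continuous_on {0..1} (\<rho> k)" and nonneg: "\<And>k x. \<rho> k x \<ge> 0"
    and mass: "\<And>k. (LINT x|unit_measure. \<rho> k x) \<le> 1"
    and bound: "\<And>k x. 0 < x \<Longrightarrow> x < 1 \<Longrightarrow> \<bar>x - y\<bar> * \<rho> k x \<le> 2"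
    and lim: "\<And>x. 0 < x \<Longrightarrow> x < 1 \<Longrightarrow> (\<lambda>k. \<rho> k x) \<longlonglongrightarrow> 0"
  shows "(\<lambda>k. LINT x|unit_measure. \<bar>F x\<bar> * \<rho> k x) \<longlonglongrightarrow> 0"
proof (rule LIMSEQ_I)
  fix r :: real assume "r > 0"
  obtain G where G: "integrable unit_measure G"
    and FG: "AE x in unit_measure. \<bar>F x\<bar> \<le> r / 2 + \<bar>x - y\<bar> * G x"
    using small \<open>r > 0\<close> unfolding vanishing_at_def by (meson half_gt_zero)
  have "(\<lambda>k. LINT x|unit_measure. G x * (\<bar>x - y\<bar> * \<rho> k x)) \<longlonglongrightarrow> (LINT x|unit_measure. 0)"
  proof (rule integral_dominated_convergence)
    show "(\<lambda>x. G x * (\<bar>x - y\<bar> * \<rho> k x)) \<in> borel_measurable unit_measure" for k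
      by (intro borel_measurable_integrable integrable_mult_continuous G continuous_intros cont)
    show "integrable unit_measure (\<lambda>x. 2 * \<bar>G x\<bar>)" using G by simp
    show "AE x in unit_measure. (\<lambda>k. G x * (\<bar>x - y\<bar> * \<rho> k x)) \<longlonglongrightarrow> 0"
      by (rule AE_unit_measureI) (auto intro!: tendsto_eq_intros lim)
    have "\<bar>G x\<bar> * \<bar>\<bar>x - y\<bar> * \<rho> k x\<bar> \<le> \<bar>G x\<bar> * 2" if "0 < x" "x < 1" for x k
      using bound[OF that, of k] nonneg by (intro mult_left_mono) auto
    then show "AE x in unit_measure. norm (G x * (\<bar>x - y\<bar> * \<rho> k x)) \<le> 2 * \<bar>G x\<bar>" for k
      by (intro AE_unit_measureI) (simp add: abs_mult mult.commute)
  qed simp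
  then obtain no where no: "\<And>k. k \<ge> no \<Longrightarrow> \<bar>LINT x|unit_measure. G x * (\<bar>x - y\<bar> * \<rho> k x)\<bar> < r / 2"
    using LIMSEQ_D[of _ _ "r / 2"] \<open>r > 0\<close> by fastforce
  have "norm ((LINT x|unit_measure. \<bar>F x\<bar> * \<rho> k x) - 0) < r" if "k \<ge> no" for k
  proof -
    have int: "integrable unit_measure (\<lambda>x. \<bar>F x\<bar> * \<rho> k x)" "integrable unit_measure (\<rho> k)"
        "integrable unit_measure (\<lambda>x. G x * (\<bar>x - y\<bar> * \<rho> k x))"
      by (intro integrable_mult_continuous[OF integrable_abs[OF F]] cont)
         (intro L2_integrable L2_continuous cont, intro integrable_mult_continuous[OF G] continuous_intros cont)
    have "0 \<le> (LINT x|unit_measure. \<bar>F x\<bar> * \<rho> k x)"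
      by (intro Bochner_Integration.integral_nonneg) (simp add: nonneg)
    moreover have "(LINT x|unit_measure. \<bar>F x\<bar> * \<rho> k x)
        \<le> (LINT x|unit_measure. r / 2 * \<rho> k x + G x * (\<bar>x - y\<bar> * \<rho> k x))"
    proof (rule integral_mono_AE)
      show "AE x in unit_measure. \<bar>F x\<bar> * \<rho> k x \<le> r / 2 * \<rho> k x + G x * (\<bar>x - y\<bar> * \<rho> k x)"
        using FG
      proof eventually_elim
        case (elim x)
        from mult_right_mono[OF this nonneg[of k x]] show ?case by (simp add: algebra_simps)
      qed
    qed (use int in auto)
    moreover have "\<dots> = r / 2 * (LINT x|unit_measure. \<rho> k x) + (LINT x|unit_measure. G x * (\<bar>x - y\<bar> * \<rho> k x))"
      using int by simp
    moreover have "r / 2 * (LINT x|unit_measure. \<rho> k x) \<le> r / 2 * 1"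
      using mass \<open>r > 0\<close> by (intro mult_left_mono) auto
    ultimately show ?thesis using no[OF that] by simp
  qed
  then show "\<exists>no. \<forall>k\<ge>no. norm ((LINT x|unit_measure. \<bar>F x\<bar> * \<rho> k x) - 0) < r" by blast
qed

lemma cutoff_deriv_tendsto_0:
  assumes F: "integrable unit_measure F" and small: "vanishing_at 0 F" "vanishing_at 1 F"
  shows "(\<lambda>k. LINT x|unit_measure. F x * deriv (cutoff k) x) \<longlonglongrightarrow> 0"
proof -
  have left: "(\<lambda>k. LINT x|unit_measure. \<bar>F x\<bar> * rise k x) \<longlonglongrightarrow> 0"
    by (rule vanishing_at_kernel_tendsto_0[OF F small(1)])
       (auto intro: continuous_on_rise rise_nonneg LINT_rise_le mult_rise_le rise_tendsto_0)
  have right: "(\<lambda>k. LINT x|unit_measure. \<bar>F x\<bar> * rise k (1 - x)) \<longlonglongrightarrow> 0"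
    using mult_rise_le[of "1 - _"]
    by (intro vanishing_at_kernel_tendsto_0[OF F small(2)])
       (auto intro: continuous_on_rise_reflect rise_nonneg LINT_rise_reflect_le rise_tendsto_0)
  have "(\<lambda>k. (LINT x|unit_measure. \<bar>F x\<bar> * rise k x) + (LINT x|unit_measure. \<bar>F x\<bar> * rise k (1 - x))) \<longlonglongrightarrow> 0"
    using tendsto_add[OF left right] by simp
  then show ?thesis
  proof (rule Lim_null_comparison[rotated], intro always_eventually allI)
    fix k
    have int: "integrable unit_measure (\<lambda>x. \<bar>F x\<bar> * rise k x)"
      "integrable unit_measure (\<lambda>x. \<bar>F x\<bar> * rise k (1 - x))"
      using F by (auto intro!: integrable_mult_continuous continuous_on_rise continuous_on_rise_reflect)
    have bound: "\<bar>F x * deriv (cutoff k) x\<bar> \<le> \<bar>F x\<bar> * rise k x + \<bar>F x\<bar> * rise k (1 - x)" for x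
    proof -
      have "deriv (cutoff k) x = rise k x * flat 1 (real k * (1 - x) - 1) - rise k (1 - x) * flat 1 (real k * x - 1)"
        by (rule DERIV_imp_deriv[OF cutoff_has_derivative])
      moreover have "0 \<le> rise k x * flat 1 (real k * (1 - x) - 1)" "rise k x * flat 1 (real k * (1 - x) - 1) \<le> rise k x"
        "0 \<le> rise k (1 - x) * flat 1 (real k * x - 1)" "rise k (1 - x) * flat 1 (real k * x - 1) \<le> rise k (1 - x)"
        by (auto intro!: mult_nonneg_nonneg mult_right_le_one_le rise_nonneg flat_1_bounds)
      ultimately have "\<bar>deriv (cutoff k) x\<bar> \<le> rise k x + rise k (1 - x)" by linarith
      then show ?thesis by (simp add: abs_mult mult_left_mono flip: distrib_left)
    qed
    have "norm (LINT x|unit_measure. F x * deriv (cutoff k) x)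
       \<le> (LINT x|unit_measure. \<bar>F x\<bar> * rise k x + \<bar>F x\<bar> * rise k (1 - x))"
      by (rule Bochner_Integration.integral_norm_bound_integral)
         (use int bound F in \<open>auto intro!: integrable_mult_continuous smooth_fun_continuous_on smooth_fun_deriv smooth_fun_cutoff\<close>)
    then show "norm (LINT x|unit_measure. F x * deriv (cutoff k) x)
       \<le> (LINT x|unit_measure. \<bar>F x\<bar> * rise k x) + (LINT x|unit_measure. \<bar>F x\<bar> * rise k (1 - x))"
      using int by simp
  qed
qed

section \<open>Calculus of weak derivatives and integration by parts\<close>

lemma has_weak_deriv_iff:
  "has_weak_deriv k f g \<longleftrightarrow>
     (\<forall>\<phi>\<in>test_functions. L2_inner f ((deriv ^^ k) \<phi>) = (- 1) ^ k * L2_inner g \<phi>)"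
  by (simp add: has_weak_deriv_def L2_inner_def)

text \<open>Derivatives of test functions are test functions, so the first relation may be tested
  with \<open>(deriv ^^ j) \<phi>\<close>. This recovers the step from one weak derivative to the
  next from relations that all refer to \<open>f\<close>.\<close>

lemma has_weak_deriv_comp:
  assumes "has_weak_deriv i f g" "has_weak_deriv (i + j) f h"
  shows "has_weak_deriv j g h"
  unfolding has_weak_deriv_iff
proof
  fix \<phi> assume \<phi>: "\<phi> \<in> test_functions"
  have "(- 1) ^ i * L2_inner g ((deriv ^^ j) \<phi>) = L2_inner f ((deriv ^^ i) ((deriv ^^ j) \<phi>))"
    using assms(1) test_functions_funpow_deriv[OF \<phi>] by (simp add: has_weak_deriv_iff)
  also have "\<dots> = (- 1) ^ (i + j) * L2_inner h \<phi>"
    using assms(2) \<phi> by (simp add: has_weak_deriv_iff funpow_add)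
  finally have "(- 1) ^ i * L2_inner g ((deriv ^^ j) \<phi>) = (- 1) ^ i * ((- 1) ^ j * L2_inner h \<phi>)"
    by (simp add: power_add mult.assoc)
  then show "L2_inner g ((deriv ^^ j) \<phi>) = (- 1) ^ j * L2_inner h \<phi>" by simp
qed

text \<open>The difference annihilates every test function, so the duality bound holds with constant
  0.\<close>

lemma has_weak_deriv_unique:
  assumes "g \<in> L2" "h \<in> L2" "has_weak_deriv k f g" "has_weak_deriv k f h"
  shows "AE x in unit_measure. g x = h x"
proof -
  have "L2_inner (\<lambda>x. g x - h x) \<phi> = 0" if \<phi>: "\<phi> \<in> test_functions" for \<phi>
  proof -
    have "(- 1) ^ k * L2_inner g \<phi> = (- 1) ^ k * L2_inner h \<phi>"
      using assms(3,4) \<phi> by (simp add: has_weak_deriv_iff)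
    then show ?thesis using assms \<phi> by (simp add: L2_inner_diff_left test_functions_L2)
  qed
  then have "L2_norm (\<lambda>x. g x - h x) \<le> 0"
    by (intro L2_norm_le_test_functions L2_diff assms) auto
  then have "L2_norm (\<lambda>x. g x - h x) = 0" using L2_norm_nonneg by (simp add: antisym)
  from L2_norm_eq_0[OF L2_diff[OF assms(1,2)] this] show ?thesis by simp
qed

lemma weak_deriv_L2:
  assumes "g \<in> L2" "has_weak_deriv k f g"
  shows "weak_deriv k f \<in> L2" "has_weak_deriv k f (weak_deriv k f)"
    and "AE x in unit_measure. weak_deriv k f x = g x"
proof -
  show w: "weak_deriv k f \<in> L2" "has_weak_deriv k f (weak_deriv k f)"
    unfolding weak_deriv_def using someI[of "\<lambda>g. g \<in> L2 \<and> has_weak_deriv k f g" g] assms by auto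
  show "AE x in unit_measure. weak_deriv k f x = g x"
    using has_weak_deriv_unique[OF w(1) assms(1) w(2) assms(2)] .
qed

lemma has_weak_deriv_0: "has_weak_deriv 0 f f"
  by (simp add: has_weak_deriv_iff)

lemma Sobolev_weak_deriv:
  assumes "f \<in> Sobolev k" "j \<le> k"
  shows "weak_deriv j f \<in> L2" "has_weak_deriv j f (weak_deriv j f)"
proof -
  obtain g where "g \<in> L2" "has_weak_deriv j f g"
    using assms unfolding Sobolev_def by blast
  then show "weak_deriv j f \<in> L2" "has_weak_deriv j f (weak_deriv j f)"
    using weak_deriv_L2 by blast+
qed

lemma Sobolev_L2: "f \<in> Sobolev k \<Longrightarrow> f \<in> L2"
  by (simp add: Sobolev_def)

lemma Sobolev_mono: "f \<in> Sobolev k \<Longrightarrow> j \<le> k \<Longrightarrow> f \<in> Sobolev j"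
  by (auto simp: Sobolev_def)

lemma has_weak_deriv_lincomb:
  assumes "f \<in> L2" "f' \<in> L2" "g \<in> L2" "g' \<in> L2" "has_weak_deriv k f f'" "has_weak_deriv k g g'"
  shows "has_weak_deriv k (\<lambda>x. \<alpha> * f x + \<beta> * g x) (\<lambda>x. \<alpha> * f' x + \<beta> * g' x)"
  unfolding has_weak_deriv_iff
proof
  fix \<phi> assume \<phi>: "\<phi> \<in> test_functions"
  then have "(deriv ^^ k) \<phi> \<in> L2" "\<phi> \<in> L2"
    by (auto intro: test_functions_L2 test_functions_funpow_deriv)
  then show "L2_inner (\<lambda>x. \<alpha> * f x + \<beta> * g x) ((deriv ^^ k) \<phi>) =
      (- 1) ^ k * L2_inner (\<lambda>x. \<alpha> * f' x + \<beta> * g' x) \<phi>"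
    using assms \<phi>
    by (simp add: L2_inner_add_left L2_inner_cmult_left L2_cmult has_weak_deriv_iff algebra_simps)
qed

text \<open>
  The boundary terms are controlled by testing with \<open>cutoff k \<cdot> h\<close>: the derivatives of the cutoffs
  concentrate at the end points, where \<open>f \<cdot> h\<close> is small.
\<close>

lemma weak_deriv_integration_by_parts:
  assumes f: "f \<in> L2" and g: "g \<in> L2" and fg: "has_weak_deriv 1 f g" and h: "smooth_fun h"
    and small: "vanishing_at 0 (\<lambda>x. f x * h x)" "vanishing_at 1 (\<lambda>x. f x * h x)"
  shows "L2_inner g h = - L2_inner f (deriv h)"
proof -
  have h': "h \<in> L2" "deriv h \<in> L2" using h by (auto intro: smooth_fun_L2 smooth_fun_deriv)
  have int: "integrable unit_measure (\<lambda>x. f x * h x)" by (intro L2_mult_integrable f h')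
  have eq: "L2_inner (\<lambda>x. cutoff k x * h x) g =
      - ((LINT x|unit_measure. f x * h x * deriv (cutoff k) x) + L2_inner (\<lambda>x. cutoff k x * deriv h x) f)" for k
  proof -
    have "deriv (\<lambda>x. cutoff k x * h x) x = deriv (cutoff k) x * h x + cutoff k x * deriv h x" for x
      using DERIV_imp_deriv[OF DERIV_mult[OF smooth_fun_has_derivative[OF smooth_fun_cutoff] smooth_fun_has_derivative[OF h]]]
      by (simp add: mult.commute)
    then have "L2_inner f (deriv (\<lambda>x. cutoff k x * h x))
      = (LINT x|unit_measure. f x * h x * deriv (cutoff k) x + cutoff k x * deriv h x * f x)"
      by (simp add: L2_inner_def algebra_simps)
    also have "\<dots> = (LINT x|unit_measure. f x * h x * deriv (cutoff k) x) + L2_inner (\<lambda>x. cutoff k x * deriv h x) f"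
      unfolding L2_inner_def
      by (intro Bochner_Integration.integral_add integrable_mult_continuous[OF int] smooth_fun_continuous_on
          smooth_fun_deriv smooth_fun_cutoff L2_mult_integrable cutoff_mult_L2 h' f)
    finally show ?thesis
      using fg cutoff_mult_test_function[OF h, of k]
      by (simp add: has_weak_deriv_iff L2_inner_commute[of _ g])
  qed
  have "(\<lambda>k. - ((LINT x|unit_measure. f x * h x * deriv (cutoff k) x) + L2_inner (\<lambda>x. cutoff k x * deriv h x) f))
      \<longlonglongrightarrow> - (0 + L2_inner (deriv h) f)"
    by (intro tendsto_intros cutoff_deriv_tendsto_0 int small L2_inner_tendsto h' f cutoff_mult_tendsto cutoff_mult_L2)
  moreover have "(\<lambda>k. L2_inner (\<lambda>x. cutoff k x * h x) g) \<longlonglongrightarrow> L2_inner h g"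
    by (intro L2_inner_tendsto h' g cutoff_mult_tendsto cutoff_mult_L2)
  ultimately show ?thesis
    unfolding eq using LIMSEQ_unique by (fastforce simp: L2_inner_commute)
qed

lemma deriv_trig: "deriv (trig j n) = trig (Suc j) n"
  by (rule ext) (rule DERIV_imp_deriv[OF has_real_derivative_trig])

text \<open>Two integrations by parts, whose boundary terms vanish for different reasons: first
  because the sine is 0 at the ends while \<open>f1\<close> is merely in \<open>L2\<close>, then
  because \<open>f\<close> is 0 there while the cosine is not.\<close>

lemma sine_coeff_second_weak_deriv:
  assumes L2: "f \<in> L2" "f1 \<in> L2" "f2 \<in> L2" and weak: "has_weak_deriv 1 f f1" "has_weak_deriv 2 f f2"
    and ends: "vanishes_at f 0" "vanishes_at f 1"
  shows "sine_coeff f2 n = - ((freq n)\<^sup>2 * sine_coeff f n)"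
proof -
  have weak': "has_weak_deriv 1 f1 f2"
    by (rule has_weak_deriv_comp[OF weak(1)]) (use weak(2) in \<open>simp add: numeral_2_eq_2\<close>)
  have "L2_inner f2 (trig 0 n) = - L2_inner f1 (trig 1 n)"
    using weak_deriv_integration_by_parts[OF L2(2,3) weak' smooth_fun_trig[of 0 n]]
    by (simp add: deriv_trig trig_0_ends vanishing_at_mult_smooth L2 smooth_fun_trig)
  also have "L2_inner f1 (trig 1 n) = - L2_inner f (trig 2 n)"
    using weak_deriv_integration_by_parts[OF L2(1,2) weak(1) smooth_fun_trig[of 1 n]]
    by (simp add: deriv_trig numeral_2_eq_2 vanishing_at_mult_continuous ends continuous_on_trig)
  also have "L2_inner f (trig 2 n) = - (freq n)\<^sup>2 * L2_inner f (trig 0 n)"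
    using L2_inner_cmult_right[of f "- (freq n)\<^sup>2" "trig 0 n"] by (simp add: trig_2[abs_def])
  finally show ?thesis by (simp add: sine_coeff_def)
qed

lemma sine_coeff_weak_deriv_2:
  assumes "f \<in> Sobolev 2" "vanishes_at f 0" "vanishes_at f 1"
  shows "sine_coeff (weak_deriv 2 f) n = - ((freq n)\<^sup>2 * sine_coeff f n)"
  by (rule sine_coeff_second_weak_deriv[of f "weak_deriv 1 f"])
     (use assms in \<open>auto intro: Sobolev_weak_deriv Sobolev_L2\<close>)

lemma sine_coeff_cong_AE:
  "f \<in> L2 \<Longrightarrow> g \<in> L2 \<Longrightarrow> AE x in unit_measure. f x = g x \<Longrightarrow> sine_coeff f n = sine_coeff g n"
  unfolding sine_coeff_def by (rule L2_inner_cong_AE) (auto intro: trig_L2)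

lemma sine_coeff_le: "f \<in> L2 \<Longrightarrow> \<bar>sine_coeff f n\<bar> \<le> L2_norm f"
  using L2_inner_le[OF _ trig_L2, of f 0 n]
  by (simp add: sine_coeff_def L2_norm_eq_sqrt_inner[of "trig _ _"] trig_0_orthonormal)

lemma L2_norm_le_sine_coeff:
  assumes "f \<in> L2" "g \<in> L2" "C \<ge> 0" "\<And>n. \<bar>sine_coeff f n\<bar> \<le> C * \<bar>sine_coeff g n\<bar>"
  shows "L2_norm f \<le> C * L2_norm g"
proof (rule power2_le_imp_le)
  have "(sine_coeff f n)\<^sup>2 \<le> C\<^sup>2 * (sine_coeff g n)\<^sup>2" for n
    using power_mono[OF assms(4)[of n], of 2] by (simp add: power_mult_distrib)
  then have "(L2_norm f)\<^sup>2 \<le> C\<^sup>2 * (L2_norm g)\<^sup>2"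
    by (rule sums_le[OF _ parseval[OF assms(1)] sums_mult[OF parseval[OF assms(2)]]])
  then show "(L2_norm f)\<^sup>2 \<le> (C * L2_norm g)\<^sup>2" by (simp add: power_mult_distrib)
qed (use assms L2_norm_nonneg in auto)

section \<open>Control of the Sobolev norm by the second derivative\<close>

lemma smooth_test_integration_by_parts:
  assumes s: "smooth_fun s" and \<phi>: "\<phi> \<in> test_functions"
  shows "L2_inner s (deriv \<phi>) = - L2_inner (deriv s) \<phi>"
proof -
  have \<phi>s: "smooth_fun \<phi>" and ends: "\<phi> 0 = 0" "\<phi> 1 = 0" using test_functionsD[OF \<phi>] by auto
  have "(LINT x|unit_measure. deriv s x * \<phi> x + s x * deriv \<phi> x) = s 1 * \<phi> 1 - s 0 * \<phi> 0"
  proof (rule LINT_unit_measure_FTC)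
    show "((\<lambda>x. s x * \<phi> x) has_real_derivative deriv s x * \<phi> x + s x * deriv \<phi> x) (at x)" for x
      using DERIV_mult[OF smooth_fun_has_derivative[OF s] smooth_fun_has_derivative[OF \<phi>s]]
      by (simp add: mult.commute)
  qed (intro continuous_intros smooth_fun_continuous_on smooth_fun_deriv s \<phi>s)
  then show ?thesis
    using s \<phi>s by (simp add: ends L2_inner_def L2_mult_integrable smooth_fun_L2 smooth_fun_deriv)
qed

lemma deriv_sine_sum: "deriv (sine_sum a N) = (\<lambda>x. \<Sum>n<N. a n * trig 1 n x)"
proof
  fix x
  show "deriv (sine_sum a N) x = (\<Sum>n<N. a n * trig 1 n x)"
    unfolding sine_sum_def[abs_def]
    by (intro DERIV_imp_deriv DERIV_sum DERIV_cmult) (use has_real_derivative_trig[of 0] in simp)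
qed

lemma L2_norm_deriv_sine_sum:
  "(L2_norm (deriv (sine_sum a N)))\<^sup>2 = (\<Sum>n<N. (a n * freq n)\<^sup>2)"
proof -
  have t: "(\<lambda>x. a n * trig 1 n x) \<in> L2" for n by (intro L2_cmult trig_L2)
  have "L2_inner (\<lambda>x. \<Sum>n<N. a n * trig 1 n x) (\<lambda>x. a m * trig 1 m x) = (a m * freq m)\<^sup>2" if "m < N" for m
  proof -
    have "L2_inner (\<lambda>x. \<Sum>n<N. a n * trig 1 n x) (\<lambda>x. a m * trig 1 m x)
        = (\<Sum>n<N. L2_inner (\<lambda>x. a n * trig 1 n x) (\<lambda>x. a m * trig 1 m x))"
      by (intro L2_inner_sum_left t)
    also have "\<dots> = (\<Sum>n<N. if n = m then (a m * freq m)\<^sup>2 else 0)"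
      unfolding L2_inner_cmult_left L2_inner_cmult_right trig_1_orthogonal
      by (intro sum.cong) (auto simp: power2_eq_square)
    finally show ?thesis using that by simp
  qed
  moreover have "L2_inner (\<lambda>x. \<Sum>n<N. a n * trig 1 n x) (\<lambda>x. \<Sum>n<N. a n * trig 1 n x)
      = (\<Sum>m<N. L2_inner (\<lambda>x. \<Sum>n<N. a n * trig 1 n x) (\<lambda>x. a m * trig 1 m x))"
    by (intro L2_inner_sum_right t L2_sum)
  ultimately show ?thesis
    unfolding L2_norm_square deriv_sine_sum by simp
qed

text \<open>The first derivative is naturally a cosine series, for which no Parseval identity is at
  hand. Instead \<open>f1\<close> is bounded by duality: pairings of \<open>f\<close> with
  \<open>deriv \<phi>\<close> are limits of those of its sine sums, whose derivatives are bounded by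
  \<open>L2_norm f2\<close> since each frequency is at least 1.\<close>

lemma L2_norm_weak_deriv_1_le:
  assumes L2: "f \<in> L2" "f1 \<in> L2" "f2 \<in> L2" and weak: "has_weak_deriv 1 f f1" "has_weak_deriv 2 f f2"
    and ends: "vanishes_at f 0" "vanishes_at f 1"
  shows "L2_norm f1 \<le> L2_norm f2"
proof (rule L2_norm_le_test_functions[OF L2(2) _ L2_norm_nonneg])
  fix \<phi> assume \<phi>: "\<phi> \<in> test_functions"
  define s where "s = sine_sum (sine_coeff f)"
  have smooth: "smooth_fun (s N)" for N by (simp add: s_def smooth_fun_sine_sum)
  have norm: "L2_norm (deriv (s N)) \<le> L2_norm f2" for N
  proof (rule power2_le_imp_le)
    have "(sine_coeff f n * freq n)\<^sup>2 \<le> (sine_coeff f2 n)\<^sup>2" for n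
    proof (rule power2_le_iff_abs_le[THEN iffD2, of "\<bar>sine_coeff f2 n\<bar>", simplified])
      have "\<bar>sine_coeff f n\<bar> * freq n * 1 \<le> \<bar>sine_coeff f n\<bar> * freq n * freq n"
        using freq_ge_1[of n] freq_pos[of n] by (intro mult_left_mono) auto
      then show "\<bar>sine_coeff f n * freq n\<bar> \<le> \<bar>sine_coeff f2 n\<bar>"
        using freq_pos[of n]
        by (simp add: sine_coeff_second_weak_deriv[OF L2 weak ends] abs_mult power2_eq_square mult_ac)
    qed
    then have "(L2_norm (deriv (s N)))\<^sup>2 \<le> (\<Sum>n<N. (sine_coeff f2 n)\<^sup>2)"
      unfolding s_def L2_norm_deriv_sine_sum by (rule sum_mono)
    also have "\<dots> \<le> (L2_norm f2)\<^sup>2"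
      using sums_unique[OF parseval[OF L2(3)]] sum_le_suminf[OF sums_summable[OF parseval[OF L2(3)]], of "{..<N}"]
      by simp
    finally show "(L2_norm (deriv (s N)))\<^sup>2 \<le> (L2_norm f2)\<^sup>2" .
  qed (rule L2_norm_nonneg)
  have bound: "\<bar>L2_inner (s N) (deriv \<phi>)\<bar> \<le> L2_norm f2 * L2_norm \<phi>" for N
  proof -
    have "\<bar>L2_inner (deriv (s N)) \<phi>\<bar> \<le> L2_norm (deriv (s N)) * L2_norm \<phi>"
      by (intro L2_inner_le smooth_fun_L2 smooth_fun_deriv smooth test_functions_L2 \<phi>)
    also have "\<dots> \<le> L2_norm f2 * L2_norm \<phi>"
      by (intro mult_right_mono norm L2_norm_nonneg)
    finally show ?thesis by (simp add: smooth_test_integration_by_parts[OF smooth \<phi>])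
  qed
  have "(\<lambda>N. \<bar>L2_inner (s N) (deriv \<phi>)\<bar>) \<longlonglongrightarrow> \<bar>L2_inner f (deriv \<phi>)\<bar>"
    unfolding s_def
    by (intro tendsto_intros L2_inner_sine_sum_tendsto L2 test_functions_L2 test_functions_deriv \<phi>)
  then have "\<bar>L2_inner f (deriv \<phi>)\<bar> \<le> L2_norm f2 * L2_norm \<phi>"
    by (rule LIMSEQ_le_const2) (use bound in auto)
  then show "\<bar>L2_inner f1 \<phi>\<bar> \<le> L2_norm f2 * L2_norm \<phi>"
    using weak(1) \<phi> by (simp add: has_weak_deriv_iff)
qed

lemma L2_norm_le_second_weak_deriv:
  assumes L2: "f \<in> L2" "f1 \<in> L2" "f2 \<in> L2" and weak: "has_weak_deriv 1 f f1" "has_weak_deriv 2 f f2"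
    and ends: "vanishes_at f 0" "vanishes_at f 1"
  shows "L2_norm f \<le> L2_norm f2"
proof -
  have "\<bar>sine_coeff f n\<bar> \<le> 1 * \<bar>sine_coeff f2 n\<bar>" for n
  proof -
    have "1 * \<bar>sine_coeff f n\<bar> \<le> (freq n)\<^sup>2 * \<bar>sine_coeff f n\<bar>"
      using freq_ge_1[of n] by (intro mult_right_mono) (auto simp: one_le_power)
    then show ?thesis by (simp add: sine_coeff_second_weak_deriv[OF assms] abs_mult)
  qed
  from L2_norm_le_sine_coeff[OF L2(1,3) _ this] show ?thesis by simp
qed

text \<open>Each of the three squares in the norm is at most that of the second derivative; rounding
  3 up to 4 gives the factor 2.\<close>

lemma Sobolev_norm_2_le:
  assumes f: "f \<in> Sobolev 2" and ends: "vanishes_at f 0" "vanishes_at f 1"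
  shows "Sobolev_norm 2 f \<le> 2 * L2_norm (weak_deriv 2 f)"
proof -
  let ?K = "L2_norm (weak_deriv 2 f)"
  have w: "weak_deriv j f \<in> L2" "has_weak_deriv j f (weak_deriv j f)" if "j \<le> 2" for j
    using Sobolev_weak_deriv[OF f that] .
  have "L2_norm (weak_deriv 0 f) = L2_norm f"
    using weak_deriv_L2[OF Sobolev_L2[OF f] has_weak_deriv_0] Sobolev_L2[OF f]
    by (intro L2_norm_cong_AE) auto
  also have "\<dots> \<le> ?K"
    using L2_norm_le_second_weak_deriv[OF Sobolev_L2[OF f] w(1)[of 1] w(1)[of 2] w(2)[of 1] w(2)[of 2] ends] by simp
  finally have 0: "(L2_norm (weak_deriv 0 f))\<^sup>2 \<le> ?K\<^sup>2"
    by (intro power_mono L2_norm_nonneg)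
  have "L2_norm (weak_deriv 1 f) \<le> ?K"
    using L2_norm_weak_deriv_1_le[OF Sobolev_L2[OF f] w(1)[of 1] w(1)[of 2] w(2)[of 1] w(2)[of 2] ends] by simp
  then have 1: "(L2_norm (weak_deriv 1 f))\<^sup>2 \<le> ?K\<^sup>2"
    by (intro power_mono L2_norm_nonneg)
  have "(\<Sum>j\<le>2. (L2_norm (weak_deriv j f))\<^sup>2)
      = (L2_norm (weak_deriv 0 f))\<^sup>2 + (L2_norm (weak_deriv 1 f))\<^sup>2 + ?K\<^sup>2"
    by (simp add: numeral_2_eq_2)
  also have "\<dots> \<le> 4 * ?K\<^sup>2" using 0 1 zero_le_power2[of ?K] by linarith
  also have "\<dots> = (2 * ?K)\<^sup>2" by (simp add: power_mult_distrib)
  finally show ?thesis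
    unfolding Sobolev_norm_def using L2_norm_nonneg by (intro real_le_lsqrt) auto
qed

lemma L2_norm_weak_deriv_le_Sobolev_norm: "j \<le> k \<Longrightarrow> L2_norm (weak_deriv j f) \<le> Sobolev_norm k f"
  unfolding Sobolev_norm_def
  by (intro real_le_rsqrt) (rule member_le_sum, auto)

text \<open>The fourth-order boundary problem splits into two second-order ones of the same kind,
  for \<open>f\<close> and for \<open>weak_deriv 2 f\<close>, so the coefficient formula can be
  applied twice.\<close>

lemma H4_star_Sobolev_2:
  assumes "f \<in> H4_star"
  shows "f \<in> Sobolev 2" "weak_deriv 2 f \<in> Sobolev 2"
    and "vanishes_at f 0" "vanishes_at f 1" "vanishes_at (weak_deriv 2 f) 0" "vanishes_at (weak_deriv 2 f) 1"
    and "has_weak_deriv 2 (weak_deriv 2 f) (weak_deriv 4 f)" "weak_deriv 4 f \<in> L2"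
proof -
  have f: "f \<in> Sobolev 4" using assms by (simp add: H4_star_def)
  show "f \<in> Sobolev 2" using Sobolev_mono[OF f] by simp
  show "vanishes_at f 0" "vanishes_at f 1" "vanishes_at (weak_deriv 2 f) 0" "vanishes_at (weak_deriv 2 f) 1"
    using assms by (simp_all add: H4_star_def)
  have comp: "has_weak_deriv j (weak_deriv 2 f) (weak_deriv (2 + j) f)" if "j \<le> 2" for j
    by (rule has_weak_deriv_comp[of 2 f]; rule Sobolev_weak_deriv[OF f]) (use that in auto)
  have L2: "weak_deriv (2 + j) f \<in> L2" if "j \<le> 2" for j
    by (rule Sobolev_weak_deriv[OF f]) (use that in simp)
  show "weak_deriv 2 f \<in> Sobolev 2"
    unfolding Sobolev_def
  proof (intro CollectI conjI allI impI)
    show "weak_deriv 2 f \<in> L2" using L2[of 0] by simp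
    show "\<exists>g\<in>L2. has_weak_deriv j (weak_deriv 2 f) g" if "j \<le> 2" for j
      using L2[OF that] comp[OF that] by blast
  qed
  show "has_weak_deriv 2 (weak_deriv 2 f) (weak_deriv 4 f)" "weak_deriv 4 f \<in> L2"
    using comp[of 2] Sobolev_weak_deriv[OF f, of 4] by auto
qed

lemma sine_coeff_weak_deriv_4:
  assumes "f \<in> H4_star"
  shows "sine_coeff (weak_deriv 4 f) n = (freq n) ^ 4 * sine_coeff f n"
proof -
  note f = H4_star_Sobolev_2[OF assms]
  have "sine_coeff (weak_deriv 4 f) n = - ((freq n)\<^sup>2 * sine_coeff (weak_deriv 2 f) n)"
    by (rule sine_coeff_second_weak_deriv[of _ "weak_deriv 1 (weak_deriv 2 f)"])
       (use f in \<open>auto intro: Sobolev_L2 Sobolev_weak_deriv\<close>)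
  also have "\<dots> = (freq n) ^ 4 * sine_coeff f n"
    by (simp add: sine_coeff_weak_deriv_2[OF f(1,3,4)] power2_eq_square power4_eq_xxxx)
  finally show ?thesis .
qed

section \<open>Sine series with rapidly decaying coefficients\<close>

text \<open>Summability against all powers of the frequency is smoothness read off the coefficients:
  the sine series and all its termwise derivatives converge uniformly.\<close>

definition rapid :: "(nat \<Rightarrow> real) \<Rightarrow> bool" where
  "rapid a \<longleftrightarrow> (\<forall>k. summable (\<lambda>n. freq n ^ k * \<bar>a n\<bar>))"

text \<open>A polynomial loss \<open>freq n ^ j\<close> is harmless because the hypothesis covers
  every power; the closure properties under multipliers are special cases.\<close>

lemma rapid_le:
  assumes "rapid a" "\<And>n. \<bar>b n\<bar> \<le> C * freq n ^ j * \<bar>a n\<bar>"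
  shows "rapid b"
  unfolding rapid_def
proof
  fix k
  have "summable (\<lambda>n. C * (freq n ^ (k + j) * \<bar>a n\<bar>))"
    using assms(1) by (intro summable_mult) (simp add: rapid_def)
  then show "summable (\<lambda>n. freq n ^ k * \<bar>b n\<bar>)"
  proof (rule summable_comparison_test'[where N=0])
    show "norm (freq n ^ k * \<bar>b n\<bar>) \<le> C * (freq n ^ (k + j) * \<bar>a n\<bar>)" for n
      using mult_left_mono[OF assms(2)[of n], of "freq n ^ k"] freq_pos[of n]
      by (simp add: power_add mult_ac)
  qed
qed

lemma rapid_cmult: "rapid a \<Longrightarrow> rapid (\<lambda>n. c * a n)"
  by (rule rapid_le[of a _ "\<bar>c\<bar>" 0]) (auto simp: abs_mult)

lemma rapid_freq_mult: "rapid a \<Longrightarrow> rapid (\<lambda>n. freq n ^ j * a n)"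
  by (rule rapid_le[of a _ 1 j]) (auto simp: abs_mult freq_pos less_imp_le)

lemma rapid_bounded_mult: "rapid a \<Longrightarrow> (\<And>n. \<bar>\<sigma> n\<bar> \<le> C) \<Longrightarrow> rapid (\<lambda>n. \<sigma> n * a n)"
  by (rule rapid_le[of a _ C 0]) (auto simp: abs_mult mult_right_mono)

lemma rapid_add:
  assumes "rapid a" "rapid b"
  shows "rapid (\<lambda>n. a n + b n)"
  unfolding rapid_def
proof
  fix k
  have "summable (\<lambda>n. freq n ^ k * \<bar>a n\<bar> + freq n ^ k * \<bar>b n\<bar>)"
    using assms by (intro summable_add) (simp_all add: rapid_def)
  then show "summable (\<lambda>n. freq n ^ k * \<bar>a n + b n\<bar>)"
  proof (rule summable_comparison_test'[where N=0])
    show "norm (freq n ^ k * \<bar>a n + b n\<bar>) \<le> freq n ^ k * \<bar>a n\<bar> + freq n ^ k * \<bar>b n\<bar>" for n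
      using freq_pos[of n] by (simp add: abs_mult flip: distrib_left)
  qed
qed

lemma rapid_diff: "rapid a \<Longrightarrow> rapid b \<Longrightarrow> rapid (\<lambda>n. a n - b n)"
  using rapid_add[OF _ rapid_cmult[of b "-1"]] by simp

lemma rapid_sum: "(\<And>i. i \<in> I \<Longrightarrow> rapid (a i)) \<Longrightarrow> rapid (\<lambda>n. \<Sum>i\<in>I. a i n)"
  by (induction I rule: infinite_finite_induct) (auto intro: rapid_add simp: rapid_def[of "\<lambda>n. 0"])

lemma power_le_fact_exp:
  fixes y :: real
  assumes "y \<ge> 0"
  shows "y ^ k \<le> fact k * exp y"
proof -
  have "(\<Sum>n\<in>{k}. y ^ n /\<^sub>R fact n) \<le> exp y"
    using exp_converges[of y] assms
    by (metis (no_types, lifting) finite.intros sum_le_suminf sums_iff divideR_right fact_ge_zero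
        finite_insert finite.emptyI inverse_nonnegative_iff_nonnegative real_scaleR_def mult_nonneg_nonneg zero_le_power)
  then show ?thesis by (simp add: field_simps)
qed

text \<open>A single term of the exponential series at \<open>y * t\<close> is at most the whole.
  The bound does not depend on \<open>y\<close>, hence later not on the mode, and degenerates only
  as \<open>t\<close> tends to 0.\<close>

lemma power_mult_exp_le:
  fixes y t :: real
  assumes "y \<ge> 0" "t > 0"
  shows "y ^ k * exp (- y * t) \<le> fact k / t ^ k"
proof -
  have "(y * t) ^ k * exp (- (y * t)) \<le> fact k * exp (y * t) * exp (- (y * t))"
    using assms by (intro mult_right_mono power_le_fact_exp) auto
  also have "\<dots> = fact k" by (simp flip: exp_add)
  finally show ?thesis using assms by (simp add: field_simps)
qed

lemma rapid_exp:
  assumes "t > 0"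
  shows "rapid (\<lambda>n. exp (- freq n * t))"
  unfolding rapid_def
proof
  fix k
  have "summable (\<lambda>n. inverse (real (Suc n) ^ 2))"
    by (subst summable_Suc_iff) (rule inverse_power_summable, simp)
  then have "summable (\<lambda>n. fact (k + 2) / t ^ (k + 2) * inverse (real (Suc n) ^ 2))"
    by (rule summable_mult)
  then show "summable (\<lambda>n. freq n ^ k * \<bar>exp (- freq n * t)\<bar>)"
  proof (rule summable_comparison_test'[where N=0])
    fix n
    \<comment> \<open>Two extra powers are spent on the factor \<open>inverse (freq n ^ 2)\<close>,
      which is compared with the convergent series of inverse squares.\<close>
    have "freq n ^ (k + 2) * exp (- freq n * t) \<le> fact (k + 2) / t ^ (k + 2)"
      using assms freq_pos[of n] by (intro power_mult_exp_le) auto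
    then have "freq n ^ (k + 2) * exp (- freq n * t) * inverse (freq n ^ 2) \<le> fact (k + 2) / t ^ (k + 2) * inverse (real (Suc n) ^ 2)"
      using assms freq_ge[of n] by (intro mult_mono le_imp_inverse_le power_mono) auto
    moreover have "freq n ^ (k + 2) * exp (- freq n * t) * inverse (freq n ^ 2) = freq n ^ k * exp (- freq n * t)"
      using freq_pos[of n] by (simp add: power_add power2_eq_square field_simps)
    ultimately show "norm (freq n ^ k * \<bar>exp (- freq n * t)\<bar>) \<le> fact (k + 2) / t ^ (k + 2) * inverse (real (Suc n) ^ 2)"
      using freq_pos[of n] by (simp only: real_norm_def abs_mult abs_abs abs_exp_cancel abs_of_nonneg zero_le_power less_imp_le)
  qed
qed

section \<open>Termwise calculus of trigonometric series\<close>

definition trig_series :: "nat \<Rightarrow> (nat \<Rightarrow> real) \<Rightarrow> real \<Rightarrow> real" where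
  "trig_series j a x = (\<Sum>n. a n * trig j n x)"

lemma trig_series_term_le: "\<bar>a n * trig j n x\<bar> \<le> 2 * (freq n ^ j * \<bar>a n\<bar>)"
  using mult_left_mono[OF trig_bound[of j n x], of "\<bar>a n\<bar>"] by (simp add: abs_mult mult_ac)

lemma summable_trig_series:
  assumes "rapid a"
  shows "summable (\<lambda>n. a n * trig j n x)"
proof (rule summable_comparison_test)
  show "summable (\<lambda>n. 2 * (freq n ^ j * \<bar>a n\<bar>))"
    using assms by (intro summable_mult) (simp add: rapid_def)
qed (use trig_series_term_le in auto)

lemma continuous_on_trig_series:
  assumes "rapid a"
  shows "continuous_on S (trig_series j a)"
proof -
  have "uniform_limit S (\<lambda>n x. \<Sum>i<n. a i * trig j i x) (\<lambda>x. \<Sum>i. a i * trig j i x) sequentially"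
  proof (rule Weierstrass_m_test)
    show "summable (\<lambda>n. 2 * (freq n ^ j * \<bar>a n\<bar>))"
      using assms by (intro summable_mult) (simp add: rapid_def)
  qed (use trig_series_term_le in auto)
  then show ?thesis
    unfolding trig_series_def[abs_def]
    by (rule uniform_limit_theorem[rotated]) (auto intro!: always_eventually continuous_intros continuous_on_trig)
qed

lemma trig_series_L2: "rapid a \<Longrightarrow> trig_series j a \<in> L2"
  by (intro L2_continuous continuous_on_trig_series)

text \<open>Reduces every pairing with the series to single modes. Both the sine coefficients and
  the weak derivatives of the series are read off from it.\<close>

lemma L2_inner_trig_series:
  assumes a: "rapid a" and g: "g \<in> L2"
  shows "(\<lambda>n. a n * L2_inner (trig j n) g) sums L2_inner (trig_series j a) g"
proof -
  define P where "P N x = (\<Sum>n<N. a n * trig j n x)" for N x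
  have P: "P N \<in> L2" for N
    unfolding P_def[abs_def] by (intro L2_sum L2_cmult trig_L2)
  have sm: "summable (\<lambda>n. 2 * (freq n ^ j * \<bar>a n\<bar>))"
    using a by (intro summable_mult) (simp add: rapid_def)
  let ?w = "\<Sum>n. 2 * (freq n ^ j * \<bar>a n\<bar>)"
  have "(\<lambda>N. L2_norm (\<lambda>x. trig_series j a x - P N x)) \<longlonglongrightarrow> 0"
  proof (rule L2_dominated_convergence[where w = "\<lambda>x. ?w"])
    have lim: "(\<lambda>N. P N x) \<longlonglongrightarrow> trig_series j a x" for x
      using summable_sums[OF summable_trig_series[OF a, of j x]]
      by (simp add: sums_def trig_series_def P_def)
    then show "AE x in unit_measure. (\<lambda>N. P N x) \<longlonglongrightarrow> trig_series j a x" by simp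
    have bound: "\<bar>P N x\<bar> \<le> ?w" for N x
    proof -
      have "\<bar>P N x\<bar> \<le> (\<Sum>n<N. 2 * (freq n ^ j * \<bar>a n\<bar>))"
        unfolding P_def by (rule order_trans[OF sum_abs sum_mono]) (rule trig_series_term_le)
      also have "\<dots> \<le> ?w"
        using freq_pos by (intro sum_le_suminf sm) (simp_all add: less_imp_le)
      finally show ?thesis .
    qed
    then show "\<bar>P N x\<bar> \<le> ?w" for N x .
    show "\<bar>trig_series j a x\<bar> \<le> ?w" for x
      by (rule LIMSEQ_le_const2[OF tendsto_rabs[OF lim]]) (use bound in auto)
  qed (auto intro: L2_measurable P trig_series_L2 a L2_const)
  then have "(\<lambda>N. L2_inner (P N) g) \<longlonglongrightarrow> L2_inner (trig_series j a) g"
    by (intro L2_inner_tendsto trig_series_L2 a g P)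
  moreover have "L2_inner (P N) g = (\<Sum>n<N. a n * L2_inner (trig j n) g)" for N
    unfolding P_def[abs_def] by (subst L2_inner_sum_left) (auto intro: L2_cmult trig_L2 g simp: L2_inner_cmult_left)
  ultimately show ?thesis by (simp add: sums_def)
qed

lemma sine_coeff_trig_series:
  assumes "rapid a"
  shows "sine_coeff (trig_series 0 a) n = a n"
proof -
  have "(\<lambda>m. a m * L2_inner (trig 0 m) (trig 0 n)) sums sine_coeff (trig_series 0 a) n"
    unfolding sine_coeff_def by (rule L2_inner_trig_series[OF assms trig_L2])
  moreover have "(\<lambda>m. a m * L2_inner (trig 0 m) (trig 0 n)) = (\<lambda>m. if m = n then a m else 0)"
    by (auto simp: trig_0_orthonormal)
  ultimately show ?thesis using sums_single[of n a] sums_unique2 by fastforce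
qed

lemma L2_inner_trig_test_function:
  assumes "\<phi> \<in> test_functions"
  shows "L2_inner (trig i n) ((deriv ^^ j) \<phi>) = (- 1) ^ j * L2_inner (trig (i + j) n) \<phi>"
proof (induction j arbitrary: i)
  case (Suc j)
  have "L2_inner (trig i n) (deriv ((deriv ^^ j) \<phi>)) = - L2_inner (trig (Suc i) n) ((deriv ^^ j) \<phi>)"
    using smooth_test_integration_by_parts[OF smooth_fun_trig test_functions_funpow_deriv[OF assms]]
    by (simp add: deriv_trig)
  then show ?case using Suc.IH[of "Suc i"] by simp
qed simp

lemma has_weak_deriv_trig_series:
  assumes "rapid a"
  shows "has_weak_deriv j (trig_series i a) (trig_series (i + j) a)"
  unfolding has_weak_deriv_iff
proof
  fix \<phi> assume \<phi>: "\<phi> \<in> test_functions"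
  have "(\<lambda>n. a n * L2_inner (trig i n) ((deriv ^^ j) \<phi>)) sums L2_inner (trig_series i a) ((deriv ^^ j) \<phi>)"
    by (intro L2_inner_trig_series assms test_functions_L2 test_functions_funpow_deriv \<phi>)
  moreover have "(\<lambda>n. (- 1) ^ j * (a n * L2_inner (trig (i + j) n) \<phi>)) sums ((- 1) ^ j * L2_inner (trig_series (i + j) a) \<phi>)"
    by (intro sums_mult L2_inner_trig_series assms test_functions_L2 \<phi>)
  ultimately show "L2_inner (trig_series i a) ((deriv ^^ j) \<phi>) = (- 1) ^ j * L2_inner (trig_series (i + j) a) \<phi>"
    by (simp add: L2_inner_trig_test_function[OF \<phi>] mult_ac sums_iff)
qed

lemma trig_series_2: "trig_series 2 a = trig_series 0 (\<lambda>n. - ((freq n)\<^sup>2 * a n))"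
  by (auto simp: trig_series_def trig_2 mult_ac)

lemma trig_series_4: "trig_series 4 a = trig_series 0 (\<lambda>n. freq n ^ 4 * a n)"
proof -
  have "trig 4 n x = freq n ^ 4 * trig 0 n x" for n x
    by (simp add: numeral_eq_Suc trig_Suc_Suc power2_eq_square)
  then show ?thesis by (auto simp: trig_series_def mult_ac)
qed

lemma trig_series_0_ends: "trig_series 0 a 0 = 0" "trig_series 0 a 1 = 0"
  by (simp_all add: trig_series_def trig_0_ends)

lemma trig_series_lincomb:
  assumes "rapid a" "rapid b"
  shows "\<alpha> * trig_series j a x + \<beta> * trig_series j b x = trig_series j (\<lambda>n. \<alpha> * a n + \<beta> * b n) x"
  unfolding trig_series_def
  by (simp add: assms summable_trig_series summable_mult suminf_mult[symmetric] suminf_add distrib_right mult.assoc)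

lemma trig_series_sum:
  assumes "\<And>i. i \<in> I \<Longrightarrow> rapid (a i)"
  shows "(\<Sum>i\<in>I. c i * trig_series j (a i) x) = trig_series j (\<lambda>n. \<Sum>i\<in>I. c i * a i n) x"
  using assms
proof (induction I rule: infinite_finite_induct)
  case (insert i I)
  then show ?case
    using trig_series_lincomb[of "a i" "\<lambda>n. \<Sum>i\<in>I. c i * a i n" "c i" j x 1]
    by (simp add: rapid_sum rapid_cmult)
qed (simp_all add: trig_series_def)

lemma trig_series_Sobolev: "rapid a \<Longrightarrow> trig_series 0 a \<in> Sobolev k"
  unfolding Sobolev_def using has_weak_deriv_trig_series[of a _ 0] trig_series_L2 by fastforce

lemma vanishes_at_trig_series:
  "rapid a \<Longrightarrow> vanishes_at (trig_series 0 a) 0" "rapid a \<Longrightarrow> vanishes_at (trig_series 0 a) 1"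
  unfolding vanishes_at_def using continuous_on_trig_series trig_series_0_ends by blast+

lemma weak_deriv_trig_series:
  assumes "rapid a"
  shows "AE x in unit_measure. weak_deriv j (trig_series 0 a) x = trig_series j a x" "weak_deriv j (trig_series 0 a) \<in> L2"
  using weak_deriv_L2[OF trig_series_L2[OF assms] has_weak_deriv_trig_series[OF assms, of j 0, simplified]] by auto

lemma vanishes_at_cong_AE:
  assumes "AE x in unit_measure. f x = g x" "vanishes_at g y"
  shows "vanishes_at f y"
proof -
  obtain h where h: "continuous_on {0..1} h" "AE x in unit_measure. g x = h x" "h y = 0"
    using assms(2) unfolding vanishes_at_def by blast
  have "AE x in unit_measure. f x = h x" using assms(1) h(2) by eventually_elim simp
  then show ?thesis using h unfolding vanishes_at_def by blast
qed

lemma trig_series_H4_star: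
  assumes a: "rapid a"
  shows "trig_series 0 a \<in> H4_star"
proof -
  have r: "rapid (\<lambda>n. - ((freq n)\<^sup>2 * a n))"
    using rapid_cmult[OF rapid_freq_mult[OF a, of 2], of "-1"] by simp
  have "vanishes_at (weak_deriv 2 (trig_series 0 a)) y" if "y \<in> {0, 1}" for y
    using vanishes_at_cong_AE[OF weak_deriv_trig_series(1)[OF a, of 2]] vanishes_at_trig_series[OF r] that
    by (auto simp: trig_series_2)
  then show ?thesis
    using a unfolding H4_star_def by (auto simp: trig_series_Sobolev vanishes_at_trig_series)
qed

lemma Sobolev_norm_trig_series_le:
  assumes a: "rapid a"
  shows "Sobolev_norm 2 (trig_series 0 a) \<le> 2 * L2_norm (trig_series 0 (\<lambda>n. (freq n)\<^sup>2 * a n))"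
proof -
  have r: "rapid (\<lambda>n. (freq n)\<^sup>2 * a n)" by (rule rapid_freq_mult[OF a])
  have "L2_norm (weak_deriv 2 (trig_series 0 a)) = L2_norm (trig_series 2 a)"
    by (intro L2_norm_cong_AE weak_deriv_trig_series trig_series_L2 a)
  also have "trig_series 2 a = (\<lambda>x. - 1 * trig_series 0 (\<lambda>n. (freq n)\<^sup>2 * a n) x)"
    using trig_series_lincomb[OF r r, of "-1" 0 _ 0] by (auto simp: trig_series_2)
  finally have "L2_norm (weak_deriv 2 (trig_series 0 a)) = L2_norm (trig_series 0 (\<lambda>n. (freq n)\<^sup>2 * a n))"
    by (simp only: L2_norm_cmult)
  then show ?thesis
    using Sobolev_norm_2_le[OF trig_series_Sobolev[OF a] vanishes_at_trig_series[OF a]] by simp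
qed

text \<open>Dominated convergence on the side of the coefficients: by Parseval's identity the
  squared norm is a series with majorant \<open>B\<^sup>2 * (sine_coeff f n)\<^sup>2\<close>, and
  Tannery's theorem exchanges limit and sum. Since \<open>f\<close> is only required to be in
  \<open>L2\<close>, this also covers the initial time.\<close>

lemma L2_norm_multiplier_tendsto_0:
  assumes f: "f \<in> L2"
    and g: "\<forall>\<^sub>F s in F. g s \<in> L2 \<and> (\<forall>n. sine_coeff (g s) n = m s n * sine_coeff f n \<and> \<bar>m s n\<bar> \<le> B)"
    and lim: "\<And>n. ((\<lambda>s. m s n) \<longlongrightarrow> 0) F"
  shows "((\<lambda>s. L2_norm (g s)) \<longlongrightarrow> 0) F"
proof (cases "F = bot")
  case F: False
  have "((\<lambda>s. \<Sum>n. (m s n * sine_coeff f n)\<^sup>2) \<longlongrightarrow> (\<Sum>n. 0)) F"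
  proof (rule conjunct2[OF conjunct2[OF tannerys_theorem]])
    show "((\<lambda>s. (m s n * sine_coeff f n)\<^sup>2) \<longlongrightarrow> 0) F" for n
      using lim[of n] by (auto intro!: tendsto_eq_intros)
    show "summable (\<lambda>n. B\<^sup>2 * (sine_coeff f n)\<^sup>2)"
      by (intro summable_mult sums_summable[OF parseval[OF f]])
    have "norm ((m s n * sine_coeff f n)\<^sup>2) \<le> B\<^sup>2 * (sine_coeff f n)\<^sup>2" if "\<bar>m s n\<bar> \<le> B" for s n
      using power_mono[OF that, of 2] by (simp add: power_mult_distrib mult_right_mono)
    then have "\<forall>\<^sub>F s in F. \<forall>n. norm ((m s n * sine_coeff f n)\<^sup>2) \<le> B\<^sup>2 * (sine_coeff f n)\<^sup>2"
      using g by (auto elim!: eventually_mono)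
    then show "\<forall>\<^sub>F (n, s) in at_top \<times>\<^sub>F F. norm ((m s n * sine_coeff f n)\<^sup>2) \<le> B\<^sup>2 * (sine_coeff f n)\<^sup>2"
      unfolding eventually_prod_filter
      by (intro exI[of _ "\<lambda>_. True"] exI[of _ "\<lambda>s. \<forall>n. norm ((m s n * sine_coeff f n)\<^sup>2) \<le> B\<^sup>2 * (sine_coeff f n)\<^sup>2"]) auto
  qed (rule F)
  then have "((\<lambda>s. sqrt (\<Sum>n. (m s n * sine_coeff f n)\<^sup>2)) \<longlongrightarrow> sqrt 0) F"
    by (intro tendsto_real_sqrt) simp
  moreover have "\<forall>\<^sub>F s in F. sqrt (\<Sum>n. (m s n * sine_coeff f n)\<^sup>2) = L2_norm (g s)"
    using g
  proof eventually_elim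
    case (elim s)
    then have "(\<Sum>n. (m s n * sine_coeff f n)\<^sup>2) = (L2_norm (g s))\<^sup>2"
      using parseval[of "g s"] by (simp add: sums_iff)
    then show ?case by (simp add: L2_norm_nonneg)
  qed
  ultimately show ?thesis by (simp add: Lim_transform_eventually)
qed simp

section \<open>The diagonal flow\<close>

text \<open>Used with \<open>A\<close> and \<open>B\<close> equal to \<open>b\<close> and
  \<open>d\<close> divided by the effective heat capacity
  \<open>a + \<eta>\<^sup>2 / c\<close>.\<close>

definition decay_rate :: "real \<Rightarrow> real \<Rightarrow> nat \<Rightarrow> real" where
  "decay_rate A B n = A * (freq n)\<^sup>2 + B * freq n ^ 4"

text \<open>The sine coefficients of the \<open>p\<close>-th time derivative of the solution of the diagonalised flow.\<close>

definition flow_coeff :: "real \<Rightarrow> real \<Rightarrow> (real \<Rightarrow> real) \<Rightarrow> nat \<Rightarrow> real \<Rightarrow> nat \<Rightarrow> real" where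
  "flow_coeff A B f p t n = (- decay_rate A B n) ^ p * exp (- decay_rate A B n * t) * sine_coeff f n"

text \<open>
  \<open>\<sigma> = 1\<close> yields the temperature in the norm of \<open>L2\<close>; \<open>\<sigma> n = \<kappa> / (freq n)\<^sup>2\<close> yields the
  displacement, whose norm in \<open>Sobolev 2\<close> is that of the temperature up to a constant.
\<close>

locale diagonal_flow =
  fixes A B :: real and f :: "real \<Rightarrow> real"
    and X :: "(real \<Rightarrow> real) set" and N :: "(real \<Rightarrow> real) \<Rightarrow> real" and \<sigma> :: "nat \<Rightarrow> real" and C K :: real
  assumes A_pos: "A > 0" and B_pos: "B > 0" and f_L2: "f \<in> L2"
    and X_trig_series: "\<And>a. rapid a \<Longrightarrow> trig_series 0 a \<in> X"
    and \<sigma>_bounded: "\<And>n. \<bar>\<sigma> n\<bar> \<le> K"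
    and N_nonneg: "\<And>g. N g \<ge> 0"
    and N_le: "\<And>a. rapid a \<Longrightarrow> N (trig_series 0 (\<lambda>n. \<sigma> n * a n)) \<le> C * L2_norm (trig_series 0 a)"
begin

abbreviation r :: "nat \<Rightarrow> real" where "r \<equiv> decay_rate A B"

definition flow :: "nat \<Rightarrow> real \<Rightarrow> real \<Rightarrow> real" where
  "flow p t = trig_series 0 (\<lambda>n. \<sigma> n * flow_coeff A B f p t n)"

lemma rate_pos: "r n > 0"
  unfolding decay_rate_def using A_pos B_pos freq_pos[of n] by (intro add_pos_pos mult_pos_pos) auto

text \<open>Linear growth in the frequency already lets the exponential beat every power; combined
  with \<open>freq n \<ge> 1\<close> it also yields the uniform decay exponent
  \<open>A\<close>.\<close>

lemma rate_ge: "A * freq n \<le> r n"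
proof -
  have "A * (freq n * 1) \<le> A * (freq n * freq n)"
    using A_pos freq_pos[of n] freq_ge_1[of n] by (intro mult_left_mono) auto
  moreover have "B * freq n ^ 4 \<ge> 0" using B_pos freq_pos[of n] by simp
  ultimately show ?thesis by (simp add: decay_rate_def power2_eq_square)
qed

lemma rate_le: "r n \<le> (A + B) * freq n ^ 4"
proof -
  have "A * (freq n)\<^sup>2 \<le> A * freq n ^ 4"
    using A_pos freq_ge_1[of n] by (intro mult_left_mono power_increasing) auto
  then show ?thesis by (simp add: decay_rate_def distrib_right)
qed

text \<open>Parabolic smoothing: the initial coefficients are merely bounded, and the
  \<open>p\<close> factors of the rate cost a power \<open>4 * p\<close> of the frequency, but the
  exponential outweighs both once \<open>t > 0\<close>.\<close>

lemma rapid_flow_coeff: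
  assumes "t > 0"
  shows "rapid (flow_coeff A B f p t)"
proof (rule rapid_le[OF rapid_exp])
  show "A * t > 0" using assms A_pos by simp
  fix n
  have "r n ^ p \<le> ((A + B) * freq n ^ 4) ^ p"
    using rate_pos[of n] rate_le[of n] by (intro power_mono) auto
  moreover have "exp (- r n * t) \<le> exp (- freq n * (A * t))"
    using mult_right_mono[OF rate_ge[of n], of t] assms by (simp add: mult_ac)
  ultimately have "r n ^ p * exp (- r n * t) * \<bar>sine_coeff f n\<bar>
      \<le> ((A + B) * freq n ^ 4) ^ p * exp (- freq n * (A * t)) * L2_norm f"
    using rate_pos[of n] A_pos B_pos freq_pos[of n]
    by (intro mult_mono sine_coeff_le f_L2) (auto intro!: mult_nonneg_nonneg zero_le_power)
  then show "\<bar>flow_coeff A B f p t n\<bar> \<le>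
      ((A + B) ^ p * L2_norm f) * freq n ^ (4 * p) * \<bar>exp (- freq n * (A * t))\<bar>"
    using rate_pos[of n] unfolding power_mult[of "freq n" 4 p]
    by (simp add: flow_coeff_def abs_mult power_abs power_mult_distrib mult_ac)
qed

lemma rapid_\<sigma>_mult: "rapid a \<Longrightarrow> rapid (\<lambda>n. \<sigma> n * a n)"
  by (rule rapid_bounded_mult) (auto intro: \<sigma>_bounded)

lemma flow_in_X: "t > 0 \<Longrightarrow> flow p t \<in> X"
  unfolding flow_def by (intro X_trig_series rapid_\<sigma>_mult rapid_flow_coeff)

text \<open>The bound is uniform in the mode, but only away from time 0. The limits at
  \<open>t\<close> below therefore look only at times beyond \<open>t / 2\<close>.\<close>

lemma multiplier_le:
  assumes "\<tau> > 0" "s \<ge> \<tau>"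
  shows "\<bar>(- r n) ^ p * exp (- r n * s)\<bar> \<le> fact p / \<tau> ^ p"
proof -
  have "r n ^ p * exp (- r n * s) \<le> r n ^ p * exp (- r n * \<tau>)"
    using assms rate_pos[of n] by (intro mult_left_mono) auto
  also have "\<dots> \<le> fact p / \<tau> ^ p"
    using assms rate_pos[of n] by (intro power_mult_exp_le) auto
  finally show ?thesis using rate_pos[of n] by (simp add: abs_mult power_abs)
qed

text \<open>The common form of all limits below: continuity, differentiability and power series each
  reduce to multipliers \<open>m s n\<close> that vanish in the limit for every mode and are bounded
  uniformly in the modes. The sequence \<open>d s\<close> holds the coefficients before the factor
  \<open>\<sigma>\<close>.\<close>

lemma N_multiplier_tendsto_0:
  assumes g: "\<forall>\<^sub>F s in F. rapid (d s) \<and> g s = trig_series 0 (\<lambda>n. \<sigma> n * d s n) \<and>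
      (\<forall>n. d s n = m s n * sine_coeff f n \<and> \<bar>m s n\<bar> \<le> M)"
    and lim: "\<And>n. ((\<lambda>s. m s n) \<longlongrightarrow> 0) F"
  shows "((\<lambda>s. N (g s)) \<longlongrightarrow> 0) F"
proof (rule Lim_null_comparison)
  have "((\<lambda>s. L2_norm (trig_series 0 (d s))) \<longlongrightarrow> 0) F"
  proof (rule L2_norm_multiplier_tendsto_0[OF f_L2 _ lim])
    show "\<forall>\<^sub>F s in F. trig_series 0 (d s) \<in> L2 \<and>
        (\<forall>n. sine_coeff (trig_series 0 (d s)) n = m s n * sine_coeff f n \<and> \<bar>m s n\<bar> \<le> M)"
      using g by eventually_elim (auto simp: sine_coeff_trig_series trig_series_L2)
  qed
  then show "((\<lambda>s. C * L2_norm (trig_series 0 (d s))) \<longlongrightarrow> 0) F"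
    by (auto intro: tendsto_eq_intros)
  show "\<forall>\<^sub>F s in F. norm (N (g s)) \<le> C * L2_norm (trig_series 0 (d s))"
    using g
  proof eventually_elim
    case (elim s)
    then have "N (g s) \<le> C * L2_norm (trig_series 0 (d s))" using N_le[of "d s"] by metis
    then show ?case using N_nonneg[of "g s"] by simp
  qed
qed

lemma eventually_gt_half:
  assumes "t > (0::real)"
  shows "\<forall>\<^sub>F s in at t within S. s > t / 2"
  using assms by (intro order_tendstoD(1)[OF tendsto_ident_at]) auto

lemma continuous_curve_flow: "continuous_curve X N {0<..} (flow p)"
  unfolding continuous_curve_def
proof (intro conjI ballI)
  fix t :: real assume "t \<in> {0<..}"
  then have t: "t > 0" by simp
  define m where "m s n = (- r n) ^ p * exp (- r n * s) - (- r n) ^ p * exp (- r n * t)" for s n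
  show "((\<lambda>s. N (\<lambda>x. flow p s x - flow p t x)) \<longlongrightarrow> 0) (at t within {0<..})"
  proof (rule N_multiplier_tendsto_0)
    show "\<forall>\<^sub>F s in at t within {0<..}. rapid (\<lambda>n. flow_coeff A B f p s n - flow_coeff A B f p t n) \<and>
        (\<lambda>x. flow p s x - flow p t x) = trig_series 0 (\<lambda>n. \<sigma> n * (flow_coeff A B f p s n - flow_coeff A B f p t n)) \<and>
        (\<forall>n. flow_coeff A B f p s n - flow_coeff A B f p t n = m s n * sine_coeff f n \<and>
          \<bar>m s n\<bar> \<le> fact p / (t / 2) ^ p + fact p / (t / 2) ^ p)"
      using eventually_gt_half[OF t]
    proof eventually_elim
      case (elim s)
      then have s: "s > 0" using t by simp
      show ?case
      proof (intro conjI allI)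
        show "rapid (\<lambda>n. flow_coeff A B f p s n - flow_coeff A B f p t n)"
          by (intro rapid_diff rapid_flow_coeff s t)
        show "(\<lambda>x. flow p s x - flow p t x) = trig_series 0 (\<lambda>n. \<sigma> n * (flow_coeff A B f p s n - flow_coeff A B f p t n))"
          using trig_series_lincomb[OF rapid_\<sigma>_mult[OF rapid_flow_coeff[OF s]] rapid_\<sigma>_mult[OF rapid_flow_coeff[OF t]], of 1 0 p _ "-1" p]
          by (simp add: flow_def right_diff_distrib)
        show "flow_coeff A B f p s n - flow_coeff A B f p t n = m s n * sine_coeff f n" for n
          by (simp add: flow_coeff_def m_def left_diff_distrib)
        show "\<bar>m s n\<bar> \<le> fact p / (t / 2) ^ p + fact p / (t / 2) ^ p" for n
          unfolding m_def
          using multiplier_le[of "t / 2" s n p] multiplier_le[of "t / 2" t n p] elim t by linarith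
      qed
    qed
    show "((\<lambda>s. m s n) \<longlongrightarrow> 0) (at t within {0<..})" for n
      unfolding m_def by (auto intro!: tendsto_eq_intros)
  qed
qed (auto intro: flow_in_X)

lemma has_curve_deriv_flow:
  assumes t: "t > 0"
  shows "has_curve_deriv N (flow p) (flow (Suc p) t) t"
  unfolding has_curve_deriv_def
proof (rule N_multiplier_tendsto_0)
  define h where "h n s = (- r n) ^ p * exp (- r n * s)" for n s
  have h: "(h n has_real_derivative (- r n) ^ Suc p * exp (- r n * s)) (at s within S)" for n s S
    unfolding h_def[abs_def] by (auto intro!: derivative_eq_intros simp: mult_ac)
  define m where "m s n = (h n s - h n t) / (s - t) - (- r n) ^ Suc p * exp (- r n * t)" for s n
  define L where "L = fact (Suc p) / (t / 2) ^ Suc p"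
  let ?d = "\<lambda>s n. (flow_coeff A B f p s n - flow_coeff A B f p t n) / (s - t) - flow_coeff A B f (Suc p) t n"
  show "((\<lambda>s. m s n) \<longlongrightarrow> 0) (at t)" for n
    using h[of n t UNIV] unfolding m_def has_field_derivative_iff LIM_zero_iff by simp
  have "\<forall>\<^sub>F s in at t. s \<noteq> t" by (simp add: eventually_at_filter)
  then show "\<forall>\<^sub>F s in at t. rapid (?d s) \<and>
      (\<lambda>x. (flow p s x - flow p t x) / (s - t) - flow (Suc p) t x) = trig_series 0 (\<lambda>n. \<sigma> n * ?d s n) \<and>
      (\<forall>n. ?d s n = m s n * sine_coeff f n \<and> \<bar>m s n\<bar> \<le> L + L)"
    using eventually_gt_half[OF t]
  proof eventually_elim
    case (elim s)
    then have s: "s > 0" using t by simp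
    \<comment> \<open>Two nested linear combinations, the shape in which
      \<open>trig_series_lincomb\<close> collects the three series into one.\<close>
    have eq: "(u - v) / (s - t) - w = 1 * (1 / (s - t) * u + - (1 / (s - t)) * v) + - 1 * w" for u v w :: real
      by (simp add: diff_divide_distrib)
    note rs = rapid_flow_coeff[OF s, of p] and rt = rapid_flow_coeff[OF t]
    have rd: "rapid (\<lambda>n. 1 / (s - t) * (flow_coeff A B f p s n) + - (1 / (s - t)) * flow_coeff A B f p t n)"
      by (intro rapid_add rapid_cmult rs rt)
    show ?case
    proof (intro conjI allI)
      show "rapid (?d s)"
        unfolding eq by (intro rapid_add rapid_cmult rs rt)
      have "(flow p s x - flow p t x) / (s - t) - flow (Suc p) t x = trig_series 0 (\<lambda>n. \<sigma> n * ?d s n) x" for x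
        unfolding eq flow_def
        by (subst trig_series_lincomb trig_series_lincomb,
            (intro rapid_add rapid_cmult rapid_\<sigma>_mult rs rt)+)+ (simp add: algebra_simps)
      then show "(\<lambda>x. (flow p s x - flow p t x) / (s - t) - flow (Suc p) t x) = trig_series 0 (\<lambda>n. \<sigma> n * ?d s n)" by blast
      fix n
      show "?d s n = m s n * sine_coeff f n"
        by (simp add: flow_coeff_def m_def h_def left_diff_distrib distrib_right diff_divide_distrib)
      \<comment> \<open>The mean value inequality on \<open>{t / 2..}\<close>, where the derivative
        of each multiplier is bounded by \<open>L\<close> independently of the mode.\<close>
      have "norm (h n s - h n t) \<le> L * norm (s - t)"
      proof (rule field_differentiable_bound[where S="{t / 2..}"])
        show "(h n has_real_derivative (- r n) ^ Suc p * exp (- r n * z)) (at z within {t / 2..})" for z by (rule h)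
        show "norm ((- r n) ^ Suc p * exp (- r n * z)) \<le> L" if "z \<in> {t / 2..}" for z
          using multiplier_le[of "t / 2" z n "Suc p"] that t by (simp add: L_def del: power_Suc fact_Suc)
      qed (use elim t in auto)
      then have "\<bar>(h n s - h n t) / (s - t)\<bar> \<le> L"
        using elim by (simp add: abs_divide divide_le_eq)
      moreover have "\<bar>(- r n) ^ Suc p * exp (- r n * t)\<bar> \<le> L"
        using multiplier_le[of "t / 2" t n "Suc p"] t by (simp add: L_def del: power_Suc fact_Suc)
      ultimately show "\<bar>m s n\<bar> \<le> L + L" unfolding m_def by linarith
    qed
  qed
qed

lemma C1_curve_flow: "C1_curve_with_deriv X N {0<..} (flow p) (flow (Suc p))"
  unfolding C1_curve_with_deriv_def
  by (auto intro: flow_in_X has_curve_deriv_flow continuous_curve_flow)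

text \<open>Crude, but independent of \<open>m\<close>: it serves as the majorant for the power
  series of all modes at once.\<close>

lemma exp_partial_sum_bound:
  fixes y :: real
  shows "\<bar>exp y - (\<Sum>k<m. y ^ k / fact k)\<bar> \<le> 2 * exp \<bar>y\<bar>"
proof -
  have "\<bar>\<Sum>k<m. y ^ k / fact k\<bar> \<le> (\<Sum>k<m. \<bar>y\<bar> ^ k / fact k)"
    by (rule order_trans[OF sum_abs]) (simp add: abs_divide power_abs)
  also have "\<dots> \<le> exp \<bar>y\<bar>"
    using exp_converges[of "\<bar>y\<bar>"] sum_le_suminf[of "\<lambda>k. \<bar>y\<bar> ^ k / fact k" "{..<m}"]
    by (auto simp: sums_iff divide_inverse_commute)
  moreover have "exp y \<le> exp \<bar>y\<bar>" "exp y > 0" by auto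
  ultimately show ?thesis by linarith
qed

text \<open>Each mode is expanded in its exponential series around \<open>t\<close>. The radius is
  \<open>t\<close>, the distance to the initial time: for \<open>\<bar>s - t\<bar> < t\<close> the
  growth \<open>exp (r n * \<bar>s - t\<bar>)\<close> of the remainder is compensated by
  \<open>exp (- r n * t)\<close>, leaving the bound 2 in every mode.\<close>

lemma analytic_curve_flow: "analytic_curve X N {0<..} (flow 0)"
  unfolding analytic_curve_def
proof (intro conjI ballI)
  fix t :: real assume "t \<in> {0<..}"
  then have t: "t > 0" by simp
  note rt = rapid_flow_coeff[OF t]
  define q where "q k = trig_series 0 (\<lambda>n. \<sigma> n * (1 / fact k * flow_coeff A B f k t n))" for k
  have "(\<lambda>m. N (\<lambda>x. flow 0 s x - (\<Sum>k<m. (s - t) ^ k * q k x))) \<longlonglongrightarrow> 0" if s: "s > 0" "\<bar>s - t\<bar> < t" for s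
  proof (rule N_multiplier_tendsto_0)
    let ?d = "\<lambda>m n. flow_coeff A B f 0 s n - (\<Sum>k<m. (s - t) ^ k * (1 / fact k * flow_coeff A B f k t n))"
    define y where "y n = - r n * (s - t)" for n
    define M where "M m n = exp (- r n * t) * (exp (y n) - (\<Sum>k<m. y n ^ k / fact k))" for m n
    note rs = rapid_flow_coeff[OF s(1), of 0]
    have "(\<lambda>m. M m n) \<longlonglongrightarrow> exp (- r n * t) * (exp (y n) - exp (y n))" for n
      unfolding M_def using exp_converges[of "y n"]
      by (intro tendsto_intros) (simp add: sums_def divide_inverse_commute)
    then show "(\<lambda>m. M m n) \<longlonglongrightarrow> 0" for n by simp
    show "\<forall>\<^sub>F m in sequentially. rapid (?d m) \<and>
        (\<lambda>x. flow 0 s x - (\<Sum>k<m. (s - t) ^ k * q k x)) = trig_series 0 (\<lambda>n. \<sigma> n * ?d m n) \<and>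
        (\<forall>n. ?d m n = M m n * sine_coeff f n \<and> \<bar>M m n\<bar> \<le> 2)"
    proof (intro always_eventually allI conjI)
      fix m n
      show "rapid (?d m)"
        by (intro rapid_diff rapid_sum rapid_cmult rs rt)
      have "flow 0 s x - (\<Sum>k<m. (s - t) ^ k * q k x) = trig_series 0 (\<lambda>n. \<sigma> n * ?d m n) x" for x
      proof -
        have "(\<Sum>k<m. (s - t) ^ k * q k x) = trig_series 0 (\<lambda>n. \<Sum>k<m. (s - t) ^ k * (\<sigma> n * (1 / fact k * flow_coeff A B f k t n))) x"
          unfolding q_def by (intro trig_series_sum rapid_\<sigma>_mult rapid_cmult rt)
        moreover have "1 * flow 0 s x + - 1 * \<dots> = trig_series 0 (\<lambda>n. 1 * (\<sigma> n * flow_coeff A B f 0 s n) + - 1 * (\<Sum>k<m. (s - t) ^ k * (\<sigma> n * (1 / fact k * flow_coeff A B f k t n)))) x"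
          unfolding flow_def by (intro trig_series_lincomb rapid_sum rapid_\<sigma>_mult rapid_cmult rs rt)
        ultimately show ?thesis
          by (simp add: right_diff_distrib sum_distrib_left sum_negf mult_ac)
      qed
      then show "(\<lambda>x. flow 0 s x - (\<Sum>k<m. (s - t) ^ k * q k x)) = trig_series 0 (\<lambda>n. \<sigma> n * ?d m n)" by blast
      have "flow_coeff A B f 0 s n = exp (- r n * t) * exp (y n) * sine_coeff f n"
        unfolding y_def by (simp add: flow_coeff_def algebra_simps flip: exp_add)
      moreover have "(s - t) ^ k * (1 / fact k * flow_coeff A B f k t n) = exp (- r n * t) * (y n ^ k / fact k) * sine_coeff f n" for k
        unfolding y_def power_mult_distrib by (simp add: flow_coeff_def)
      ultimately have "?d m n = exp (- r n * t) * exp (y n) * sine_coeff f n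
          - (\<Sum>k<m. exp (- r n * t) * (y n ^ k / fact k) * sine_coeff f n)"
        by (simp only:)
      then show "?d m n = M m n * sine_coeff f n"
        by (simp only: M_def right_diff_distrib left_diff_distrib sum_distrib_left sum_distrib_right)
      have "\<bar>M m n\<bar> \<le> exp (- r n * t) * (2 * exp \<bar>y n\<bar>)"
        unfolding M_def abs_mult by (simp add: exp_partial_sum_bound)
      also have "\<bar>y n\<bar> = r n * \<bar>s - t\<bar>" using rate_pos[of n] by (simp add: y_def abs_mult)
      also have "exp (- r n * t) * (2 * exp (r n * \<bar>s - t\<bar>)) = 2 * exp (r n * (\<bar>s - t\<bar> - t))"
        by (simp add: algebra_simps flip: exp_add)
      also have "\<dots> \<le> 2"
        using s(2) rate_pos[of n] by (simp add: mult_nonneg_nonpos)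
      finally show "\<bar>M m n\<bar> \<le> 2" .
    qed
  qed
  moreover have "q k \<in> X" for k
    unfolding q_def by (intro X_trig_series rapid_\<sigma>_mult rapid_cmult rt)
  ultimately show "\<exists>\<rho>>0. \<exists>q. (\<forall>n. q n \<in> X) \<and> (\<forall>s\<in>{0<..}. \<bar>s - t\<bar> < \<rho> \<longrightarrow>
      (\<lambda>m. N (\<lambda>x. flow 0 s x - (\<Sum>n<m. (s - t) ^ n * q n x))) \<longlonglongrightarrow> 0)"
    using t by (intro exI[of _ t] conjI exI[of _ q]) auto
qed (auto intro: flow_in_X)

end

section \<open>Existence and decay\<close>

lemma sine_coeff_diff: "f \<in> L2 \<Longrightarrow> g \<in> L2 \<Longrightarrow> sine_coeff (\<lambda>x. f x - g x) n = sine_coeff f n - sine_coeff g n"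
  unfolding sine_coeff_def by (rule L2_inner_diff_left) (auto intro: trig_L2)

lemma sine_coeff_cmult: "sine_coeff (\<lambda>x. c * f x) n = c * sine_coeff f n"
  unfolding sine_coeff_def by (rule L2_inner_cmult_left)

text \<open>The constructed temperature coincides with the flow only at positive times; a derivative
  at \<open>t > 0\<close> sees only these.\<close>

lemma has_curve_deriv_cong:
  assumes "\<And>s. s > 0 \<Longrightarrow> f s = g s" "t > 0"
  shows "has_curve_deriv N f h t \<longleftrightarrow> has_curve_deriv N g h t"
  unfolding has_curve_deriv_def
proof (rule tendsto_cong)
  have "\<forall>\<^sub>F s in at t. s > 0"
    using assms(2) by (intro order_tendstoD(1)[OF tendsto_ident_at])
  then show "\<forall>\<^sub>F s in at t. N (\<lambda>x. (f s x - f t x) / (s - t) - h x) = N (\<lambda>x. (g s x - g t x) / (s - t) - h x)"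
    by eventually_elim (simp add: assms)
qed

lemma C1_curve_cong:
  assumes "\<And>s. s > 0 \<Longrightarrow> f s = g s"
  shows "C1_curve_with_deriv X N {0<..} f f' \<longleftrightarrow> C1_curve_with_deriv X N {0<..} g f'"
proof -
  have "has_curve_deriv N f (f' t) t \<longleftrightarrow> has_curve_deriv N g (f' t) t" if "t > 0" for t
    using assms that by (rule has_curve_deriv_cong)
  then show ?thesis using assms by (simp add: C1_curve_with_deriv_def)
qed

lemma analytic_curve_cong:
  "(\<And>s. s \<in> S \<Longrightarrow> f s = g s) \<Longrightarrow> analytic_curve X N S f \<longleftrightarrow> analytic_curve X N S g"
  unfolding analytic_curve_def by (simp cong: ball_cong)

section \<open>From curves of functions to curves of sine coefficients\<close>

lemma sine_coeff_has_derivative: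
  assumes f: "\<And>s. s > 0 \<Longrightarrow> f s \<in> L2" and g: "g \<in> L2" and t: "t > 0" and fg: "has_curve_deriv L2_norm f g t"
  shows "((\<lambda>s. sine_coeff (f s) n) has_real_derivative sine_coeff g n) (at t)"
  unfolding has_field_derivative_iff
proof (subst LIM_zero_iff[symmetric], rule Lim_null_comparison)
  have "\<forall>\<^sub>F s in at t. s > 0"
    using t by (intro order_tendstoD(1)[OF tendsto_ident_at])
  then show "\<forall>\<^sub>F s in at t. norm ((sine_coeff (f s) n - sine_coeff (f t) n) / (s - t) - sine_coeff g n)
      \<le> L2_norm (\<lambda>x. (f s x - f t x) / (s - t) - g x)"
  proof eventually_elim
    case (elim s)
    have q: "(\<lambda>x. 1 / (s - t) * (f s x - f t x)) \<in> L2"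
      by (intro L2_cmult L2_diff f elim t)
    have "\<bar>sine_coeff (\<lambda>x. 1 / (s - t) * (f s x - f t x) - g x) n\<bar> \<le> L2_norm (\<lambda>x. 1 / (s - t) * (f s x - f t x) - g x)"
      by (intro sine_coeff_le L2_diff q g)
    then show ?case
      by (simp only: sine_coeff_diff[OF q g] sine_coeff_cmult sine_coeff_diff[OF f[OF elim] f[OF t]]) simp
  qed
  show "((\<lambda>s. L2_norm (\<lambda>x. (f s x - f t x) / (s - t) - g x)) \<longlongrightarrow> 0) (at t)"
    using fg by (simp add: has_curve_deriv_def)
qed

text \<open>\<open>weak_deriv\<close> picks representatives, so it commutes with the difference
  quotient only almost everywhere. That is enough for equal norms, and one summand of the Sobolev
  norm is at most the whole.\<close>

lemma has_curve_deriv_weak_deriv: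
  assumes f: "\<And>s. s > 0 \<Longrightarrow> f s \<in> Sobolev k" and g: "g \<in> Sobolev k" and t: "t > 0"
    and fg: "has_curve_deriv (Sobolev_norm k) f g t" and j: "j \<le> k"
  shows "has_curve_deriv L2_norm (\<lambda>s. weak_deriv j (f s)) (weak_deriv j g) t"
  unfolding has_curve_deriv_def
proof (rule Lim_null_comparison)
  have "\<forall>\<^sub>F s in at t. s > 0"
    using t by (intro order_tendstoD(1)[OF tendsto_ident_at])
  then show "\<forall>\<^sub>F s in at t. norm (L2_norm (\<lambda>x. (weak_deriv j (f s) x - weak_deriv j (f t) x) / (s - t) - weak_deriv j g x))
      \<le> Sobolev_norm k (\<lambda>x. (f s x - f t x) / (s - t) - g x)"
  proof eventually_elim
    case (elim s)
    let ?\<alpha> = "1 / (s - t)"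
    let ?q = "\<lambda>x. 1 * (?\<alpha> * f s x + - ?\<alpha> * f t x) + - 1 * g x"
    let ?w = "\<lambda>x. 1 * (?\<alpha> * weak_deriv j (f s) x + - ?\<alpha> * weak_deriv j (f t) x) + - 1 * weak_deriv j g x"
    note L2 = Sobolev_L2[OF f[OF elim]] Sobolev_L2[OF f[OF t]] Sobolev_L2[OF g]
    note w = Sobolev_weak_deriv[OF f[OF elim] j] Sobolev_weak_deriv[OF f[OF t] j] Sobolev_weak_deriv[OF g j]
    have hw: "has_weak_deriv j ?q ?w"
      by (intro has_weak_deriv_lincomb L2_add L2_cmult L2 w)
    have wL2: "?w \<in> L2" by (intro L2_add L2_cmult w)
    have "L2_norm ?w = L2_norm (weak_deriv j ?q)"
      using weak_deriv_L2[OF wL2 hw] by (intro L2_norm_cong_AE wL2) (auto elim: eventually_mono)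
    also have "\<dots> \<le> Sobolev_norm k ?q" by (rule L2_norm_weak_deriv_le_Sobolev_norm[OF j])
    finally show ?case using L2_norm_nonneg by (simp add: diff_divide_distrib)
  qed
  show "((\<lambda>s. Sobolev_norm k (\<lambda>x. (f s x - f t x) / (s - t) - g x)) \<longlongrightarrow> 0) (at t)"
    using fg by (simp add: has_curve_deriv_def)
qed

lemma continuous_on_sine_coeff:
  assumes "continuous_curve L2 L2_norm S f"
  shows "continuous_on S (\<lambda>t. sine_coeff (f t) n)"
  unfolding continuous_on_def
proof (intro ballI, subst LIM_zero_iff[symmetric], rule Lim_null_comparison)
  fix t assume t: "t \<in> S"
  have f: "f s \<in> L2" if "s \<in> S" for s using assms that by (simp add: continuous_curve_def)
  have "\<forall>\<^sub>F s in at t within S. s \<in> S" by (simp add: eventually_at_filter)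
  then show "\<forall>\<^sub>F s in at t within S. norm (sine_coeff (f s) n - sine_coeff (f t) n) \<le> L2_norm (\<lambda>x. f s x - f t x)"
  proof eventually_elim
    case (elim s)
    show ?case
      using sine_coeff_le[OF L2_diff[OF f[OF elim] f[OF t]], of n]
      by (simp add: sine_coeff_diff[OF f[OF elim] f[OF t]])
  qed
  show "((\<lambda>s. L2_norm (\<lambda>x. f s x - f t x)) \<longlongrightarrow> 0) (at t within S)"
    using assms t by (simp add: continuous_curve_def)
qed

section \<open>Temperature and displacement as instances of the flow\<close>

lemma diagonal_flow_L2:
  assumes "A > 0" "B > 0" "f \<in> L2"
  shows "diagonal_flow A B f L2 L2_norm (\<lambda>n. 1) 1 1"
  by standard (use assms in \<open>auto intro: trig_series_L2 L2_norm_nonneg\<close>)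

lemma diagonal_flow_Sobolev:
  assumes "A > 0" "B > 0" "f \<in> L2"
  shows "diagonal_flow A B f (Sobolev 2) (Sobolev_norm 2) (\<lambda>n. \<kappa> / (freq n)\<^sup>2) (2 * \<bar>\<kappa>\<bar>) \<bar>\<kappa>\<bar>"
proof
  show bounded: "\<bar>\<kappa> / (freq n)\<^sup>2\<bar> \<le> \<bar>\<kappa>\<bar>" for n
  proof -
    have "1 \<le> (freq n)\<^sup>2" using freq_ge_1[of n] by (simp add: one_le_power)
    then show ?thesis by (simp add: abs_divide divide_le_eq mult_left_le_one_le mult_le_cancel_left1)
  qed
  fix a assume a: "rapid a"
  have r: "rapid (\<lambda>n. \<kappa> / (freq n)\<^sup>2 * a n)" by (rule rapid_bounded_mult[OF a bounded])
  \<comment> \<open>Two space derivatives cost \<open>(freq n)\<^sup>2\<close>, exactly the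
    denominator of the multiplier, so the norm in \<open>Sobolev 2\<close> is compared with that of
    the temperature without any loss of derivatives.\<close>
  have "(\<lambda>n. (freq n)\<^sup>2 * (\<kappa> / (freq n)\<^sup>2 * a n)) = (\<lambda>n. \<kappa> * a n)"
    using freq_pos by (auto simp: less_imp_neq[symmetric])
  then have "Sobolev_norm 2 (trig_series 0 (\<lambda>n. \<kappa> / (freq n)\<^sup>2 * a n)) \<le> 2 * L2_norm (trig_series 0 (\<lambda>n. \<kappa> * a n))"
    using Sobolev_norm_trig_series_le[OF r] by simp
  also have "trig_series 0 (\<lambda>n. \<kappa> * a n) = (\<lambda>x. \<kappa> * trig_series 0 a x)"
    using trig_series_lincomb[OF a a, of \<kappa> 0 _ 0] by auto
  also have "2 * L2_norm \<dots> = 2 * \<bar>\<kappa>\<bar> * L2_norm (trig_series 0 a)"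
    by (simp add: L2_norm_cmult)
  finally show "Sobolev_norm 2 (trig_series 0 (\<lambda>n. \<kappa> / (freq n)\<^sup>2 * a n)) \<le> 2 * \<bar>\<kappa>\<bar> * L2_norm (trig_series 0 a)" .
qed (use assms in \<open>auto intro: trig_series_Sobolev sum_nonneg simp: Sobolev_norm_def\<close>)

lemma solution_exists:
  fixes a b c d \<eta> :: real
  assumes pos: "b > 0" "d > 0" "c < 0" and \<alpha>: "a + \<eta>\<^sup>2 / c > 0" and \<theta>0: "\<theta>0 \<in> L2"
  shows "\<exists>u \<theta>. is_solution a b c d \<eta> \<theta>0 u \<theta> \<and> analytic_curve L2 L2_norm {0<..} \<theta> \<and>
    analytic_curve (Sobolev 2) (Sobolev_norm 2) {0<..} u"
proof -
  define A where "A = b / (a + \<eta>\<^sup>2 / c)"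
  define B where "B = d / (a + \<eta>\<^sup>2 / c)"
  have AB: "A > 0" "B > 0" using pos \<alpha> by (simp_all add: A_def B_def)
  interpret T: diagonal_flow A B \<theta>0 L2 L2_norm "\<lambda>n. 1" 1 1
    by (rule diagonal_flow_L2[OF AB \<theta>0])
  \<comment> \<open>In mode \<open>n\<close> the first equation reads \<open>c * freq n ^ 4 * u_n =
    - \<eta> * (freq n)\<^sup>2 * \<theta>_n\<close>, whence the multiplier.\<close>
  interpret U: diagonal_flow A B \<theta>0 "Sobolev 2" "Sobolev_norm 2" "\<lambda>n. - (\<eta> / c) / (freq n)\<^sup>2"
    "2 * \<bar>- (\<eta> / c)\<bar>" "\<bar>- (\<eta> / c)\<bar>"
    by (rule diagonal_flow_Sobolev[OF AB \<theta>0])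
  let ?F = "flow_coeff A B \<theta>0"
  \<comment> \<open>At time 0 the coefficients are only square-summable and the pointwise series
    need not converge, so the initial datum itself is inserted.\<close>
  define \<theta> where "\<theta> t = (if t > 0 then T.flow 0 t else \<theta>0)" for t
  have T_flow: "T.flow p t = trig_series 0 (?F p t)" for p t by (simp add: T.flow_def)
  have \<theta>_pos: "\<theta> t = T.flow 0 t" if "t > 0" for t using that by (simp add: \<theta>_def)
  have \<theta>_L2: "\<theta> t \<in> L2" for t using T.flow_in_X[of t 0] \<theta>0 by (simp add: \<theta>_def)
  have \<theta>_coeff: "sine_coeff (\<theta> t) n = exp (- T.r n * t) * sine_coeff \<theta>0 n" if "t \<ge> 0" for t n
    using that by (cases "t = 0") (simp_all add: \<theta>_def T_flow sine_coeff_trig_series T.rapid_flow_coeff flow_coeff_def)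
  \<comment> \<open>Time 0 is included here: without time derivatives the multipliers
    \<open>exp (- T.r n * s)\<close> lie between 0 and 1, uniformly down to
    \<open>s = 0\<close>.\<close>
  have "continuous_curve L2 L2_norm {0..} \<theta>"
    unfolding continuous_curve_def
  proof (intro conjI ballI \<theta>_L2)
    fix t :: real assume "t \<in> {0..}"
    then have t: "t \<ge> 0" by simp
    show "((\<lambda>s. L2_norm (\<lambda>x. \<theta> s x - \<theta> t x)) \<longlongrightarrow> 0) (at t within {0..})"
    proof (rule L2_norm_multiplier_tendsto_0[OF \<theta>0])
      have "\<forall>\<^sub>F s in at t within {0..}. s \<in> {0..}" by (simp add: eventually_at_filter)
      then show "\<forall>\<^sub>F s in at t within {0..}. (\<lambda>x. \<theta> s x - \<theta> t x) \<in> L2 \<and>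
          (\<forall>n. sine_coeff (\<lambda>x. \<theta> s x - \<theta> t x) n = (exp (- T.r n * s) - exp (- T.r n * t)) * sine_coeff \<theta>0 n \<and>
            \<bar>exp (- T.r n * s) - exp (- T.r n * t)\<bar> \<le> 1)"
      proof eventually_elim
        case (elim s)
        then have s: "s \<ge> 0" by simp
        have bound: "0 < exp (- T.r n * x)" "exp (- T.r n * x) \<le> 1" if "x \<ge> 0" for n x
          using T.rate_pos[of n] that by auto
        have "\<bar>exp (- T.r n * s) - exp (- T.r n * t)\<bar> \<le> 1" for n
          using bound[OF s, of n] bound[OF t, of n] by linarith
        then show ?case
          using elim t by (auto simp: sine_coeff_diff \<theta>_L2 \<theta>_coeff left_diff_distrib intro: L2_diff)
      qed
      show "((\<lambda>s. exp (- T.r n * s) - exp (- T.r n * t)) \<longlongrightarrow> 0) (at t within {0..})" for n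
        by (auto intro!: tendsto_eq_intros)
    qed
  qed
  moreover have "\<forall>t>0. \<theta> t \<in> H4_star \<and> U.flow 0 t \<in> H4_star"
    unfolding U.flow_def using trig_series_H4_star T.rapid_flow_coeff U.rapid_\<sigma>_mult
    by (intro allI impI conjI) (simp only: \<theta>_pos T_flow, blast)
  moreover have "AE x in unit_measure. \<theta> 0 x = \<theta>0 x" by (simp add: \<theta>_def)
  moreover have "C1_curve_with_deriv L2 L2_norm {0<..} \<theta> (T.flow 1)"
    using T.C1_curve_flow[of 0] C1_curve_cong[of \<theta> "T.flow 0"] \<theta>_pos by simp
  moreover have "C1_curve_with_deriv (Sobolev 2) (Sobolev_norm 2) {0<..} (U.flow 0) (U.flow 1)"
    using U.C1_curve_flow[of 0] by simp
  moreover have "(AE x in unit_measure. c * weak_deriv 4 (U.flow 0 t) x = \<eta> * weak_deriv 2 (\<theta> t) x) \<and>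
      (AE x in unit_measure. a * T.flow 1 t x =
        b * weak_deriv 2 (\<theta> t) x - d * weak_deriv 4 (\<theta> t) x - \<eta> * weak_deriv 2 (U.flow 1 t) x)" if t: "t > 0" for t
  proof
    note rF = T.rapid_flow_coeff[OF t]
    note r\<sigma> = U.rapid_\<sigma>_mult[OF rF]
    have freq0: "freq n \<noteq> 0" for n using freq_pos[of n] by simp
    have u2: "trig_series 2 (\<lambda>n. - (\<eta> / c) / (freq n)\<^sup>2 * ?F p t n) x = \<eta> / c * trig_series 0 (?F p t) x" for p x
    proof -
      have "(\<lambda>n. - ((freq n)\<^sup>2 * (- (\<eta> / c) / (freq n)\<^sup>2 * ?F p t n))) = (\<lambda>n. \<eta> / c * ?F p t n + 0 * ?F p t n)"
        using freq0 by auto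
      then show ?thesis
        using trig_series_lincomb[OF rF rF, of "\<eta> / c" 0 p x 0 p] by (simp only: trig_series_2)
    qed
    have u4: "c * trig_series 4 (\<lambda>n. - (\<eta> / c) / (freq n)\<^sup>2 * ?F 0 t n) x = \<eta> * trig_series 2 (?F 0 t) x" for x
    proof -
      have *: "(\<lambda>n. freq n ^ 4 * (- (\<eta> / c) / (freq n)\<^sup>2 * ?F 0 t n)) = (\<lambda>n. \<eta> / c * - ((freq n)\<^sup>2 * ?F 0 t n) + 0 * ?F 0 t n)"
        using freq0 by (auto simp: power4_eq_xxxx power2_eq_square)
      have "rapid (\<lambda>n. - ((freq n)\<^sup>2 * ?F 0 t n))"
        using rapid_cmult[OF rapid_freq_mult[OF rF], of "-1"] by simp
      from trig_series_lincomb[OF this rF, of "\<eta> / c" 0 x 0 0] show ?thesis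
        using pos unfolding trig_series_4 trig_series_2 * by (simp add: field_simps)
    qed
    have "AE x in unit_measure. weak_deriv 4 (U.flow 0 t) x = trig_series 4 (\<lambda>n. - (\<eta> / c) / (freq n)\<^sup>2 * ?F 0 t n) x"
      unfolding U.flow_def by (rule weak_deriv_trig_series(1)[OF r\<sigma>])
    moreover have \<theta>2: "AE x in unit_measure. weak_deriv 2 (\<theta> t) x = trig_series 2 (?F 0 t) x"
      unfolding \<theta>_pos[OF t] T_flow by (rule weak_deriv_trig_series(1)[OF rF])
    ultimately show "AE x in unit_measure. c * weak_deriv 4 (U.flow 0 t) x = \<eta> * weak_deriv 2 (\<theta> t) x"
      by eventually_elim (simp only: u4)
    have \<theta>4: "AE x in unit_measure. weak_deriv 4 (\<theta> t) x = trig_series 4 (?F 0 t) x"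
      unfolding \<theta>_pos[OF t] T_flow by (rule weak_deriv_trig_series(1)[OF rF])
    have U2: "AE x in unit_measure. weak_deriv 2 (U.flow 1 t) x = trig_series 2 (\<lambda>n. - (\<eta> / c) / (freq n)\<^sup>2 * ?F 1 t n) x"
      unfolding U.flow_def by (rule weak_deriv_trig_series(1)[OF r\<sigma>])
    have eq: "(a + \<eta>\<^sup>2 / c) * trig_series 0 (?F 1 t) x = b * trig_series 2 (?F 0 t) x - d * trig_series 4 (?F 0 t) x" for x
    proof -
      have r2: "rapid (\<lambda>n. - ((freq n)\<^sup>2 * ?F 0 t n))"
        using rapid_cmult[OF rapid_freq_mult[OF rF], of "-1"] by simp
      have r4: "rapid (\<lambda>n. freq n ^ 4 * ?F 0 t n)" by (rule rapid_freq_mult[OF rF])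
      have "(a + \<eta>\<^sup>2 / c) * ?F 1 t n = b * - ((freq n)\<^sup>2 * ?F 0 t n) + - d * (freq n ^ 4 * ?F 0 t n)" for n
      proof -
        have "(a + \<eta>\<^sup>2 / c) * decay_rate A B n = b * (freq n)\<^sup>2 + d * freq n ^ 4"
          using \<alpha> by (simp add: decay_rate_def A_def B_def distrib_left)
        moreover have "?F 1 t n = - decay_rate A B n * ?F 0 t n" by (simp add: flow_coeff_def)
        ultimately have "(a + \<eta>\<^sup>2 / c) * ?F 1 t n = - (b * (freq n)\<^sup>2 + d * freq n ^ 4) * ?F 0 t n"
          by (metis mult.assoc mult_minus_right)
        then show ?thesis by (simp add: algebra_simps)
      qed
      then have "(\<lambda>n. (a + \<eta>\<^sup>2 / c) * ?F 1 t n + 0 * ?F 1 t n) = (\<lambda>n. b * - ((freq n)\<^sup>2 * ?F 0 t n) + - d * (freq n ^ 4 * ?F 0 t n))"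
        by simp
      then show ?thesis
        using trig_series_lincomb[OF rF rF, of "a + \<eta>\<^sup>2 / c" 0 1 x 0 1] trig_series_lincomb[OF r2 r4, of b 0 x "- d"]
        by (simp only: trig_series_2 trig_series_4)
    qed
    show "AE x in unit_measure. a * T.flow 1 t x =
        b * weak_deriv 2 (\<theta> t) x - d * weak_deriv 4 (\<theta> t) x - \<eta> * weak_deriv 2 (U.flow 1 t) x"
      using \<theta>2 \<theta>4 U2
    proof eventually_elim
      case (elim x)
      \<comment> \<open>The coupling term: the second space derivative of the time derivative of the
        displacement is \<open>\<eta> / c\<close> times that of the temperature, so it shifts
        \<open>a\<close> to \<open>a + \<eta>\<^sup>2 / c\<close>.\<close>
      have "a * trig_series 0 (?F 1 t) x = (a + \<eta>\<^sup>2 / c) * trig_series 0 (?F 1 t) x - \<eta> * (\<eta> / c * trig_series 0 (?F 1 t) x)"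
        by (simp add: distrib_right power2_eq_square)
      then show ?case unfolding elim u2 eq T_flow .
    qed
  qed
  ultimately have "is_solution a b c d \<eta> \<theta>0 (U.flow 0) \<theta>"
    unfolding is_solution_def by blast
  moreover have "analytic_curve L2 L2_norm {0<..} \<theta>"
    using T.analytic_curve_flow analytic_curve_cong[of "{0<..}" \<theta> "T.flow 0"] \<theta>_pos by simp
  ultimately show ?thesis using U.analytic_curve_flow by blast
qed

section \<open>Decay of an arbitrary solution\<close>

lemma exponential_decay_ODE:
  fixes y :: "real \<Rightarrow> real"
  assumes cont: "continuous_on {0..} y"
    and deriv: "\<And>t. t > 0 \<Longrightarrow> (y has_real_derivative - r * y t) (at t)" and t: "t > 0"
  shows "y t = exp (- r * t) * y 0"
proof -
  \<comment> \<open>With the integrating factor the function is constant on \<open>{0..t}\<close>.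
    The derivative is used only in the interior, and continuity carries the value to time 0, where a
    solution need not be differentiable.\<close>
  have "exp (r * t) * y t = exp (r * 0) * y 0"
  proof (rule DERIV_isconst_end[OF t])
    show "continuous_on {0..t} (\<lambda>t. exp (r * t) * y t)"
      by (intro continuous_intros continuous_on_subset[OF cont]) auto
    show "((\<lambda>t. exp (r * t) * y t) has_real_derivative 0) (at x)" if "0 < x" "x < t" for x
      by (rule derivative_eq_intros deriv[OF that(1)] refl | simp)+
  qed
  then show ?thesis by (simp add: exp_minus field_simps)
qed

lemma solution_decay:
  fixes a b c d \<eta> :: real
  assumes pos: "b > 0" "d > 0" "c < 0" and \<alpha>: "a + \<eta>\<^sup>2 / c > 0" and \<theta>0: "\<theta>0 \<in> L2"
    and sol: "is_solution a b c d \<eta> \<theta>0 u \<theta>" and t: "t > 0"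
  shows "L2_norm (\<theta> t) + Sobolev_norm 2 (u t)
    \<le> (1 + 2 * \<bar>\<eta> / c\<bar>) * exp (- (b / (a + \<eta>\<^sup>2 / c)) * t) * L2_norm \<theta>0"
proof -
  define A where "A = b / (a + \<eta>\<^sup>2 / c)"
  define B where "B = d / (a + \<eta>\<^sup>2 / c)"
  have AB: "A > 0" "B > 0" using pos \<alpha> by (simp_all add: A_def B_def)
  \<comment> \<open>This instance supplies only facts about the rates; the solution itself is
    arbitrary.\<close>
  interpret T: diagonal_flow A B \<theta>0 L2 L2_norm "\<lambda>n. 1" 1 1
    by (rule diagonal_flow_L2[OF AB \<theta>0])
  have cont: "continuous_curve L2 L2_norm {0..} \<theta>" and init: "AE x in unit_measure. \<theta> 0 x = \<theta>0 x"
    and H4: "\<And>t. t > 0 \<Longrightarrow> \<theta> t \<in> H4_star" "\<And>t. t > 0 \<Longrightarrow> u t \<in> H4_star"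
    using sol by (auto simp: is_solution_def)
  obtain \<theta>' u' where C1: "C1_curve_with_deriv L2 L2_norm {0<..} \<theta> \<theta>'"
      "C1_curve_with_deriv (Sobolev 2) (Sobolev_norm 2) {0<..} u u'"
    and eq1: "\<And>t. t > 0 \<Longrightarrow> AE x in unit_measure. c * weak_deriv 4 (u t) x = \<eta> * weak_deriv 2 (\<theta> t) x"
    and eq2: "\<And>t. t > 0 \<Longrightarrow> AE x in unit_measure. a * \<theta>' t x =
        b * weak_deriv 2 (\<theta> t) x - d * weak_deriv 4 (\<theta> t) x - \<eta> * weak_deriv 2 (u' t) x"
    using sol unfolding is_solution_def by blast
  have L2: "\<theta> t \<in> L2" if "t \<ge> 0" for t using cont that by (simp add: continuous_curve_def)
  have \<theta>': "\<theta>' t \<in> L2" "has_curve_deriv L2_norm \<theta> (\<theta>' t) t" if "t > 0" for t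
    using C1(1) that by (auto simp: C1_curve_with_deriv_def continuous_curve_def)
  have u': "u' t \<in> Sobolev 2" "has_curve_deriv (Sobolev_norm 2) u (u' t) t" "u t \<in> Sobolev 2" if "t > 0" for t
    using C1(2) that by (auto simp: C1_curve_with_deriv_def continuous_curve_def)
  note \<theta>H = H4_star_Sobolev_2[OF H4(1)] and uH = H4_star_Sobolev_2[OF H4(2)]
  have w2\<theta>: "weak_deriv 2 (\<theta> t) \<in> L2" and w2u: "weak_deriv 2 (u t) \<in> L2" and w2u': "weak_deriv 2 (u' t) \<in> L2"
    if "t > 0" for t
    using that by (auto intro: Sobolev_weak_deriv(1) \<theta>H(1) u')
  \<comment> \<open>The first equation integrated twice, mode by mode: both sides carry a common
    factor \<open>(freq n)\<^sup>2\<close>, which is nonzero and cancels.\<close>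
  have coeff_u: "sine_coeff (weak_deriv 2 (u t)) n = \<eta> / c * sine_coeff (\<theta> t) n" if t: "t > 0" for t n
  proof -
    have "c * sine_coeff (weak_deriv 4 (u t)) n = \<eta> * sine_coeff (weak_deriv 2 (\<theta> t)) n"
      using sine_coeff_cong_AE[OF L2_cmult[OF uH(8)[OF t]] L2_cmult[OF w2\<theta>[OF t]] eq1[OF t], of n]
      by (simp add: sine_coeff_cmult)
    then have "(freq n)\<^sup>2 * (c * - ((freq n)\<^sup>2 * sine_coeff (u t) n)) = (freq n)\<^sup>2 * (\<eta> * sine_coeff (\<theta> t) n)"
      using t by (simp add: sine_coeff_weak_deriv_4 H4 sine_coeff_weak_deriv_2 \<theta>H power4_eq_xxxx power2_eq_square algebra_simps)
    then have "c * - ((freq n)\<^sup>2 * sine_coeff (u t) n) = \<eta> * sine_coeff (\<theta> t) n"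
      using freq_pos[of n] by (subst (asm) mult_left_cancel) auto
    then show ?thesis
      using t pos by (simp add: sine_coeff_weak_deriv_2 uH field_simps)
  qed
  have ODE: "((\<lambda>t. sine_coeff (\<theta> t) n) has_real_derivative - T.r n * sine_coeff (\<theta> t) n) (at t)" if t: "t > 0" for t n
  proof -
    have dT: "((\<lambda>t. sine_coeff (\<theta> t) n) has_real_derivative sine_coeff (\<theta>' t) n) (at t)"
      by (rule sine_coeff_has_derivative) (use t L2 \<theta>' in auto)
    \<comment> \<open>No boundary values of \<open>u' t\<close> are available, so integration by
      parts does not apply to it. The coefficient of the second derivative of \<open>u\<close> is
      differentiated in time in two ways, directly and through \<open>coeff_u\<close>, and the
      results must agree.\<close>
    have "((\<lambda>s. sine_coeff (weak_deriv 2 (u s)) n) has_real_derivative sine_coeff (weak_deriv 2 (u' t)) n) (at t)"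
      by (rule sine_coeff_has_derivative has_curve_deriv_weak_deriv)+ (use t w2u w2u' u' has_curve_deriv_weak_deriv[of u 2] in auto)
    moreover have "\<forall>\<^sub>F s in nhds t. sine_coeff (weak_deriv 2 (u s)) n = \<eta> / c * sine_coeff (\<theta> s) n"
      using eventually_nhds_in_open[of "{0<..}" t] t by (auto elim!: eventually_mono simp: coeff_u)
    ultimately have "((\<lambda>s. \<eta> / c * sine_coeff (\<theta> s) n) has_real_derivative sine_coeff (weak_deriv 2 (u' t)) n) (at t)"
      by (rule DERIV_cong_ev[OF refl _ refl, THEN iffD1, rotated])
    then have dU: "sine_coeff (weak_deriv 2 (u' t)) n = \<eta> / c * sine_coeff (\<theta>' t) n"
      using DERIV_unique[OF _ DERIV_cmult[OF dT]] by blast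
    have "a * sine_coeff (\<theta>' t) n = b * sine_coeff (weak_deriv 2 (\<theta> t)) n
        - d * sine_coeff (weak_deriv 4 (\<theta> t)) n - \<eta> * sine_coeff (weak_deriv 2 (u' t)) n"
    proof -
      have 1: "(\<lambda>x. b * weak_deriv 2 (\<theta> t) x - d * weak_deriv 4 (\<theta> t) x) \<in> L2"
        by (intro L2_diff L2_cmult w2\<theta> \<theta>H t)
      have "sine_coeff (\<lambda>x. a * \<theta>' t x) n =
          sine_coeff (\<lambda>x. b * weak_deriv 2 (\<theta> t) x - d * weak_deriv 4 (\<theta> t) x - \<eta> * weak_deriv 2 (u' t) x) n"
        by (intro sine_coeff_cong_AE eq2 t L2_cmult \<theta>' L2_diff 1 w2u')
      then show ?thesis
        using t by (simp add: sine_coeff_cmult sine_coeff_diff 1 L2_cmult w2\<theta> \<theta>H w2u')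
    qed
    then have "(a + \<eta>\<^sup>2 / c) * sine_coeff (\<theta>' t) n = - (b * (freq n)\<^sup>2 + d * freq n ^ 4) * sine_coeff (\<theta> t) n"
      using t unfolding dU
      by (simp add: sine_coeff_weak_deriv_4 H4 sine_coeff_weak_deriv_2 \<theta>H power2_eq_square algebra_simps)
    moreover have "(a + \<eta>\<^sup>2 / c) * T.r n = b * (freq n)\<^sup>2 + d * freq n ^ 4"
      using \<alpha> by (simp add: decay_rate_def A_def B_def distrib_left)
    ultimately have "(a + \<eta>\<^sup>2 / c) * sine_coeff (\<theta>' t) n = (a + \<eta>\<^sup>2 / c) * (- T.r n * sine_coeff (\<theta> t) n)"
      by (metis mult.assoc mult_minus_right)
    then have "sine_coeff (\<theta>' t) n = - T.r n * sine_coeff (\<theta> t) n"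
      using \<alpha> by (subst (asm) mult_left_cancel) auto
    then show ?thesis using dT by simp
  qed
  have "\<bar>sine_coeff (\<theta> t) n\<bar> \<le> exp (- A * t) * \<bar>sine_coeff \<theta>0 n\<bar>" for n
  proof -
    have "sine_coeff (\<theta> t) n = exp (- T.r n * t) * sine_coeff (\<theta> 0) n"
      by (rule exponential_decay_ODE[OF continuous_on_sine_coeff[OF cont] ODE t])
    moreover have "sine_coeff (\<theta> 0) n = sine_coeff \<theta>0 n"
      by (rule sine_coeff_cong_AE[OF L2 \<theta>0 init]) simp
    \<comment> \<open>The slowest mode is bounded through \<open>freq n \<ge> 1\<close>, which is
      where the decay exponent comes from.\<close>
    moreover have "A * 1 \<le> T.r n"
      using mult_left_mono[OF freq_ge_1[of n], of A] AB T.rate_ge[of n] by linarith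
    then have "exp (- T.r n * t) \<le> exp (- A * t)" using t by simp
    ultimately show ?thesis by (simp add: abs_mult mult_right_mono)
  qed
  then have \<theta>_le: "L2_norm (\<theta> t) \<le> exp (- A * t) * L2_norm \<theta>0"
    using t by (intro L2_norm_le_sine_coeff L2 \<theta>0) auto
  \<comment> \<open>The displacement contributes \<open>2 * \<bar>\<eta> / c\<bar>\<close>: the 2
    from the Sobolev norm, the ratio from \<open>coeff_u\<close>.\<close>
  have "Sobolev_norm 2 (u t) \<le> 2 * L2_norm (weak_deriv 2 (u t))"
    using t by (intro Sobolev_norm_2_le uH)
  also have "L2_norm (weak_deriv 2 (u t)) \<le> \<bar>\<eta> / c\<bar> * L2_norm (\<theta> t)"
    using t by (intro L2_norm_le_sine_coeff L2 w2u) (auto simp: coeff_u abs_mult)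
  finally have "L2_norm (\<theta> t) + Sobolev_norm 2 (u t) \<le> (1 + 2 * \<bar>\<eta> / c\<bar>) * L2_norm (\<theta> t)"
    by (simp add: distrib_right)
  also have "\<dots> \<le> (1 + 2 * \<bar>\<eta> / c\<bar>) * (exp (- A * t) * L2_norm \<theta>0)"
    by (intro mult_left_mono \<theta>_le) auto
  finally show ?thesis by (simp add: A_def mult.assoc)
qed

theorem theorem7p1:
  fixes a b c d \<eta> :: real
  assumes "a > 0" and "b > 0" and "d > 0" and "\<eta> \<noteq> 0" and "c < 0"
    and "a > - (\<eta>\<^sup>2 / c)"
  shows "(\<forall>\<theta>0\<in>L2. \<exists>u \<theta>. is_solution a b c d \<eta> \<theta>0 u \<theta> \<and>
            analytic_curve L2 L2_norm {0<..} \<theta> \<and>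
            analytic_curve (Sobolev 2) (Sobolev_norm 2) {0<..} u) \<and>
         (\<exists>M>0. \<exists>\<omega>>0. \<forall>\<theta>0\<in>L2. \<forall>u \<theta>. is_solution a b c d \<eta> \<theta>0 u \<theta> \<longrightarrow>
            (\<forall>t>0. L2_norm (\<theta> t) + Sobolev_norm 2 (u t) \<le> M * exp (- \<omega> * t) * L2_norm \<theta>0))"
proof
  have \<alpha>: "a + \<eta>\<^sup>2 / c > 0" using assms(6) by linarith
  show "\<forall>\<theta>0\<in>L2. \<exists>u \<theta>. is_solution a b c d \<eta> \<theta>0 u \<theta> \<and> analytic_curve L2 L2_norm {0<..} \<theta> \<and>
      analytic_curve (Sobolev 2) (Sobolev_norm 2) {0<..} u"
    using solution_exists[OF assms(2,3,5) \<alpha>] by blast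
  show "\<exists>M>0. \<exists>\<omega>>0. \<forall>\<theta>0\<in>L2. \<forall>u \<theta>. is_solution a b c d \<eta> \<theta>0 u \<theta> \<longrightarrow>
      (\<forall>t>0. L2_norm (\<theta> t) + Sobolev_norm 2 (u t) \<le> M * exp (- \<omega> * t) * L2_norm \<theta>0)"
  proof (intro exI conjI ballI allI impI)
    show "1 + 2 * \<bar>\<eta> / c\<bar> > 0" by (intro add_pos_nonneg) auto
    show "b / (a + \<eta>\<^sup>2 / c) > 0" using assms(2) \<alpha> by simp
  qed (rule solution_decay[OF assms(2,3,5) \<alpha>])
qed

end
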